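(* Let $n\ge2$, $m\ge1$ be integers, $k=n-1$. For $(z,w),(\zeta,\eta)\in E_{n,m}$ let $$X=X((z,w),(\zeta,\eta))=\frac{w\bar\eta}{(1-\langle z,\zeta\rangle)^{1/m}},$$ where the principal branch of $(1-\langle z,\zeta\rangle)^{1/m}$ is used. Then the Fefferman--Szegő kernel of $E_{n,m}$ is $$S_{n,m}((z,w),(\zeta,\eta))=C_{n,m}\,(1-\langle z,\zeta\rangle)^{-k-\mu_{n,m}}\,\frac{P_{k,\mu_{n,m}}(X)}{(1-X)^n},$$ where $\mu_{n,m}=\frac{n+m}{m(n+1)}$, $C_{n,m}=\frac{m^{1-2/(n+1)}}{\pi^n}$, and $P_{k,\mu_{n,m}}$ is the polynomial of degree at most $k$ given in the context.
   Context: $E_{n,m}=\{(z,w)\in\mathbb C^{k}\times\mathbb C: |z|^2+|w|^{2m}<1\}$, $\langle z,\zeta\rangle=\sum_{j=1}^k z_j\bar\zeta_j$; fractional powers of $1-\langle z,\zeta\rangle$ use the principal branch. Let $(a)_j=a(a+1)\cdots(a+j-1)$. For $\mu>0$, $P_{k,\mu}$ denotes the polynomial of degree at most $k$ determined by $$\sum_{\beta=0}^\infty(\mu+\beta/m)_k X^\beta=\frac{P_{k,\mu}(X)}{(1-X)^{k+1}},\qquad |X|<1 .$$ The Fefferman--Szegő kernel $S_{n,m}$: with $\rho(z,w)=|z|^2+|w|^{2m}-1$, let $M(\rho)=-\det\begin{pmatrix}0&\rho_{\bar \ell}\\ \rho_j&\rho_{j\bar \ell}\end{pmatrix}_{1\le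 j,\ell\le n}$ be the $(n+1)\times(n+1)$ complex bordered Hessian determinant on $\partial E_{n,m}$, and $d\mu_F=M(\rho)^{1/(n+1)}\,d\sigma/|\nabla\rho|$ with $d\sigma$ Euclidean hypersurface measure and $|\nabla\rho|$ the Euclidean length of the real gradient. $H_F^2(E_{n,m})$ is the closure in $L^2(\partial E_{n,m},d\mu_F)$ of the holomorphic functions defined in a neighbourhood of $\overline{E_{n,m}}$; it is a reproducing-kernel Hilbert space of functions on $E_{n,m}$ and $S_{n,m}$ is its reproducing kernel: $f(q)=\langle f,S_{n,m}(\cdot,q)\rangle_{L^2(d\mu_F)}$. *)

theory Defs
  imports "HOL-Analysis.Analysis" "HOL-Computational_Algebra.Polynomial"
begin

text \<open>Points \<open>(z, w)\<close> of \<open>\<complex>\<^sup>k \<times> \<complex> = \<complex>\<^sup>n\<close>, where \<open>k = CARD('k)\<close> and \<open>n = k + 1\<close>; the Euclidean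
  structure of the type is that of \<open>\<real>\<^sup>2\<^sup>n\<close>.\<close>

type_synonym 'k cpoint = "(complex ^ 'k) \<times> complex"

definition egg_defining :: "nat \<Rightarrow> ('k::finite) cpoint \<Rightarrow> real" where
  "egg_defining m = (\<lambda>(z, w). (norm z)\<^sup>2 + cmod w ^ (2 * m) - 1)"

definition egg :: "nat \<Rightarrow> ('k::finite) cpoint set" where
  "egg m = {(z, w). (norm z)\<^sup>2 + cmod w ^ (2 * m) < 1}"

definition herm :: "complex ^ ('k::finite) \<Rightarrow> complex ^ 'k \<Rightarrow> complex" where
  "herm z \<zeta> = (\<Sum>j\<in>UNIV. z $ j * cnj (\<zeta> $ j))"


subsection \<open>The bordered complex Hessian\<close>

text \<open>The \<open>n\<close> complex coordinates are indexed by \<open>'k option\<close>: \<open>Some j\<close> stands for \<open>z\<^sub>j\<close> and \<open>None\<close>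
  for \<open>w\<close>.\<close>

definition coord_vec :: "('k::finite) option \<Rightarrow> complex \<Rightarrow> 'k cpoint" where
  "coord_vec a c = (case a of None \<Rightarrow> (0, c) | Some j \<Rightarrow> (axis j c, 0))"

definition wirtinger :: "('k::finite) option \<Rightarrow> ('k cpoint \<Rightarrow> complex) \<Rightarrow> 'k cpoint \<Rightarrow> complex" where
  "wirtinger a f p =
     (frechet_derivative f (at p) (coord_vec a 1)
      - \<i> * frechet_derivative f (at p) (coord_vec a \<i>)) / 2"

definition wirtinger_bar :: "('k::finite) option \<Rightarrow> ('k cpoint \<Rightarrow> complex) \<Rightarrow> 'k cpoint \<Rightarrow> complex"
  where
  "wirtinger_bar a f p =
     (frechet_derivative f (at p) (coord_vec a 1)
      + \<i> * frechet_derivative f (at p) (coord_vec a \<i>)) / 2"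

text \<open>In the bordered matrix, of size \<open>n + 1 = CARD('k option option)\<close>, the index \<open>None\<close> is the
  border.\<close>

definition bordered_hessian ::
  "(('k::finite) cpoint \<Rightarrow> real) \<Rightarrow> 'k cpoint \<Rightarrow> complex ^ 'k option option ^ 'k option option" where
  "bordered_hessian \<rho> p =
     (let r = (\<lambda>q. complex_of_real (\<rho> q)) in
      \<chi> a b. case a of
          None \<Rightarrow> (case b of None \<Rightarrow> 0 | Some l \<Rightarrow> wirtinger_bar l r p)
        | Some j \<Rightarrow> (case b of None \<Rightarrow> wirtinger j r p
                             | Some l \<Rightarrow> wirtinger j (wirtinger_bar l r) p))"

text \<open>The bordered matrix of a real function is Hermitian, so its determinant is real.\<close>

definition fefferman_M :: "(('k::finite) cpoint \<Rightarrow> real) \<Rightarrow> 'k cpoint \<Rightarrow> real" where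
  "fefferman_M \<rho> p = - Re (det (bordered_hessian \<rho> p))"

definition real_gradient :: "('a::euclidean_space \<Rightarrow> real) \<Rightarrow> 'a \<Rightarrow> 'a" where
  "real_gradient f p = (\<Sum>b\<in>Basis. frechet_derivative f (at p) b *\<^sub>R b)"


subsection \<open>Euclidean hypersurface measure\<close>

text \<open>Parameter domains of hypersurfaces in \<open>\<complex>\<^sup>k \<times> \<complex>\<close> are open sets of \<open>\<real>\<^sup>2\<^sup>k\<^sup>+\<^sup>1\<close>.\<close>

type_synonym 'k hparam = "real ^ ('k + 'k + unit)"

definition gram_jacobian :: "(real ^ ('d::finite) \<Rightarrow> 'a::real_inner) \<Rightarrow> real" where
  "gram_jacobian D = sqrt (det (\<chi> i j. D (axis i 1) \<bullet> D (axis j 1) :: real ^ 'd ^ 'd))"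

definition regular_patch ::
  "('k::finite) cpoint set \<Rightarrow> 'k hparam set \<Rightarrow> ('k hparam \<Rightarrow> 'k cpoint)
   \<Rightarrow> ('k hparam \<Rightarrow> 'k hparam \<Rightarrow> 'k cpoint) \<Rightarrow> bool" where
  "regular_patch S U \<phi> D \<longleftrightarrow>
     open U \<and> inj_on \<phi> U \<and> \<phi> ` U \<subseteq> S \<and>
     (\<forall>u\<in>U. (\<phi> has_derivative D u) (at u) \<and> inj (D u)) \<and>
     (\<forall>v. continuous_on U (\<lambda>u. D u v))"

text \<open>The surface measure of \<open>S\<close> is the Borel measure on \<open>S\<close> given in every injective regular \<open>C\<^sup>1\<close>
  parametrization by the square root of the Gram determinant. It is unique whenever \<open>S\<close> is covered by
  countably many such patches, in particular for \<open>C\<^sup>1\<close> hypersurfaces.\<close>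

definition is_surface_measure :: "('k::finite) cpoint set \<Rightarrow> 'k cpoint measure \<Rightarrow> bool" where
  "is_surface_measure S \<sigma> \<longleftrightarrow>
     sets \<sigma> = sets (restrict_space borel S) \<and>
     (\<forall>U \<phi> D. regular_patch S U \<phi> D \<longrightarrow>
        (\<forall>B\<in>sets \<sigma>. B \<subseteq> \<phi> ` U \<longrightarrow>
           emeasure \<sigma> B =
             (\<integral>\<^sup>+u. indicator U u * indicator B (\<phi> u) * ennreal (gram_jacobian (D u)) \<partial>lborel)))"

definition surface_measure :: "('k::finite) cpoint set \<Rightarrow> 'k cpoint measure" where
  "surface_measure S = (THE \<sigma>. is_surface_measure S \<sigma>)"

text \<open>The exponent is \<open>1 / (n + 1)\<close>. Note that \<open>M\<close> vanishes where \<open>w = 0\<close> if \<open>m > 1\<close>; there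
  \<open>0 powr _ = 0\<close> is the intended value.\<close>

definition fefferman_measure :: "nat \<Rightarrow> ('k::finite) cpoint measure" where
  "fefferman_measure m =
     density (surface_measure (frontier (egg m)))
       (\<lambda>p. ennreal (fefferman_M (egg_defining m) p powr (1 / (real CARD('k) + 2))
                     / norm (real_gradient (egg_defining m) p)))"


subsection \<open>The Hardy space and its reproducing kernel\<close>

definition holomorphic_several :: "(('k::finite) cpoint \<Rightarrow> complex) \<Rightarrow> 'k cpoint set \<Rightarrow> bool" where
  "holomorphic_several f U \<longleftrightarrow>
     (\<forall>p\<in>U. \<exists>D. (f has_derivative D) (at p) \<and>
        (\<forall>c z w. D (c *s z, c * w) = c * D (z, w)))"

definition holomorphic_near_closure :: "nat \<Rightarrow> (('k::finite) cpoint \<Rightarrow> complex) set" where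
  "holomorphic_near_closure m =
     {f. \<exists>U. open U \<and> closure (egg m) \<subseteq> U \<and> holomorphic_several f U}"

definition square_integrable :: "'a measure \<Rightarrow> ('a \<Rightarrow> complex) \<Rightarrow> bool" where
  "square_integrable M g \<longleftrightarrow> g \<in> borel_measurable M \<and> integrable M (\<lambda>x. (cmod (g x))\<^sup>2)"

definition L2_converges :: "'a measure \<Rightarrow> (nat \<Rightarrow> 'a \<Rightarrow> complex) \<Rightarrow> ('a \<Rightarrow> complex) \<Rightarrow> bool" where
  "L2_converges M f g \<longleftrightarrow> (\<lambda>j. \<integral>\<^sup>+x. ennreal ((cmod (f j x - g x))\<^sup>2) \<partial>M) \<longlonglongrightarrow> 0"

definition L2_inner :: "'a measure \<Rightarrow> ('a \<Rightarrow> complex) \<Rightarrow> ('a \<Rightarrow> complex) \<Rightarrow> complex" where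
  "L2_inner M f g = (LINT x|M. f x * cnj (g x))"

text \<open>An element of \<open>H\<^sub>F\<^sup>2\<close> is an \<open>L\<^sup>2\<close> limit \<open>g\<close>, living on the boundary, of functions holomorphic near
  the closed domain; the function \<open>F\<close> on the domain that it represents is the pointwise limit there
  of the approximating functions. \<open>hardy_pair m F g\<close> says that \<open>g\<close> is in \<open>H\<^sub>F\<^sup>2\<close> and represents \<open>F\<close>.
  Only the values of \<open>F\<close> on \<open>egg m\<close> and those of \<open>g\<close> on the boundary (up to null sets) matter.\<close>

definition hardy_pair ::
  "nat \<Rightarrow> (('k::finite) cpoint \<Rightarrow> complex) \<Rightarrow> ('k cpoint \<Rightarrow> complex) \<Rightarrow> bool" where
  "hardy_pair m F g \<longleftrightarrow>
     square_integrable (fefferman_measure m) g \<and>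
     (\<exists>f. (\<forall>j. f j \<in> holomorphic_near_closure m) \<and>
          L2_converges (fefferman_measure m) f g \<and>
          (\<forall>q\<in>egg m. (\<lambda>j. f j q) \<longlonglongrightarrow> F q))"

text \<open>The first argument of the kernel is the holomorphic one. Such a kernel is unique on
  \<open>egg m \<times> egg m\<close>: if \<open>s\<^sub>q\<close> represents \<open>S(\<cdot>, q)\<close>, then \<open>S(p, q) = \<langle>s\<^sub>q, s\<^sub>p\<rangle>\<close>. Its values
  elsewhere are unconstrained.\<close>

definition is_fefferman_szego_kernel ::
  "nat \<Rightarrow> (('k::finite) cpoint \<Rightarrow> 'k cpoint \<Rightarrow> complex) \<Rightarrow> bool" where
  "is_fefferman_szego_kernel m S \<longleftrightarrow>
     (\<forall>q\<in>egg m. \<exists>s. hardy_pair m (\<lambda>p. S p q) s \<and>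
        (\<forall>F g. hardy_pair m F g \<longrightarrow> F q = L2_inner (fefferman_measure m) g s))"

definition fefferman_szego_kernel :: "nat \<Rightarrow> ('k::finite) cpoint \<Rightarrow> 'k cpoint \<Rightarrow> complex" where
  "fefferman_szego_kernel m = (SOME S. is_fefferman_szego_kernel m S)"


subsection \<open>The data of the explicit formula\<close>

text \<open>\<open>P\<^sub>k\<^sub>,\<^sub>\<mu>\<close>, which also depends on \<open>m\<close>, taken with complex coefficients.\<close>

definition P_poly :: "nat \<Rightarrow> nat \<Rightarrow> real \<Rightarrow> complex poly" where
  "P_poly m k \<mu> =
     (THE P. degree P \<le> k \<and>
        (\<forall>X. cmod X < 1 \<longrightarrow>
           (\<lambda>\<beta>. complex_of_real (pochhammer (\<mu> + real \<beta> / real m) k) * X ^ \<beta>)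
             sums (poly P X / (1 - X) ^ (k + 1))))"

definition mu_egg :: "nat \<Rightarrow> nat \<Rightarrow> real" where
  "mu_egg n m = (real n + real m) / (real m * (real n + 1))"

definition C_egg :: "nat \<Rightarrow> nat \<Rightarrow> real" where
  "C_egg n m = real m powr (1 - 2 / (real n + 1)) / pi ^ n"

definition X_egg :: "nat \<Rightarrow> ('k::finite) cpoint \<Rightarrow> 'k cpoint \<Rightarrow> complex" where
  "X_egg m = (\<lambda>(z, w) (\<zeta>, \<eta>). w * cnj \<eta> / (1 - herm z \<zeta>) powr complex_of_real (1 / real m))"

end

theory Submission
  imports Defs "HOL-Complex_Analysis.Complex_Analysis"
begin

text \<open>Write \<open>\<mu> = \<mu>\<^sub>n\<^sub>,\<^sub>m\<close>, let \<open>B\<close> be the unit ball of \<open>\<complex>\<^sup>k\<close> and put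
  \<open>R(z) = (1 - |z|\<^sup>2)\<^bsup>1/2m\<^esup>\<close>, the radius of the disc of the domain over \<open>z\<close>. The boundary is, up to a
  null set, parametrized by \<open>(z, R(z) cis t)\<close> with \<open>z \<in> B\<close> and \<open>-\<pi> < t < \<pi>\<close>. In these coordinates
  the Gram determinant of the parametrization, the power of the bordered Hessian and the length of
  the gradient combine to a constant times \<open>(1 - |z|\<^sup>2)\<^bsup>\<mu>-1\<^esup>\<close> (\<open>polar_jacobian_eq\<close>,
  \<open>integral_fefferman_measure\<close>): integration against \<open>\<mu>\<^sub>F\<close> is a circle mean in the last variable
  followed by a weighted integral over the ball. Most of the geometric work is in showing that the
  surface measure exists and that it is given by the Gram determinant of this one patch
  (\<open>surface_measure_from_atlas\<close>, \<open>nn_integral_fefferman_measure\<close>).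

  Next comes the reproducing property for a function \<open>f\<close> that is holomorphic near the closed domain.
  Expanding \<open>P\<^sub>k\<^sub>,\<^sub>\<mu>(X)/(1-X)\<^sup>n\<close> in powers of \<open>X\<close> and then each power of \<open>1 - \<langle>z, \<zeta>\<rangle>\<close> in powers of
  \<open>\<langle>z, \<zeta>\<rangle>\<close> writes the conjugate of the kernel as a series of multiples of
  \<open>cnj w^g * \<langle>\<zeta>, z\<rangle>^M\<close>. The circle mean picks out the coefficient \<open>a\<^sub>g(z)\<close> of \<open>w^g\<close> in \<open>f(z, w)\<close>, and
  what remains is the integral over \<open>B\<close> of \<open>a\<^sub>g(z) \<langle>\<zeta>, z\<rangle>^M (1 - |z|\<^sup>2)\<^bsup>s\<^esup>\<close> with
  \<open>s = \<mu> - 1 + g/m\<close>. Only the homogeneous part \<open>A\<close> of degree \<open>M\<close> of \<open>a\<^sub>g\<close> contributes, and the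
  integral is a multiple of \<open>A(\<zeta>)\<close> (\<open>ball_reproducing\<close>). To find the multiple, let \<open>h\<close> be homogeneous
  of degree \<open>2M\<close> and integrate \<open>h(z) (T - |z|\<^sup>2)\<^bsup>s\<^esup> e\<^bsup>-T\<^esup>\<close> over \<open>|z|\<^sup>2 < T\<close> in both orders: this compares
  the weighted integral over the ball with the Gaussian integral of \<open>h\<close>
  (\<open>nn_integral_homogeneous_ball_gaussian\<close>). The Gaussian integral is the reproducing formula of Fock
  space (\<open>fock_reproducing\<close>), which follows from the substitution \<open>z = \<zeta> + u\<close> and the mean value
  property. The coefficients of the kernel are exactly the reciprocals of the constants obtained
  (\<open>kernel_constant\<close>), so summing up gives back the Taylor series of \<open>f\<close> (\<open>kernel_reproduces\<close>).

  The series converge uniformly on the boundary because \<open>|X(p, q)|\<close> stays below a number smaller than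
  one when \<open>p\<close> runs through the closed domain (\<open>cmod_X_egg_le\<close>). For the same reason the formula is
  holomorphic in \<open>p\<close> near the closed domain, so it represents itself in the Hardy space; its
  reproducing property extends to \<open>L\<^sup>2\<close> limits by continuity. Finally any two reproducing kernels
  satisfy \<open>S(p, q) = cnj (T(q, p))\<close> and therefore agree.\<close>

section \<open>Isometries and Lebesgue measure\<close>

text \<open>The transformation formulas for the measure of differentiable or orthogonal images concern
  \<open>real ^ 'm\<close> with a well-ordered index type \<open>'m\<close>. The type \<open>'a coord\<close> is such an index type with
  \<open>DIM('a)\<close> elements; results are carried from \<open>real ^ 'a coord\<close> to \<open>'a\<close> along a bijection of the
  standard bases.\<close>

typedef (overloaded) ('a::euclidean_space) coord = "{..<DIM('a)}"
  by (rule exI[of _ 0]) simp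

instance coord :: (euclidean_space) finite
proof
  show "finite (UNIV :: 'a coord set)"
    unfolding type_definition.univ[OF type_definition_coord] by simp
qed

instantiation coord :: (euclidean_space) linorder
begin
definition less_eq_coord :: "'a coord \<Rightarrow> 'a coord \<Rightarrow> bool" where "less_eq_coord i j \<longleftrightarrow> Rep_coord i \<le> Rep_coord j"
definition less_coord :: "'a coord \<Rightarrow> 'a coord \<Rightarrow> bool" where "less_coord i j \<longleftrightarrow> Rep_coord i < Rep_coord j"
instance
  by intro_classes (auto simp: less_eq_coord_def less_coord_def Rep_coord_inject)
end

instance coord :: (euclidean_space) wellorder
proof (rule wf_wellorderI)
  have "{(x :: 'a coord, y). x < y} = inv_image less_than Rep_coord"
    by (auto simp: less_coord_def)
  then show "wf {(x :: 'a coord, y). x < y}" by simp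
qed intro_classes

lemma card_coord: "CARD('a::euclidean_space coord) = DIM('a)"
  by (simp add: type_definition.card[OF type_definition_coord])

lemma linear_basis_expansion:
  fixes f :: "'a::euclidean_space \<Rightarrow> 'b::real_vector"
  assumes "linear f"
  shows "f x = (\<Sum>b\<in>Basis. (x \<bullet> b) *\<^sub>R f b)"
proof -
  have "f x = f (\<Sum>b\<in>Basis. (x \<bullet> b) *\<^sub>R b)" by (simp add: euclidean_representation)
  then show ?thesis by (simp add: linear_sum[OF assms] linear_scale[OF assms])
qed

lemma basis_map_inner:
  fixes f :: "'a::euclidean_space \<Rightarrow> 'b::euclidean_space"
  assumes "linear f" "inj_on f Basis" "f ` Basis \<subseteq> Basis" 
  shows "f x \<bullet> f y = x \<bullet> y"
proof -
  have b: "f b \<bullet> f c = (if b = c then 1 else 0)" if "b \<in> Basis" "c \<in> Basis" for b c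
    using that assms inner_Basis[of "f b" "f c"] inj_onD[OF assms(2), of b c] by (auto simp: image_subset_iff)
  have "f x \<bullet> f y = (\<Sum>b\<in>Basis. \<Sum>c\<in>Basis. (x \<bullet> b) * (y \<bullet> c) * (f b \<bullet> f c))"
    unfolding linear_basis_expansion[OF assms(1), of x] linear_basis_expansion[OF assms(1), of y] inner_sum_left
    unfolding inner_sum_right by (simp add: ac_simps)
  also have "\<dots> = (\<Sum>b\<in>Basis. (x \<bullet> b) * (y \<bullet> b))"
  proof (rule sum.cong[OF refl])
    fix b :: 'a assume "b \<in> Basis"
    then have "(\<Sum>c\<in>Basis. (x \<bullet> b) * (y \<bullet> c) * (f b \<bullet> f c)) = (\<Sum>c\<in>Basis. if b = c then (x \<bullet> b) * (y \<bullet> c) else 0)"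
      by (intro sum.cong) (auto simp: b)
    then show "(\<Sum>c\<in>Basis. (x \<bullet> b) * (y \<bullet> c) * (f b \<bullet> f c)) = (x \<bullet> b) * (y \<bullet> b)"
      using \<open>b \<in> Basis\<close> by simp
  qed
  also have "\<dots> = x \<bullet> y" by (rule euclidean_inner[symmetric])
  finally show ?thesis .
qed

lemma exists_basis_map:
  assumes "finite B" "card B = DIM('a::euclidean_space)"
  shows "\<exists>f :: 'a \<Rightarrow> 'b::euclidean_space. linear f \<and> bij_betw f Basis B"
proof -
  obtain h where h: "bij_betw h (Basis :: 'a set) B"
    using finite_same_card_bij[OF finite_Basis assms(1)] assms(2) by metis
  obtain f :: "'a \<Rightarrow> 'b" where f: "linear f" "\<forall>b\<in>Basis. f b = h b"
    using linear_independent_extend[OF independent_Basis, of h] by blast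
  have "bij_betw f Basis B" using h f(2) bij_betw_cong[of Basis f h B] by simp
  then show ?thesis using f by blast
qed

text \<open>A linear bijection of the standard bases maps boxes to boxes with the same side lengths.\<close>

lemma lborel_distr_basis_map:
  fixes f :: "'a::euclidean_space \<Rightarrow> 'b::euclidean_space"
  assumes f: "linear f" "bij_betw f Basis Basis"
  shows "distr lborel borel f = lborel"
proof (rule lborel_eqI[symmetric])
  have fm[measurable]: "f \<in> borel_measurable borel"
    using f(1) by (intro borel_measurable_continuous_onI linear_continuous_on) (simp add: linear_conv_bounded_linear)
  define g where "g y = (\<Sum>b\<in>Basis. (y \<bullet> f b) *\<^sub>R b)" for y
  have gi: "g y \<bullet> b = y \<bullet> f b" if "b \<in> Basis" for y b
    unfolding g_def using that by (simp add: inner_sum_left inner_Basis if_distrib cong: if_cong)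
  have fi: "f x \<bullet> f b = x \<bullet> b" for x b 
    using basis_map_inner[OF f(1)] f(2) by (auto simp: bij_betw_def)
  have B: "Basis = f ` Basis" using f(2) by (auto simp: bij_betw_def)
  fix l u :: 'b assume le: "\<And>b. b \<in> Basis \<Longrightarrow> l \<bullet> b \<le> u \<bullet> b"
  have pre: "f -` box l u = box (g l) (g u)"
    unfolding box_def B by (auto simp: gi fi)
  have "emeasure (distr lborel borel f) (box l u) = emeasure lborel (box (g l) (g u))"
    by (simp add: emeasure_distr pre)
  also have "\<dots> = (\<Prod>b\<in>Basis. (g u - g l) \<bullet> b)"
  proof (rule emeasure_lborel_box)
    fix b :: 'a assume "b \<in> Basis"
    then show "g l \<bullet> b \<le> g u \<bullet> b" using le[of "f b"] B by (auto simp: gi)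
  qed
  also have "(\<Prod>b\<in>Basis. (g u - g l) \<bullet> b) = (\<Prod>b\<in>Basis. (u - l) \<bullet> f b)"
    by (intro prod.cong) (auto simp: inner_diff_left gi)
  also have "\<dots> = (\<Prod>b\<in>Basis. (u - l) \<bullet> b)"
    using f(2) by (rule prod.reindex_bij_betw)
  finally show "emeasure (distr lborel borel f) (box l u) = ennreal (\<Prod>b\<in>Basis. (u - l) \<bullet> b)" .
qed simp

lemma nn_integral_lborel_basis_map:
  fixes f :: "'a::euclidean_space \<Rightarrow> 'b::euclidean_space"
  assumes f: "linear f" "bij_betw f Basis Basis" and h: "h \<in> borel_measurable borel"
  shows "(\<integral>\<^sup>+x. h (f x) \<partial>lborel) = (\<integral>\<^sup>+y. h y \<partial>lborel)"
proof -
  have fm: "f \<in> borel_measurable borel"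
    using f(1) by (intro borel_measurable_continuous_onI linear_continuous_on) (simp add: linear_conv_bounded_linear)
  have "(\<integral>\<^sup>+y. h y \<partial>lborel) = (\<integral>\<^sup>+y. h y \<partial>distr lborel borel f)"
    by (simp add: lborel_distr_basis_map[OF f])
  also have "\<dots> = (\<integral>\<^sup>+x. h (f x) \<partial>lborel)"
    using fm h by (subst nn_integral_distr) auto
  finally show ?thesis by simp
qed

lemma lborel_distr_isometry_wellorder:
  fixes g :: "real ^ 'm::{finite,wellorder} \<Rightarrow> real ^ 'm::{finite,wellorder}"
  assumes "orthogonal_transformation g"
  shows "distr lborel borel g = lborel"
proof (rule lborel_eqI[symmetric])
  have lin: "linear g" using assms by (simp add: orthogonal_transformation)
  have gm[measurable]: "g \<in> borel_measurable borel"
    using lin by (intro borel_measurable_continuous_onI linear_continuous_on) (simp add: linear_conv_bounded_linear)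
  fix l u :: "real ^ 'm::{finite,wellorder}" assume le: "\<And>b. b \<in> Basis \<Longrightarrow> l \<bullet> b \<le> u \<bullet> b"
  have inv: "orthogonal_transformation (inv g)" by (rule orthogonal_transformation_inv[OF assms])
  have bij: "bij g" by (rule orthogonal_transformation_bij[OF assms])
  have pre: "g -` box l u = inv g ` box l u"
    using bij by (simp add: bij_vimage_eq_inv_image)
  have lm: "box l u \<in> lmeasurable" by simp
  have "measure lebesgue (inv g ` box l u) = measure lebesgue (box l u)"
    using measure_orthogonal_image[OF inv lm] .
  moreover have "inv g ` box l u \<in> lmeasurable"
    using measurable_orthogonal_image[OF inv lm] .
  ultimately have "emeasure lebesgue (inv g ` box l u) = emeasure lebesgue (box l u)"
    using lm by (simp add: emeasure_eq_measure2 fmeasurableD2 emeasure_eq_ennreal_measure)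
  moreover have "g -` box l u \<in> sets borel" using measurable_sets[OF gm, of "box l u"] by simp
  ultimately have "emeasure lborel (g -` box l u) = emeasure lborel (box l u)"
    by (simp add: pre)
  then show "emeasure (distr lborel borel g) (box l u) = ennreal (\<Prod>b\<in>Basis. (u - l) \<bullet> b)"
    using le by (simp add: emeasure_distr)
qed simp

text \<open>Conjugating by a bijection of standard bases reduces the claim to a well-ordered index type.\<close>

lemma lborel_distr_isometry:
  fixes g :: "'a::euclidean_space \<Rightarrow> 'a"
  assumes g: "orthogonal_transformation g"
  shows "distr lborel borel g = lborel"
proof -
  obtain e :: "real ^ 'a coord \<Rightarrow> 'a" where e: "linear e" "bij_betw e Basis Basis"
  proof -
    have "card (Basis :: 'a set) = DIM(real ^ 'a coord)" by (simp add: card_coord)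
    from exists_basis_map[OF finite_Basis this] show thesis using that by blast
  qed
  obtain e' :: "'a \<Rightarrow> real ^ 'a coord" where e': "linear e'" "\<forall>b\<in>Basis. e' b = inv_into Basis e b"
    using linear_independent_extend[OF independent_Basis, of "inv_into Basis e"] by blast
  have e'bij: "bij_betw e' Basis Basis"
    using bij_betw_inv_into[OF e(2)] bij_betw_cong[of Basis e' "inv_into Basis e" Basis] e'(2) by simp
  have eb: "e' (e b) = b" if "b \<in> Basis" for b
    using that e'(2) e(2) by (metis bij_betwE bij_betw_inv_into_left)
  have ebb: "e (e' b) = b" if "b \<in> Basis" for b
    using that e'(2) e(2) by (metis bij_betw_inv_into_right)
  have e'e: "e' (e x) = x" for x
  proof -
    have "e' (e x) = (\<Sum>b\<in>Basis. (x \<bullet> b) *\<^sub>R e' (e b))"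
      using linear_basis_expansion[OF linear_compose[OF e(1) e'(1)], of x] by (simp only: o_apply)
    also have "\<dots> = (\<Sum>b\<in>Basis. (x \<bullet> b) *\<^sub>R b)"
      by (simp add: eb)
    finally show ?thesis by (simp add: euclidean_representation)
  qed
  have ee': "e (e' x) = x" for x
  proof -
    have "e (e' x) = (\<Sum>b\<in>Basis. (x \<bullet> b) *\<^sub>R e (e' b))"
      using linear_basis_expansion[OF linear_compose[OF e'(1) e(1)], of x] by (simp only: o_apply)
    also have "\<dots> = (\<Sum>b\<in>Basis. (x \<bullet> b) *\<^sub>R b)"
      by (simp add: ebb)
    finally show ?thesis by (simp add: euclidean_representation)
  qed
  have norm_e: "norm (e x) = norm x" for x
    using basis_map_inner[OF e(1)] e(2) by (simp add: norm_eq_sqrt_inner bij_betw_def)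
  have norm_e': "norm (e' x) = norm x" for x
    using norm_e[of "e' x"] by (simp add: ee')
  have lin: "linear g" and ng: "norm (g x) = norm x" for x
    using g by (auto simp: orthogonal_transformation)
  define h where "h = e' \<circ> g \<circ> e"
  have h: "orthogonal_transformation h"
    unfolding orthogonal_transformation h_def
    using linear_compose[OF e(1) linear_compose[OF lin e'(1)]]
    by (simp add: ng norm_e norm_e' comp_assoc)
  have ms: "f \<in> borel_measurable borel" if "linear f" for f :: "'x::euclidean_space \<Rightarrow> 'y::euclidean_space"
    using that by (intro borel_measurable_continuous_onI linear_continuous_on) (simp add: linear_conv_bounded_linear)
  have lh: "linear h" using h by (simp add: orthogonal_transformation)
  have "distr lborel borel g = distr (distr lborel borel e) borel g"
    by (simp add: lborel_distr_basis_map[OF e])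
  also have "\<dots> = distr lborel borel (g \<circ> e)"
    using ms[OF lin] ms[OF e(1)] by (subst distr_distr) auto
  also have "g \<circ> e = e \<circ> h" by (simp add: fun_eq_iff h_def ee')
  also have "distr lborel borel (e \<circ> h) = distr (distr lborel borel h) borel e"
    using ms[OF lh] ms[OF e(1)] by (subst distr_distr) auto
  also have "\<dots> = lborel"
    by (simp add: lborel_distr_isometry_wellorder[OF h] lborel_distr_basis_map[OF e])
  finally show ?thesis .
qed

section \<open>Change of variables and Gram determinants\<close>

text \<open>For finite measure this is the theorem on integrals of Jacobians in the Henstock-Kurzweil sense. An
  infinite integral forces an infinite measure of the image, since that theorem would otherwise bound
  the integral.\<close>

lemma emeasure_differentiable_image_wellorder:
  fixes g :: "real ^ 'm::{finite,wellorder} \<Rightarrow> real ^ 'm::{finite,wellorder}"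
  assumes S: "S \<in> sets borel" and T: "g ` S \<in> sets borel"
    and der: "\<And>x. x \<in> S \<Longrightarrow> (g has_derivative g' x) (at x within S)"
    and inj: "inj_on g S"
    and d: "d \<in> borel_measurable borel" "\<And>x. x \<in> S \<Longrightarrow> d x = \<bar>det (matrix (g' x))\<bar>"
  shows "(\<integral>\<^sup>+x. indicator S x * ennreal (d x) \<partial>lborel) = emeasure lborel (g ` S)"
proof -
  let ?f = "\<lambda>x. if x \<in> S then d x else 0"
  have fm: "?f \<in> borel_measurable borel" using S d(1) by measurable
  have nn: "?f x \<ge> 0" for x using d(2)[of x] by auto
  have eq: "(\<integral>\<^sup>+x. indicator S x * ennreal (d x) \<partial>lborel) = (\<integral>\<^sup>+x. ennreal (?f x) \<partial>lborel)"
    by (intro nn_integral_cong) (auto split: split_indicator)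
  have hi: "(?f has_integral m) UNIV \<longleftrightarrow> g ` S \<in> lmeasurable \<and> measure lebesgue (g ` S) = m" for m
  proof -
    have "(?f has_integral m) UNIV \<longleftrightarrow> (d has_integral m) S" by (rule has_integral_restrict_UNIV)
    also have "\<dots> \<longleftrightarrow> ((\<lambda>x. \<bar>det (matrix (g' x))\<bar>) has_integral m) S"
      using d(2) by (intro has_integral_cong) auto
    also have "\<dots> \<longleftrightarrow> g ` S \<in> lmeasurable \<and> measure lebesgue (g ` S) = m"
      using has_measure_differentiable_image[OF _ der inj, of m] S by (simp add: sets_completionI_sets)
    finally show ?thesis .
  qed
  show ?thesis
  proof (cases "(\<integral>\<^sup>+x. ennreal (?f x) \<partial>lborel) < \<infinity>")
    case True
    then obtain r where r: "(\<integral>\<^sup>+x. ennreal (?f x) \<partial>lborel) = ennreal r" "r \<ge> 0"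
      by (cases "(\<integral>\<^sup>+x. ennreal (?f x) \<partial>lborel)") auto
    have "(?f has_integral r) UNIV"
      using nn_integral_has_integral[OF fm nn r(1) r(2)] .
    then have "g ` S \<in> lmeasurable" "measure lebesgue (g ` S) = r" using hi by auto
    then have "emeasure lebesgue (g ` S) = ennreal r"
      by (simp add: emeasure_eq_measure2)
    then show ?thesis using T r eq by simp
  next
    case False
    have "emeasure lborel (g ` S) = \<infinity>"
    proof (rule ccontr)
      assume "emeasure lborel (g ` S) \<noteq> \<infinity>"
      then have "g ` S \<in> lmeasurable" using T
        by (simp add: fmeasurable_def top.not_eq_extremum sets_completionI_sets)
      then have "(?f has_integral measure lebesgue (g ` S)) UNIV" using hi by auto
      then have "(\<integral>\<^sup>+x. ennreal (?f x) \<partial>lborel) = ennreal (measure lebesgue (g ` S))"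
        using fm nn by (intro nn_integral_has_integral_lborel) auto
      with False show False by simp
    qed
    with False eq show ?thesis by (metis infinity_ennreal_def top.not_eq_extremum)
  qed
qed

text \<open>Conjugation with the bijection \<open>q\<close> matches the permutations in the two Leibniz expansions and keeps
  their signs.\<close>

lemma det_reindex:
  fixes A :: "'a::comm_ring_1 ^ 'n ^ 'n" and q :: "'m::finite \<Rightarrow> 'n::finite"
  assumes q: "bij q"
  shows "det (\<chi> i j. A $ q i $ q j) = det A"
proof -
  let ?mp = "map_permutation UNIV q"
  have app: "?mp p (q i) = q (p i)" if "p permutes UNIV" for p i
    using map_permutation_apply[of q UNIV i p] q by (simp add: bij_def inj_on_def)
  have bij: "bij_betw ?mp {p. p permutes UNIV} {p. p permutes UNIV}"
  proof (rule bij_betwI[where g = "map_permutation UNIV (inv q)"])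
    show "?mp \<in> {p. p permutes UNIV} \<rightarrow> {p. p permutes UNIV}"
      using map_permutation_permutes[of q UNIV UNIV] q by auto
    show "map_permutation UNIV (inv q) \<in> {p. p permutes UNIV} \<rightarrow> {p. p permutes UNIV}"
      using map_permutation_permutes[of "inv q" UNIV UNIV] bij_imp_bij_inv[OF q] by auto
    show "map_permutation UNIV (inv q) (?mp p) = p" if "p \<in> {p. p permutes UNIV}" for p
      using map_permutation_compose[of q UNIV UNIV "inv q" p] q that bij_imp_bij_inv[OF q]
      by (simp add: bij_def)
    show "?mp (map_permutation UNIV (inv q) p) = p" if "p \<in> {p. p permutes UNIV}" for p
      using map_permutation_compose[of "inv q" UNIV UNIV q p] q that bij_imp_bij_inv[OF q]
      by (simp add: bij_def surj_iff)
  qed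
  have "det A = (\<Sum>p | p permutes UNIV. of_int (sign (?mp p)) * (\<Prod>i\<in>UNIV. A $ i $ (?mp p) i))"
    unfolding det_def by (rule sum.reindex_bij_betw[OF bij, symmetric])
  also have "\<dots> = (\<Sum>p | p permutes UNIV. of_int (sign p) * (\<Prod>i\<in>UNIV. A $ q i $ q (p i)))"
  proof (rule sum.cong[OF refl])
    fix p :: "'m \<Rightarrow> 'm" assume "p \<in> {p. p permutes UNIV}"
    then have p: "p permutes UNIV" by simp
    have "sign (?mp p) = sign p" using q p by (intro sign_map_permutation) (auto simp: bij_def)
    moreover have "(\<Prod>i\<in>UNIV. A $ i $ (?mp p) i) = (\<Prod>i\<in>UNIV. A $ q i $ (?mp p) (q i))"
      using q by (intro prod.reindex_bij_betw[symmetric]) simp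
    ultimately show "of_int (sign (?mp p)) * (\<Prod>i\<in>UNIV. A $ i $ (?mp p) i)
        = of_int (sign p) * (\<Prod>i\<in>UNIV. A $ q i $ q (p i))"
      using app[OF p] by simp
  qed
  finally show ?thesis by (simp add: det_def)
qed

text \<open>Renaming the indices is an isometry and, by \<open>det_reindex\<close>, does not affect the Jacobian; this removes
  the order on the index type.\<close>

lemma emeasure_differentiable_image:
  fixes g :: "real ^ 'd::finite \<Rightarrow> real ^ 'd"
  assumes S: "S \<in> sets borel" and T: "g ` S \<in> sets borel"
    and der: "\<And>x. x \<in> S \<Longrightarrow> (g has_derivative g' x) (at x within S)"
    and inj: "inj_on g S"
    and d: "d \<in> borel_measurable borel" "\<And>x. x \<in> S \<Longrightarrow> d x = \<bar>det (matrix (g' x))\<bar>"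
  shows "(\<integral>\<^sup>+x. indicator S x * ennreal (d x) \<partial>lborel) = emeasure lborel (g ` S)"
proof -
  have "CARD((real ^ 'd) coord) = CARD('d)" by (simp add: card_coord)
  then obtain q :: "(real ^ 'd) coord \<Rightarrow> 'd" where q: "bij q"
    using finite_same_card_bij[of "UNIV :: (real ^ 'd) coord set" "UNIV :: 'd set"] by auto
  have iq: "inv q (q j) = j" "q (inv q i) = i" for i j
    using q by (auto simp: bij_def surj_f_inv_f)
  define e :: "real ^ (real ^ 'd) coord \<Rightarrow> real ^ 'd" where "e x = (\<chi> i. x $ inv q i)" for x
  define r :: "real ^ 'd \<Rightarrow> real ^ (real ^ 'd) coord" where "r y = (\<chi> j. y $ q j)" for y
  have re: "r (e x) = x" and er: "e (r y) = y" for x y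
    by (simp_all add: r_def e_def vec_eq_iff iq)
  have line: "linear e" and linr: "linear r"
    by (auto intro!: linearI simp: e_def r_def vec_eq_iff)
  have blr: "bounded_linear r" and ble: "bounded_linear e" using linr line by (simp_all add: linear_conv_bounded_linear)
  have eax: "e (axis j 1) = axis (q j) 1" for j
    by (auto simp: e_def axis_def vec_eq_iff iq)
  have em[measurable]: "e \<in> borel_measurable borel"
    by (intro borel_measurable_continuous_onI linear_continuous_on ble)
  have bb: "bij_betw e Basis Basis"
  proof (rule bij_betw_byWitness[where f' = r])
    show "e ` Basis \<subseteq> Basis" by (auto simp: Basis_vec_def eax)
    have "r (axis i 1) = axis (inv q i) 1" for i
      by (metis eax iq(2) re)
    then show "r ` Basis \<subseteq> Basis" by (auto simp: Basis_vec_def)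
  qed (auto simp: re er)
  define S' where "S' = e -` S"
  define h where "h = r \<circ> g \<circ> e"
  have S'b: "S' \<in> sets borel" unfolding S'_def using measurable_sets[OF em S] by simp
  have hS: "h ` S' = e -` (g ` S)"
  proof
    show "h ` S' \<subseteq> e -` (g ` S)" by (auto simp: h_def S'_def er)
    show "e -` (g ` S) \<subseteq> h ` S'"
    proof
      fix x assume "x \<in> e -` (g ` S)"
      then obtain y where y: "y \<in> S" "e x = g y" by auto
      then have "x = h (r y)" by (simp add: h_def er) (metis re)
      then show "x \<in> h ` S'" using y by (auto simp: S'_def er)
    qed
  qed
  have hSb: "h ` S' \<in> sets borel" unfolding hS using measurable_sets[OF em T] by simp
  have "(\<integral>\<^sup>+x. indicator S x * ennreal (d x) \<partial>lborel) = (\<integral>\<^sup>+x. indicator S (e x) * ennreal (d (e x)) \<partial>lborel)"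
  proof (rule nn_integral_lborel_basis_map[OF line bb, symmetric])
    note [measurable] = S d(1)
    show "(\<lambda>x. indicator S x * ennreal (d x)) \<in> borel_measurable borel" by measurable
  qed
  also have "\<dots> = (\<integral>\<^sup>+x. indicator S' x * ennreal (d (e x)) \<partial>lborel)"
    by (simp add: S'_def indicator_def)
  also have "\<dots> = emeasure lborel (h ` S')"
  proof (rule emeasure_differentiable_image_wellorder[OF S'b hSb, where g' = "\<lambda>x. r \<circ> g' (e x) \<circ> e"])
    fix x assume x: "x \<in> S'"
    then have ex: "e x \<in> S" by (simp add: S'_def)
    have "(e has_derivative e) (at x within S')" using ble by (rule bounded_linear_imp_has_derivative)
    moreover have "(g has_derivative g' (e x)) (at (e x) within e ` S')"
      using der[OF ex] by (rule has_derivative_subset) (auto simp: S'_def)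
    ultimately have "(g \<circ> e has_derivative g' (e x) \<circ> e) (at x within S')"
      by (rule diff_chain_within)
    then have "((\<lambda>x. r ((g \<circ> e) x)) has_derivative (\<lambda>v. r ((g' (e x) \<circ> e) v))) (at x within S')"
      by (rule bounded_linear.has_derivative[OF blr])
    then show "(h has_derivative r \<circ> g' (e x) \<circ> e) (at x within S')"
      by (simp add: h_def o_def)
    have "matrix (r \<circ> g' (e x) \<circ> e) = (\<chi> i j. matrix (g' (e x)) $ q i $ q j)"
      by (simp add: vec_eq_iff matrix_def eax r_def)
    then show "d (e x) = \<bar>det (matrix (r \<circ> g' (e x) \<circ> e))\<bar>"
      using d(2)[OF ex] det_reindex[OF q, of "matrix (g' (e x))"] by simp
  next
    show "inj_on h S'"
    proof (rule inj_onI)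
      fix x y assume *: "x \<in> S'" "y \<in> S'" "h x = h y"
      then have "g (e x) = g (e y)" by (simp add: h_def) (metis er)
      then have "e x = e y" using * inj by (auto simp: S'_def dest: inj_onD)
      then show "x = y" by (metis re)
    qed
    show "(\<lambda>x. d (e x)) \<in> borel_measurable borel" using d(1) by measurable
  qed
  also have "\<dots> = emeasure (distr lborel borel e) (g ` S)"
    using T by (simp add: emeasure_distr hS)
  finally show ?thesis by (simp add: lborel_distr_basis_map[OF line bb])
qed

text \<open>Applied to all Borel subsets of \<open>S\<close>, the formula for measures of images identifies the push-forward
  of the measure with density \<open>d\<close> as Lebesgue measure on \<open>g ` S\<close>.\<close>

lemma nn_integral_change_of_variables:
  fixes g :: "real ^ 'd::finite \<Rightarrow> real ^ 'd"
  assumes S: "S \<in> sets borel" and T: "g ` S \<in> sets borel"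
    and g: "g \<in> borel_measurable borel"
    and der: "\<And>x. x \<in> S \<Longrightarrow> (g has_derivative g' x) (at x within S)"
    and inj: "inj_on g S"
    and d: "d \<in> borel_measurable borel" "\<And>x. x \<in> S \<Longrightarrow> d x = \<bar>det (matrix (g' x))\<bar>"
    and h: "h \<in> borel_measurable borel"
  shows "(\<integral>\<^sup>+x. indicator S x * (ennreal (d x) * h (g x)) \<partial>lborel) = (\<integral>\<^sup>+y. indicator (g ` S) y * h y \<partial>lborel)"
proof -
  note [measurable] = S T g d(1) h
  let ?M1 = "distr (density lborel (\<lambda>x. indicator S x * ennreal (d x))) borel g"
  let ?M2 = "density lborel (indicator (g ` S))"
  have "?M1 = ?M2"
  proof (rule measure_eqI)
    fix A assume "A \<in> sets ?M1"
    then have A[measurable]: "A \<in> sets borel" by simp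
    have vA: "g -` A \<in> sets borel" using measurable_sets[OF g A] by simp
    have im: "g ` (S \<inter> g -` A) = g ` S \<inter> A" by auto
    have "emeasure ?M1 A = (\<integral>\<^sup>+x. indicator S x * ennreal (d x) * indicator (g -` A) x \<partial>lborel)"
      using vA by (simp add: emeasure_distr emeasure_density)
    also have "\<dots> = (\<integral>\<^sup>+x. indicator (S \<inter> g -` A) x * ennreal (d x) \<partial>lborel)"
      by (intro nn_integral_cong) (auto split: split_indicator)
    also have "\<dots> = emeasure lborel (g ` (S \<inter> g -` A))"
    proof (rule emeasure_differentiable_image)
      show "S \<inter> g -` A \<in> sets borel" using S vA by blast
      show "g ` (S \<inter> g -` A) \<in> sets borel" unfolding im using T A by blast
      show "inj_on g (S \<inter> g -` A)" using inj by (rule inj_on_subset) auto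
      show "(g has_derivative g' x) (at x within S \<inter> g -` A)" if "x \<in> S \<inter> g -` A" for x
        using der that by (auto intro: has_derivative_subset)
    qed (use d in auto)
    also have "\<dots> = emeasure ?M2 A"
      by (simp add: im emeasure_density indicator_inter_arith[symmetric])
    finally show "emeasure ?M1 A = emeasure ?M2 A" .
  qed simp
  then have "(\<integral>\<^sup>+y. h y \<partial>?M1) = (\<integral>\<^sup>+y. h y \<partial>?M2)" by simp
  then show ?thesis
    by (simp add: nn_integral_distr nn_integral_density mult.assoc)
qed

text \<open>If \<open>G\<close> is the Gram matrix of \<open>E\<close>, that of \<open>E \<circ> L\<close> is \<open>L\<^sup>T G L\<close>. This is why the surface element does
  not depend on the parametrization.\<close>

lemma gram_jacobian_compose:
  fixes E :: "real ^ 'd::finite \<Rightarrow> 'a::real_inner"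
  assumes E: "linear E" and L: "linear L"
  shows "gram_jacobian (\<lambda>v. E (L v)) = \<bar>det (matrix L)\<bar> * gram_jacobian E"
proof -
  define G where "G = (\<chi> i j. E (axis i 1) \<bullet> E (axis j 1) :: real ^ 'd ^ 'd)"
  have EL: "E (L (axis i 1)) = (\<Sum>k\<in>UNIV. matrix L $ k $ i *\<^sub>R E (axis k 1))" for i
  proof -
    have "L (axis i 1) = (\<Sum>k\<in>UNIV. matrix L $ k $ i *\<^sub>R axis k 1)"
      using basis_expansion[of "L (axis i 1)", symmetric] by (simp add: matrix_def scalar_mult_eq_scaleR)
    then show ?thesis by (simp add: linear_sum[OF E] linear_scale[OF E])
  qed
  have "(\<chi> i j. E (L (axis i 1)) \<bullet> E (L (axis j 1)) :: real ^ 'd ^ 'd) = transpose (matrix L) ** (G ** matrix L)"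
    unfolding EL
  proof (simp add: vec_eq_iff matrix_matrix_mult_def transpose_def G_def inner_sum_left inner_sum_right
        sum_distrib_left ac_simps, intro allI, goal_cases)
    case (1 i j)
    show ?case by (subst sum.swap) (simp add: ac_simps)
  qed
  then have "det (\<chi> i j. E (L (axis i 1)) \<bullet> E (L (axis j 1)) :: real ^ 'd ^ 'd) = (det (matrix L))\<^sup>2 * det G"
    by (simp add: det_mul power2_eq_square)
  then show ?thesis
    by (simp add: gram_jacobian_def G_def real_sqrt_mult)
qed

lemma borel_measurable_if_continuous_on:
  fixes f :: "'a::topological_space \<Rightarrow> 'b::real_normed_vector"
  assumes "U \<in> sets borel" "continuous_on U f"
  shows "(\<lambda>x. if x \<in> U then f x else 0) \<in> borel_measurable borel"
proof -
  have "(\<lambda>x. if x \<in> U then f x else 0) = (\<lambda>x. indicat_real U x *\<^sub>R f x)" by (auto simp: fun_eq_iff)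
  then show ?thesis using borel_measurable_continuous_on_indicator[OF assms] by simp
qed

lemma continuous_on_det:
  fixes A :: "'x::topological_space \<Rightarrow> real ^ 'n ^ 'n"
  assumes "\<And>i j. continuous_on U (\<lambda>x. A x $ i $ j)"
  shows "continuous_on U (\<lambda>x. det (A x))"
  unfolding det_def by (intro continuous_intros assms)

lemma continuous_on_gram_jacobian:
  assumes "\<And>v. continuous_on U (\<lambda>u. D u v)"
  shows "continuous_on U (\<lambda>u. gram_jacobian (D u))"
  unfolding gram_jacobian_def
  by (intro continuous_on_real_sqrt continuous_on_det) (simp, intro continuous_intros assms)

section \<open>Surface measure from an atlas\<close>

text \<open>The area that a single patch assigns to a set, the quantity prescribed in the definition of a
  surface measure.\<close>

definition patch_area where
  "patch_area U \<phi> D B = (\<integral>\<^sup>+u. indicator U u * indicator B (\<phi> u) * ennreal (gram_jacobian (D u)) \<partial>lborel)"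

lemma regular_patch_continuous_on: "regular_patch S U \<phi> D \<Longrightarrow> continuous_on U \<phi>"
  unfolding regular_patch_def by (auto intro!: continuous_at_imp_continuous_on has_derivative_continuous)

lemma regular_patch_vimage:
  assumes "regular_patch S U \<phi> D" "B \<in> sets borel"
  shows "{u \<in> U. \<phi> u \<in> B} \<in> sets borel"
proof -
  have o: "open U" using assms by (simp add: regular_patch_def)
  have "(\<lambda>u. if u \<in> U then \<phi> u else 0) -` B \<inter> U \<in> sets borel"
    using measurable_sets[OF borel_measurable_if_continuous_on[OF _ regular_patch_continuous_on[OF assms(1)]] assms(2)] o
    by auto
  also have "(\<lambda>u. if u \<in> U then \<phi> u else 0) -` B \<inter> U = {u \<in> U. \<phi> u \<in> B}" by auto
  finally show ?thesis .
qed

lemma patch_area_measure: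
  assumes p: "regular_patch S U \<phi> D"
  shows "\<exists>N. sets N = sets borel \<and> (\<forall>B\<in>sets borel. emeasure N B = patch_area U \<phi> D B)"
proof -
  have o: "open U" using p by (simp add: regular_patch_def)
  define f where "f u = (if u \<in> U then \<phi> u else 0)" for u
  define c where "c u = (if u \<in> U then gram_jacobian (D u) else 0)" for u
  have [measurable]: "f \<in> borel_measurable borel" unfolding f_def[abs_def]
    using o by (intro borel_measurable_if_continuous_on regular_patch_continuous_on[OF p]) auto
  have [measurable]: "c \<in> borel_measurable borel" unfolding c_def[abs_def]
    using p o by (intro borel_measurable_if_continuous_on continuous_on_gram_jacobian) (auto simp: regular_patch_def)
  let ?N = "distr (density lborel (\<lambda>u. ennreal (c u))) borel f"
  have "emeasure ?N B = patch_area U \<phi> D B" if B[measurable]: "B \<in> sets borel" for B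
  proof -
    have vB: "f -` B \<in> sets borel" using measurable_sets[of f borel borel B] by simp
    have "emeasure ?N B = (\<integral>\<^sup>+u. ennreal (c u) * indicator (f -` B) u \<partial>lborel)"
      using vB by (simp add: emeasure_distr emeasure_density)
    also have "\<dots> = patch_area U \<phi> D B" unfolding patch_area_def
      by (intro nn_integral_cong) (auto simp: f_def c_def split: split_indicator)
    finally show ?thesis .
  qed
  then show ?thesis by (intro exI[of _ ?N]) auto
qed

text \<open>The linear left inverse \<open>\<pi>\<close> makes the change of parameters equal to \<open>\<pi> \<circ> \<phi>\<close>, which is visibly
  differentiable; for two arbitrary patches this step would need the inverse function theorem. The
  chain rule for \<open>\<phi> = \<psi> \<circ> (\<pi> \<circ> \<phi>)\<close> and \<open>gram_jacobian_compose\<close> relate the two densities.\<close>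

lemma patch_area_compatible:
  fixes \<phi> \<psi> :: "('k::finite) hparam \<Rightarrow> 'k cpoint"
  assumes p\<phi>: "regular_patch S U \<phi> D" and p\<psi>: "regular_patch S V \<psi> E"
    and \<pi>: "linear \<pi>" "\<And>v. v \<in> V \<Longrightarrow> \<pi> (\<psi> v) = v"
    and W: "open W" "\<psi> ` V = S \<inter> W"
    and B: "B \<in> sets borel" "B \<subseteq> \<phi> ` U" "B \<subseteq> \<psi> ` V"
  shows "patch_area U \<phi> D B = patch_area V \<psi> E B"
proof -
  have U: "open U" "inj_on \<phi> U" "\<phi> ` U \<subseteq> S" "\<And>u. u \<in> U \<Longrightarrow> (\<phi> has_derivative D u) (at u)"
    "\<And>v. continuous_on U (\<lambda>u. D u v)"
    using p\<phi> by (auto simp: regular_patch_def)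
  have V: "open V" "inj_on \<psi> V" "\<And>v. v \<in> V \<Longrightarrow> (\<psi> has_derivative E v) (at v)"
    "\<And>w. continuous_on V (\<lambda>v. E v w)"
    using p\<psi> by (auto simp: regular_patch_def)
  have bl\<pi>: "bounded_linear \<pi>" using \<pi>(1) by (simp add: linear_conv_bounded_linear)
  define U' where "U' = {u \<in> U. \<phi> u \<in> B}"
  define V' where "V' = {v \<in> V. \<psi> v \<in> B}"
  have U'b: "U' \<in> sets borel" unfolding U'_def by (rule regular_patch_vimage[OF p\<phi> B(1)])
  have V'b: "V' \<in> sets borel" unfolding V'_def by (rule regular_patch_vimage[OF p\<psi> B(1)])
  define U0 where "U0 = {u \<in> U. \<phi> u \<in> W}"
  have U0: "open U0"
  proof -
    have "open (U \<inter> \<phi> -` W)"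
      using regular_patch_continuous_on[OF p\<phi>] U(1) W(1) by (rule continuous_open_preimage)
    then show ?thesis by (simp add: U0_def vimage_def Int_def)
  qed
  have U'0: "U' \<subseteq> U0" using B W by (auto simp: U'_def U0_def)
  define g where "g u = (if u \<in> U then \<pi> (\<phi> u) else 0)" for u
  have g0: "g u \<in> V" "\<psi> (g u) = \<phi> u" if "u \<in> U0" for u
  proof -
    have "\<phi> u \<in> \<psi> ` V" using that U(3) W(2) by (auto simp: U0_def)
    then obtain v where "v \<in> V" "\<phi> u = \<psi> v" by auto
    then show "g u \<in> V" "\<psi> (g u) = \<phi> u" using that \<pi>(2) by (auto simp: g_def U0_def)
  qed
  have gim: "g ` U' = V'"
  proof
    show "g ` U' \<subseteq> V'" using g0 U'0 by (auto simp: U'_def V'_def)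
    show "V' \<subseteq> g ` U'"
    proof
      fix v assume v: "v \<in> V'"
      then obtain u where u: "u \<in> U" "\<psi> v = \<phi> u" using B(2) by (auto simp: V'_def)
      then have "g u = v" using v \<pi>(2)[of v] by (simp add: g_def V'_def)
      then show "v \<in> g ` U'" using u v by (auto simp: U'_def V'_def)
    qed
  qed
  have ginj: "inj_on g U'"
  proof (rule inj_onI)
    fix x y assume *: "x \<in> U'" "y \<in> U'" "g x = g y"
    then have "\<phi> x = \<phi> y" using g0(2) U'0 by (metis subsetD)
    then show "x = y" using * U(2) by (auto simp: U'_def dest: inj_onD)
  qed
  have contD: "continuous_on U (\<lambda>u. \<pi> (D u v))" for v
    using bounded_linear.continuous_on[OF bl\<pi> U(5)[of v]] .
  have gd: "(g has_derivative (\<lambda>v. \<pi> (D u v))) (at u)" if u: "u \<in> U" for u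
  proof -
    have "((\<lambda>u. \<pi> (\<phi> u)) has_derivative (\<lambda>v. \<pi> (D u v))) (at u)"
      by (rule bounded_linear.has_derivative[OF bl\<pi> U(4)[OF u]])
    then show ?thesis
      by (rule has_derivative_transform_within_open[OF _ U(1) u]) (simp add: g_def)
  qed
  have De: "gram_jacobian (D u) = \<bar>det (matrix (\<lambda>v. \<pi> (D u v)))\<bar> * gram_jacobian (E (g u))" if u: "u \<in> U0" for u
  proof -
    have uU: "u \<in> U" using u by (simp add: U0_def)
    have "(\<psi> \<circ> g has_derivative E (g u) \<circ> (\<lambda>v. \<pi> (D u v))) (at u)"
      using gd[OF uU] V(3)[OF g0(1)[OF u]] by (rule diff_chain_at)
    then have "(\<phi> has_derivative E (g u) \<circ> (\<lambda>v. \<pi> (D u v))) (at u)"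
      by (rule has_derivative_transform_within_open[OF _ U0 u]) (simp add: g0(2))
    then have "D u = E (g u) \<circ> (\<lambda>v. \<pi> (D u v))"
      using U(4)[OF uU] has_derivative_unique by blast
    then have DE: "D u = (\<lambda>v. E (g u) (\<pi> (D u v)))" by (simp add: o_def)
    have "linear (\<lambda>v. \<pi> (D u v))" using gd[OF uU] has_derivative_linear by blast
    moreover have "linear (E (g u))" using V(3)[OF g0(1)[OF u]] has_derivative_linear by blast
    ultimately show ?thesis by (subst DE) (rule gram_jacobian_compose)
  qed
  define d where "d u = (if u \<in> U then \<bar>det (matrix (\<lambda>v. \<pi> (D u v)))\<bar> else 0)" for u
  define c where "c v = (if v \<in> V then gram_jacobian (E v) else 0)" for v
  have [measurable]: "d \<in> borel_measurable borel" unfolding d_def[abs_def]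
    using U(1) by (intro borel_measurable_if_continuous_on continuous_on_rabs continuous_on_det)
      (auto simp: matrix_def intro!: continuous_on_component contD)
  have [measurable]: "c \<in> borel_measurable borel" unfolding c_def[abs_def]
    using V by (intro borel_measurable_if_continuous_on continuous_on_gram_jacobian) auto
  have gm: "g \<in> borel_measurable borel" unfolding g_def[abs_def]
    using U(1) by (intro borel_measurable_if_continuous_on)
      (auto intro: bounded_linear.continuous_on[OF bl\<pi>] regular_patch_continuous_on[OF p\<phi>])
  have "patch_area U \<phi> D B = (\<integral>\<^sup>+u. indicator U' u * (ennreal (d u) * ennreal (c (g u))) \<partial>lborel)"
    unfolding patch_area_def
  proof (intro nn_integral_cong)
    fix u
    show "indicator U u * indicator B (\<phi> u) * ennreal (gram_jacobian (D u)) = indicator U' u * (ennreal (d u) * ennreal (c (g u)))"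
    proof (cases "u \<in> U'")
      case True
      then have "u \<in> U0" "u \<in> U" using U'0 by (auto simp: U'_def)
      then have "gram_jacobian (D u) = d u * c (g u)"
        using De g0(1) by (simp add: d_def c_def)
      moreover have "d u \<ge> 0" by (simp add: d_def)
      ultimately show ?thesis using True by (simp add: U'_def ennreal_mult')
    qed (auto simp: U'_def)
  qed
  also have "\<dots> = (\<integral>\<^sup>+v. indicator (g ` U') v * ennreal (c v) \<partial>lborel)"
  proof (rule nn_integral_change_of_variables[where g' = "\<lambda>u v. \<pi> (D u v)"])
    show "(g has_derivative (\<lambda>v. \<pi> (D x v))) (at x within U')" if "x \<in> U'" for x
      using gd that by (auto simp: U'_def intro: has_derivative_at_withinI)
    show "d x = \<bar>det (matrix (\<lambda>v. \<pi> (D x v)))\<bar>" if "x \<in> U'" for x using that by (simp add: d_def U'_def)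
  qed (use U'b V'b gim ginj gm in auto)
  also have "\<dots> = patch_area V \<psi> E B"
    unfolding patch_area_def gim
    by (intro nn_integral_cong) (auto simp: V'_def c_def split: split_indicator)
  finally show ?thesis .
qed

lemma countably_additive_patch_area:
  assumes p: "regular_patch S U \<phi> D"
    and "\<And>i::nat. F i \<in> sets borel" "disjoint_family F"
  shows "(\<Sum>i. patch_area U \<phi> D (F i)) = patch_area U \<phi> D (\<Union>i. F i)"
proof -
  obtain N where N: "sets N = sets borel" "\<forall>B\<in>sets borel. emeasure N B = patch_area U \<phi> D B"
    using patch_area_measure[OF p] by blast
  have "(\<Sum>i. emeasure N (F i)) = emeasure N (\<Union>i. F i)"
    using assms N by (intro suminf_emeasure) auto
  moreover have "(\<Union>i. F i) \<in> sets borel" using assms by auto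
  ultimately show ?thesis using N assms by simp
qed

lemma suminf_ennreal_commute:
  fixes f :: "nat \<Rightarrow> nat \<Rightarrow> ennreal"
  shows "(\<Sum>i. \<Sum>j. f i j) = (\<Sum>j. \<Sum>i. f i j)"
proof -
  have "(\<Sum>i. \<Sum>j. f i j) = (\<Sum>i. \<integral>\<^sup>+j. f i j \<partial>count_space UNIV)"
    by (simp add: nn_integral_count_space_nat)
  also have "\<dots> = (\<integral>\<^sup>+j. (\<Sum>i. f i j) \<partial>count_space UNIV)"
    by (rule nn_integral_suminf[symmetric]) simp
  finally show ?thesis by (simp add: nn_integral_count_space_nat)
qed

text \<open>Cut \<open>S\<close> into disjoint pieces, each inside one chart, and add up the chart areas of the pieces. By
  compatibility the sum has the prescribed value in every patch, whether it belongs to the atlas or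
  not. Conversely a surface measure is determined on each piece, hence on \<open>S\<close>.\<close>

theorem surface_measure_from_atlas:
  fixes S :: "('k::finite) cpoint set" and U :: "nat \<Rightarrow> 'k hparam set"
  assumes S: "S \<in> sets borel"
    and p: "\<And>i. regular_patch S (U i) (\<phi> i) (D i)"
    and \<pi>: "\<And>i. linear (\<pi> i)" "\<And>i v. v \<in> U i \<Longrightarrow> \<pi> i (\<phi> i v) = v"
    and W: "\<And>i. open (W i)" "\<And>i. \<phi> i ` U i = S \<inter> W i" "S \<subseteq> (\<Union>i. W i)"
  shows "\<exists>!\<sigma>. is_surface_measure S \<sigma>"
proof -
  define A where "A i = S \<inter> W i - (\<Union>j<i. W j)" for i
  have Ab: "A i \<in> sets borel" for i
    unfolding A_def using S W(1) by (intro sets.Diff sets.Int sets.finite_UN) auto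
  have Adisj: "disjoint_family A"
    unfolding A_def disjoint_family_on_def
  proof (intro ballI impI)
    fix m n :: nat assume "m \<noteq> n"
    then show "(S \<inter> W m - (\<Union>j<m. W j)) \<inter> (S \<inter> W n - (\<Union>j<n. W j)) = {}"
      by (cases "m < n") auto
  qed
  have AS: "(\<Union>i. A i) = S"
  proof
    show "(\<Union>i. A i) \<subseteq> S" by (auto simp: A_def)
    show "S \<subseteq> (\<Union>i. A i)"
    proof
      fix x assume x: "x \<in> S"
      then have ex: "\<exists>i. x \<in> W i" using W(3) by auto
      define n where "n = (LEAST i. x \<in> W i)"
      have "x \<in> W n" "\<And>j. j < n \<Longrightarrow> x \<notin> W j"
        using LeastI_ex[OF ex] not_less_Least by (auto simp: n_def)
      then show "x \<in> (\<Union>i. A i)" using x by (auto simp: A_def)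
    qed
  qed
  have AW: "A i \<subseteq> \<phi> i ` U i" for i unfolding W(2) by (auto simp: A_def)
  have sr: "sets (restrict_space borel S) = {B \<in> sets borel. B \<subseteq> S}"
    using S by (subst sets_restrict_space) auto
  define \<mu> where "\<mu> B = (\<Sum>i. patch_area (U i) (\<phi> i) (D i) (B \<inter> A i))" for B
  define \<sigma> where "\<sigma> = measure_of S (sets (restrict_space borel S)) \<mu>"
  have sa: "sigma_algebra S (sets (restrict_space borel S))"
    using sets.sigma_algebra_axioms[of "restrict_space borel S"] by (simp add: space_restrict_space)
  have sets\<sigma>: "sets \<sigma> = sets (restrict_space borel S)"
    unfolding \<sigma>_def using sigma_algebra.sets_measure_of_eq[OF sa] by simp
  have pos: "positive (sets (restrict_space borel S)) \<mu>"
    by (simp add: positive_def \<mu>_def patch_area_def)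
  have ca: "countably_additive (sets (restrict_space borel S)) \<mu>"
  proof (rule countably_additiveI)
    fix F :: "nat \<Rightarrow> 'k cpoint set"
    assume F: "range F \<subseteq> sets (restrict_space borel S)" "disjoint_family F"
    then have Fb: "F i \<in> sets borel" for i unfolding sr by auto
    have "(\<Sum>i. \<mu> (F i)) = (\<Sum>j. \<Sum>i. patch_area (U j) (\<phi> j) (D j) (F i \<inter> A j))"
      unfolding \<mu>_def by (rule suminf_ennreal_commute)
    also have "\<dots> = (\<Sum>j. patch_area (U j) (\<phi> j) (D j) (\<Union>i. F i \<inter> A j))"
    proof (rule suminf_cong, rule countably_additive_patch_area[OF p])
      show "F i \<inter> A j \<in> sets borel" for i j using Fb Ab by blast
      show "disjoint_family (\<lambda>i. F i \<inter> A j)" for j using F(2) by (auto simp: disjoint_family_on_def)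
    qed
    also have "\<dots> = \<mu> (\<Union>i. F i)" unfolding \<mu>_def by (simp add: Int_UN_distrib2)
    finally show "(\<Sum>i. \<mu> (F i)) = \<mu> (\<Union>i. F i)" .
  qed
  have em\<sigma>: "emeasure \<sigma> B = \<mu> B" if "B \<in> sets \<sigma>" for B
    unfolding \<sigma>_def using emeasure_measure_of_sigma[OF sa pos ca] that sets\<sigma> by simp
  have is\<sigma>: "is_surface_measure S \<sigma>"
    unfolding is_surface_measure_def
  proof (intro conjI sets\<sigma> allI impI ballI)
    fix V and \<psi> :: "'k hparam \<Rightarrow> 'k cpoint" and E B
    assume q: "regular_patch S V \<psi> E" and B: "B \<in> sets \<sigma>" "B \<subseteq> \<psi> ` V"
    have Bb: "B \<in> sets borel" "B \<subseteq> S" using B(1) unfolding sets\<sigma> sr by auto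
    have "emeasure \<sigma> B = (\<Sum>i. patch_area (U i) (\<phi> i) (D i) (B \<inter> A i))"
      using em\<sigma>[OF B(1)] by (simp add: \<mu>_def)
    also have "\<dots> = (\<Sum>i. patch_area V \<psi> E (B \<inter> A i))"
    proof (rule suminf_cong)
      fix i
      show "patch_area (U i) (\<phi> i) (D i) (B \<inter> A i) = patch_area V \<psi> E (B \<inter> A i)"
      proof (rule patch_area_compatible[OF q p[of i] \<pi>(1)[of i] \<pi>(2) W(1)[of i] W(2)[of i], symmetric])
        show "B \<inter> A i \<in> sets borel" using Bb Ab by blast
        show "B \<inter> A i \<subseteq> \<psi> ` V" "B \<inter> A i \<subseteq> \<phi> i ` U i" using B(2) AW by auto
      qed
    qed
    also have "\<dots> = patch_area V \<psi> E (\<Union>i. B \<inter> A i)"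
    proof (rule countably_additive_patch_area[OF q])
      show "B \<inter> A i \<in> sets borel" for i using Bb Ab by blast
      show "disjoint_family (\<lambda>i. B \<inter> A i)" using Adisj by (auto simp: disjoint_family_on_def)
    qed
    also have "(\<Union>i. B \<inter> A i) = B" using AS Bb(2) by auto
    finally show "emeasure \<sigma> B = (\<integral>\<^sup>+u. indicator V u * indicator B (\<psi> u) * ennreal (gram_jacobian (E u)) \<partial>lborel)"
      by (simp add: patch_area_def)
  qed
  moreover have "\<tau> = \<sigma>" if t: "is_surface_measure S \<tau>" for \<tau>
  proof (rule measure_eqI)
    show s: "sets \<tau> = sets \<sigma>" using t sets\<sigma> by (simp add: is_surface_measure_def)
    fix B assume B: "B \<in> sets \<tau>"
    then have Bb: "B \<in> sets borel" "B \<subseteq> S" unfolding s sets\<sigma> sr by auto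
    have BA: "B \<inter> A i \<in> sets \<tau>" for i unfolding s sets\<sigma> sr using Bb Ab by auto
    have dj: "disjoint_family (\<lambda>i. B \<inter> A i)" using Adisj by (auto simp: disjoint_family_on_def)
    have BU: "(\<Union>i. B \<inter> A i) = B" using AS Bb(2) by auto
    have "emeasure \<tau> (B \<inter> A i) = emeasure \<sigma> (B \<inter> A i)" for i
    proof -
      have "B \<inter> A i \<subseteq> \<phi> i ` U i" using AW by auto
      have "emeasure \<rho> (B \<inter> A i) = patch_area (U i) (\<phi> i) (D i) (B \<inter> A i)"
        if "is_surface_measure S \<rho>" "B \<inter> A i \<in> sets \<rho>" for \<rho>
        unfolding patch_area_def using that p[of i] \<open>B \<inter> A i \<subseteq> \<phi> i ` U i\<close>
        unfolding is_surface_measure_def by blast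
      then show ?thesis using t is\<sigma> BA[of i] s by simp
    qed
    then have "(\<Sum>i. emeasure \<tau> (B \<inter> A i)) = (\<Sum>i. emeasure \<sigma> (B \<inter> A i))" by simp
    moreover have "(\<Sum>i. emeasure \<tau> (B \<inter> A i)) = emeasure \<tau> (\<Union>i. B \<inter> A i)"
      using BA dj by (intro suminf_emeasure) auto
    moreover have "(\<Sum>i. emeasure \<sigma> (B \<inter> A i)) = emeasure \<sigma> (\<Union>i. B \<inter> A i)"
      using BA dj s by (intro suminf_emeasure) auto
    ultimately show "emeasure \<tau> B = emeasure \<sigma> B" unfolding BU by simp
  qed
  ultimately show ?thesis by blast
qed

section \<open>The boundary of the egg domain as a hypersurface\<close>

lemma open_egg: "open (egg m)"
proof -
  have *: "egg m = {p. (norm (fst p))\<^sup>2 + cmod (snd p) ^ (2 * m) < 1}" by (auto simp: egg_def)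
  show ?thesis unfolding * by (intro open_Collect_less continuous_intros)
qed

lemma closure_egg:
  assumes "m \<ge> 1"
  shows "closure (egg m :: ('k::finite) cpoint set) = {p. (norm (fst p))\<^sup>2 + cmod (snd p) ^ (2 * m) \<le> 1}" (is "?C = ?D")
proof
  show "?C \<subseteq> ?D"
    by (rule closure_minimal) (auto simp: egg_def intro!: closed_Collect_le continuous_intros)
  show "?D \<subseteq> ?C"
  proof
    fix p :: "'k cpoint" assume p: "p \<in> ?D"
    \<comment> \<open>Scaling by a factor below one moves a point of the closed region into the domain, as \<open>2 * m \<ge> 2\<close>.\<close>
    let ?t = "\<lambda>j::nat. 1 - inverse (real (Suc j))"
    have "?t j *\<^sub>R p \<in> egg m" for j
    proof -
      have t: "0 \<le> ?t j" "?t j < 1" by (auto simp: field_simps)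
      have t2: "(?t j) ^ 2 < 1" using t by (simp add: power_less_one_iff abs_square_less_1)
      have t2m: "(?t j) ^ (2 * m) \<le> (?t j) ^ 2" using t assms by (intro power_decreasing) auto
      have "(norm (fst (?t j *\<^sub>R p)))\<^sup>2 + cmod (snd (?t j *\<^sub>R p)) ^ (2 * m) =
        (?t j)\<^sup>2 * (norm (fst p))\<^sup>2 + (?t j) ^ (2 * m) * cmod (snd p) ^ (2 * m)"
        using t by (simp add: power_mult_distrib)
      also have "\<dots> \<le> (?t j)\<^sup>2 * ((norm (fst p))\<^sup>2 + cmod (snd p) ^ (2 * m))"
        using mult_right_mono[OF t2m, of "cmod (snd p) ^ (2 * m)"] by (simp add: algebra_simps)
      also have "\<dots> \<le> (?t j)\<^sup>2 * 1" using p by (intro mult_left_mono) auto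
      also have "\<dots> < 1" using t2 by simp
      finally show ?thesis by (simp add: egg_def case_prod_beta)
    qed
    moreover have "(\<lambda>j. ?t j *\<^sub>R p) \<longlonglongrightarrow> (1 - 0) *\<^sub>R p"
      by (intro tendsto_intros LIMSEQ_inverse_real_of_nat)
    ultimately show "p \<in> ?C" unfolding closure_sequential by force
  qed
qed

lemma frontier_egg:
  assumes "m \<ge> 1"
  shows "frontier (egg m) = {p. (norm (fst p))\<^sup>2 + cmod (snd p) ^ (2 * m) = 1}"
  unfolding frontier_def closure_egg[OF assms] interior_open[OF open_egg]
  by (auto simp: egg_def)

text \<open>The part of \<open>S\<close> where the coordinate along \<open>b\<close> has the sign \<open>s\<close> is the graph of \<open>s * sqrt G\<close> over an
  open set in the hyperplane orthogonal to \<open>b\<close>; orthogonal projection to that hyperplane is the linear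
  left inverse. By the last conjunct the remaining coordinates of a boundary point are parameters of
  the chart, which turns coordinate conditions on \<open>S\<close> into null sets of parameters.\<close>

lemma graph_chart:
  fixes J :: "('k::finite) hparam \<Rightarrow> 'k cpoint" and G :: "'k cpoint \<Rightarrow> real"
  assumes J: "linear J" "bij_betw J Basis (Basis - {b})" and b: "b \<in> Basis"
    and G: "continuous_on UNIV G" "\<And>p. G p > 0 \<Longrightarrow> (G has_derivative G' p) (at p)"
      "\<And>v. continuous_on {p. G p > 0} (\<lambda>p. G' p v)"
    and s: "s = 1 \<or> s = -1"
    and char: "\<And>p t. p \<bullet> b = 0 \<Longrightarrow> t \<noteq> 0 \<Longrightarrow> p + t *\<^sub>R b \<in> S \<longleftrightarrow> t\<^sup>2 = G p"
  shows "\<exists>U \<phi> D \<pi>. regular_patch S U \<phi> D \<and> linear \<pi> \<and> (\<forall>v\<in>U. \<pi> (\<phi> v) = v) \<and>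
     \<phi> ` U = S \<inter> {p. s * (p \<bullet> b) > 0} \<and> (\<forall>c\<in>Basis - {b}. \<exists>e\<in>Basis. \<forall>u. \<phi> u \<bullet> c = u \<bullet> e)"
proof -
  define U where "U = {u. G (J u) > 0}"
  define \<phi> where "\<phi> u = J u + (s * sqrt (G (J u))) *\<^sub>R b" for u
  define D where "D u v = J v + (s * (G' (J u) (J v) / (2 * sqrt (G (J u))))) *\<^sub>R b" for u v
  define \<pi> where "\<pi> p = (\<Sum>e\<in>Basis. (p \<bullet> J e) *\<^sub>R e)" for p
  have ss: "s * s = 1" "s \<noteq> 0" using s by auto
  have blJ: "bounded_linear J" using J(1) by (simp add: linear_conv_bounded_linear)
  have Jin: "J e \<in> Basis" "J e \<noteq> b" if "e \<in> Basis" for e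
    using J(2) that by (auto simp: bij_betw_def)
  have JJ: "J x \<bullet> J y = x \<bullet> y" for x y
    using basis_map_inner[OF J(1)] J(2) by (auto simp: bij_betw_def)
  have Jb: "J x \<bullet> b = 0" for x
    using linear_basis_expansion[OF J(1), of x] Jin b by (simp add: inner_sum_left inner_Basis)
  have lin\<pi>: "linear \<pi>" unfolding \<pi>_def
    by (rule linearI) (simp_all add: inner_add_left scaleR_add_left sum.distrib scaleR_sum_right)
  have \<pi>J: "\<pi> (J x) = x" for x by (simp add: \<pi>_def JJ euclidean_representation)
  have \<pi>b: "\<pi> b = 0"
    unfolding \<pi>_def using inner_not_same_Basis[OF b Jin(1)] Jin(2) by (intro sum.neutral) force
  have \<pi>sum: "\<pi> (J x + t *\<^sub>R b) = x" for x t
    by (simp add: linear_add[OF lin\<pi>] linear_scale[OF lin\<pi>] \<pi>J \<pi>b)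
  have J\<pi>: "J (\<pi> p) = p - (p \<bullet> b) *\<^sub>R b" for p
  proof -
    have "J (\<pi> p) = (\<Sum>e\<in>Basis. (p \<bullet> J e) *\<^sub>R J e)"
      by (simp add: \<pi>_def linear_sum[OF J(1)] linear_scale[OF J(1)])
    also have "\<dots> = (\<Sum>c\<in>Basis - {b}. (p \<bullet> c) *\<^sub>R c)"
      by (rule sum.reindex_bij_betw[OF J(2)])
    also have "\<dots> = p - (p \<bullet> b) *\<^sub>R b"
      using b euclidean_representation[of p] by (simp add: sum_diff1)
    finally show ?thesis .
  qed
  have bb: "b \<bullet> b = 1" using b by simp
  have contJ: "continuous_on A J" for A using blJ by (rule linear_continuous_on)
  have openU: "open U"
    unfolding U_def using continuous_on_compose2[OF G(1) contJ[of UNIV]]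
    by (intro open_Collect_less) auto
  have \<phi>S: "\<phi> u \<in> S \<inter> {p. s * (p \<bullet> b) > 0}" if u: "u \<in> U" for u
  proof -
    have g: "G (J u) > 0" using u by (simp add: U_def)
    have "(s * sqrt (G (J u)))\<^sup>2 = G (J u)" using ss(1) g by (simp add: power_mult_distrib power2_eq_square[of s])
    then have "\<phi> u \<in> S" unfolding \<phi>_def using char[OF Jb[of u], of "s * sqrt (G (J u))"] g ss(2) by simp
    moreover have "s * (\<phi> u \<bullet> b) = (s * s) * sqrt (G (J u))"
      by (simp add: \<phi>_def inner_add_left Jb bb)
    ultimately show ?thesis using g ss(1) by simp
  qed
  have img: "\<phi> ` U = S \<inter> {p. s * (p \<bullet> b) > 0}"
  proof
    show "\<phi> ` U \<subseteq> S \<inter> {p. s * (p \<bullet> b) > 0}" using \<phi>S by auto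
    show "S \<inter> {p. s * (p \<bullet> b) > 0} \<subseteq> \<phi> ` U"
    proof
      fix p assume p: "p \<in> S \<inter> {p. s * (p \<bullet> b) > 0}"
      then have t: "p \<bullet> b \<noteq> 0" by auto
      have 0: "J (\<pi> p) \<bullet> b = 0" by (rule Jb)
      have p': "J (\<pi> p) + (p \<bullet> b) *\<^sub>R b = p" by (simp add: J\<pi>)
      have GJ: "G (J (\<pi> p)) = (p \<bullet> b)\<^sup>2" using char[OF 0 t] p p' by simp
      have "s * sqrt (G (J (\<pi> p))) = p \<bullet> b" using p s GJ by (auto simp: real_sqrt_abs)
      then have "\<phi> (\<pi> p) = p" using p' by (simp add: \<phi>_def)
      moreover have "\<pi> p \<in> U" using GJ t by (simp add: U_def)
      ultimately show "p \<in> \<phi> ` U" by force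
    qed
  qed
  have der: "(\<phi> has_derivative D u) (at u)" if u: "u \<in> U" for u
  proof -
    have g: "G (J u) > 0" using u by (simp add: U_def)
    have "((\<lambda>u. G (J u)) has_derivative (\<lambda>v. G' (J u) (J v))) (at u)"
      by (rule has_derivative_compose[OF bounded_linear_imp_has_derivative[OF blJ] G(2)[OF g]])
    then have "((\<lambda>u. sqrt (G (J u))) has_derivative (\<lambda>v. G' (J u) (J v) / 2 * inverse (sqrt (G (J u))))) (at u)"
      using g by (auto intro!: derivative_eq_intros simp: divide_simps)
    from has_derivative_add[OF bounded_linear_imp_has_derivative[OF blJ]
        has_derivative_scaleR_left[OF has_derivative_mult_right[OF this, of s], of b]]
    show ?thesis
      unfolding \<phi>_def[abs_def] D_def[abs_def] by (simp add: field_simps)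
  qed
  have injD: "inj (D u)" for u
    by (rule inj_on_inverseI[where g = \<pi>]) (simp add: D_def \<pi>sum)
  have contD: "continuous_on U (\<lambda>u. D u v)" for v
  proof -
    have c1: "continuous_on U (\<lambda>u. G' (J u) (J v))"
      by (rule continuous_on_compose2[OF G(3) contJ]) (auto simp: U_def)
    have c2: "continuous_on U (\<lambda>u. G (J u))"
      by (rule continuous_on_compose2[OF G(1) contJ]) auto
    show ?thesis unfolding D_def
      by (intro continuous_intros c1 c2) (auto simp: U_def)
  qed
  have inj\<phi>: "inj_on \<phi> U" by (rule inj_on_inverseI[where g = \<pi>]) (simp add: \<phi>_def \<pi>sum)
  have coord: "\<exists>e\<in>Basis. \<forall>u. \<phi> u \<bullet> c = u \<bullet> e" if c: "c \<in> Basis - {b}" for c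
  proof -
    have "c \<in> J ` Basis" using c J(2) by (simp add: bij_betw_def)
    then obtain e where e: "e \<in> Basis" "J e = c" by blast
    have bc: "b \<bullet> c = 0" using inner_not_same_Basis[of b c] b c by auto
    have "\<phi> u \<bullet> c = u \<bullet> e" for u
    proof -
      have "\<phi> u \<bullet> c = J u \<bullet> c" by (simp add: \<phi>_def inner_add_left bc)
      also have "\<dots> = u \<bullet> e" unfolding e(2)[symmetric] by (rule JJ)
      finally show ?thesis .
    qed
    then show ?thesis using e(1) by blast
  qed
  have "regular_patch S U \<phi> D"
    unfolding regular_patch_def
  proof (intro conjI ballI allI)
    show "\<phi> ` U \<subseteq> S" unfolding img by simp
  qed (use openU inj\<phi> der injD contD in simp_all)
  moreover have "\<forall>v\<in>U. \<pi> (\<phi> v) = v" by (simp add: \<phi>_def \<pi>sum)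
  ultimately show ?thesis using lin\<pi> img coord by blast
qed

lemma norm_even_power_inner: "cmod w ^ (2 * m) = (w \<bullet> w) ^ m"
  by (simp add: power_mult power2_norm_eq_inner)

text \<open>For \<open>b\<close> in a \<open>z\<close>-direction the equation of the boundary is solved for the square of that coordinate
  without taking roots. For \<open>b\<close> in a \<open>w\<close>-direction an \<open>m\<close>-th root of \<open>1 - |z|\<^sup>2\<close> is needed, which is
  smooth where the resulting square is positive because the radicand is positive there.\<close>

lemma egg_chart:
  assumes m: "m \<ge> 1" and b: "b \<in> (Basis :: ('k::finite) cpoint set)" and s: "s = 1 \<or> s = -1"
  shows "\<exists>U \<phi> D \<pi>. regular_patch (frontier (egg m)) U \<phi> D \<and> linear \<pi> \<and> (\<forall>v\<in>U. \<pi> (\<phi> v) = v) \<and>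
     \<phi> ` U = frontier (egg m) \<inter> {p. s * (p \<bullet> b) > 0} \<and>
     (\<forall>c\<in>Basis - {b}. \<exists>e\<in>Basis. \<forall>u. \<phi> u \<bullet> c = u \<bullet> e)"
proof -
  have card: "card (Basis - {b}) = DIM('k hparam)" using b by (simp add: card_Diff_singleton)
  obtain J :: "'k hparam \<Rightarrow> 'k cpoint" where J: "linear J" "bij_betw J Basis (Basis - {b})"
    using exists_basis_map[OF _ card] by auto
  show ?thesis
  proof (cases "snd b = 0")
    case True
    then have nb: "norm (fst b) = 1" using b by (auto simp: Basis_prod_def)
    define G where "G p = 1 - fst p \<bullet> fst p - (snd p \<bullet> snd p) ^ m" for p :: "'k cpoint"
    define G' where "G' p v = - (2 * (fst p \<bullet> fst v)) - real m * (2 * (snd p \<bullet> snd v)) * (snd p \<bullet> snd p) ^ (m - 1)" for p v :: "'k cpoint"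
    show ?thesis
    proof (rule graph_chart[OF J b, where G = G and G' = G'])
      show "continuous_on UNIV G" unfolding G_def by (intro continuous_intros)
      show "(G has_derivative G' p) (at p)" for p
        unfolding G_def[abs_def] G'_def[abs_def]
        by (auto intro!: derivative_eq_intros simp: inner_commute algebra_simps)
      show "continuous_on {p. G p > 0} (\<lambda>p. G' p v)" for v
        unfolding G'_def by (intro continuous_intros)
      fix p t assume "p \<bullet> b = 0" "t \<noteq> (0::real)"
      then have 0: "fst p \<bullet> fst b = 0" using True by (simp add: inner_prod_def)
      have "(norm (fst p + t *\<^sub>R fst b))\<^sup>2 = fst p \<bullet> fst p + t\<^sup>2"
        unfolding power2_norm_eq_inner using 0 nb
        by (simp add: inner_add inner_commute power2_eq_square norm_eq_1)
      then show "p + t *\<^sub>R b \<in> frontier (egg m) \<longleftrightarrow> t\<^sup>2 = G p"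
        unfolding frontier_egg[OF m] using True by (auto simp: G_def norm_even_power_inner)
    qed (use s in auto)
  next
    case False
    then have fb: "fst b = 0" and nb: "norm (snd b) = 1" using b by (auto simp: Basis_prod_def)
    define G where "G p = root m (1 - fst p \<bullet> fst p) - snd p \<bullet> snd p" for p :: "'k cpoint"
    define G' where "G' p v = - (2 * (fst p \<bullet> fst v)) * inverse (real m * root m (1 - fst p \<bullet> fst p) ^ (m - Suc 0)) - 2 * (snd p \<bullet> snd v)" for p v :: "'k cpoint"
    have pos: "0 < 1 - fst p \<bullet> fst p" if "G p > 0" for p
    proof -
      have "root m (1 - fst p \<bullet> fst p) > 0" using that inner_ge_zero[of "snd p"] unfolding G_def by linarith
      then show ?thesis using m by simp
    qed
    show ?thesis
    proof (rule graph_chart[OF J b, where G = G and G' = G'])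
      show "continuous_on UNIV G" unfolding G_def by (intro continuous_intros)
      show "(G has_derivative G' p) (at p)" if "G p > 0" for p
      proof -
        have m0: "0 < m" using m by simp
        have d1: "((\<lambda>p. 1 - fst p \<bullet> fst p) has_derivative (\<lambda>v. - (2 * (fst p \<bullet> fst v)))) (at p)"
          by (auto intro!: derivative_eq_intros simp: inner_commute)
        have d2: "((\<lambda>p. snd p \<bullet> snd p) has_derivative (\<lambda>v. 2 * (snd p \<bullet> snd v))) (at p)"
          by (auto intro!: derivative_eq_intros simp: inner_commute)
        show ?thesis
          unfolding G_def[abs_def] G'_def[abs_def]
          using has_derivative_diff[OF DERIV_compose_FDERIV[OF DERIV_real_root[OF m0 pos[OF that]] d1] d2] by simp
      qed
      show "continuous_on {p. G p > 0} (\<lambda>p. G' p v)" for v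
        unfolding G'_def using m pos by (intro continuous_intros) force
      fix p t assume *: "p \<bullet> b = 0" "t \<noteq> (0::real)"
      then have 0: "snd p \<bullet> snd b = 0" using fb by (simp add: inner_prod_def)
      let ?y = "snd p \<bullet> snd p + t\<^sup>2" and ?x = "1 - fst p \<bullet> fst p"
      have "(norm (snd p + t *\<^sub>R snd b))\<^sup>2 = ?y"
        unfolding power2_norm_eq_inner using 0 nb
        by (simp add: inner_add inner_commute power2_eq_square norm_eq_1)
      then have e: "cmod (snd p + t *\<^sub>R snd b) ^ (2 * m) = ?y ^ m" by (simp only: power_mult)
      have y: "?y > 0" using * by (simp add: add_nonneg_pos)
      have "?y ^ m = ?x \<longleftrightarrow> ?y = root m ?x"
      proof
        assume "?y ^ m = ?x"
        then show "?y = root m ?x" using y m real_root_power_cancel[of m ?y] by simp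
      next
        assume r: "?y = root m ?x"
        then have "?x > 0" using y m by simp
        then show "?y ^ m = ?x" using m by (subst r) (simp add: real_root_pow_pos2)
      qed
      then show "p + t *\<^sub>R b \<in> frontier (egg m) \<longleftrightarrow> t\<^sup>2 = G p"
        unfolding frontier_egg[OF m] using fb e by (auto simp: G_def power2_norm_eq_inner)
    qed (use s in auto)
  qed
qed

text \<open>Every boundary point is nonzero, so some coordinate is nonzero and the charts
  \<open>egg_chart\<close> over all basis vectors and signs cover the boundary.\<close>

lemma ex1_surface_measure_egg:
  assumes m: "m \<ge> 1"
  shows "\<exists>!\<sigma>. is_surface_measure (frontier (egg m :: ('k::finite) cpoint set)) \<sigma>"
proof -
  define I where "I = (Basis :: 'k cpoint set) \<times> {1, -1 :: real}"
  have I: "countable I" "I \<noteq> {}" by (auto simp: I_def intro!: countable_finite)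
  \<comment> \<open>An enumeration with repetitions of the finite set of charts, since atlases are sequences.\<close>
  define c where "c = from_nat_into I"
  have cI: "c i \<in> I" for i using from_nat_into[OF I(2)] by (simp add: c_def)
  have rc: "range c = I" using range_from_nat_into[OF I(2,1)] by (simp add: c_def)
  let ?S = "frontier (egg m :: 'k cpoint set)"
  have "\<exists>U \<phi> D \<pi>. regular_patch ?S U \<phi> D \<and> linear \<pi> \<and> (\<forall>v\<in>U. \<pi> (\<phi> v) = v) \<and>
     \<phi> ` U = ?S \<inter> {p. snd (c i) * (p \<bullet> fst (c i)) > 0}" for i
  proof -
    have "fst (c i) \<in> Basis" "snd (c i) = 1 \<or> snd (c i) = -1" using cI[of i] by (auto simp: I_def mem_Times_iff)
    from egg_chart[OF m this] show ?thesis by blast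
  qed
  then obtain U \<phi> D \<pi> where ch: "\<And>i. regular_patch ?S (U i) (\<phi> i) (D i)" "\<And>i. linear (\<pi> i)"
     "\<And>i v. v \<in> U i \<Longrightarrow> \<pi> i (\<phi> i v) = v"
     "\<And>i. \<phi> i ` U i = ?S \<inter> {p. snd (c i) * (p \<bullet> fst (c i)) > 0}" by metis
  show ?thesis
  proof (rule surface_measure_from_atlas[OF _ ch(1) ch(2) ch(3)])
    show "?S \<in> sets borel" by simp
    show "open {p. snd (c i) * (p \<bullet> fst (c i)) > 0}" for i
      by (intro open_Collect_less continuous_intros)
    show "?S \<subseteq> (\<Union>i. {p. snd (c i) * (p \<bullet> fst (c i)) > 0})"
    proof
      fix p assume "p \<in> ?S"
      then have "p \<noteq> 0" using m unfolding frontier_egg[OF m] by (auto simp: power_0_left)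
      then obtain b where b: "b \<in> Basis" "p \<bullet> b \<noteq> 0" using euclidean_all_zero_iff[of p] by blast
      have "(b, sgn (p \<bullet> b)) \<in> I" using b by (auto simp: I_def sgn_if)
      then obtain i where "c i = (b, sgn (p \<bullet> b))" using rc by (metis imageE)
      then show "p \<in> (\<Union>i. {p. snd (c i) * (p \<bullet> fst (c i)) > 0})"
        using b by (intro UN_I[of i]) (auto simp: sgn_if)
    qed
  qed (use ch in auto)
qed

lemma is_surface_measure_egg:
  "m \<ge> 1 \<Longrightarrow> is_surface_measure (frontier (egg m)) (surface_measure (frontier (egg m)))"
  unfolding surface_measure_def by (rule theI'[OF ex1_surface_measure_egg])

lemma hyperplane_null:
  assumes "e \<in> (Basis :: 'a::euclidean_space set)"
  shows "{u. u \<bullet> e = 0} \<in> null_sets lborel"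
proof -
  have "negligible {u. u \<bullet> e = 0}" using negligible_standard_hyperplane[OF assms, of 0] by simp
  moreover have "closed {u. u \<bullet> e = 0}" by (intro closed_Collect_eq continuous_intros)
  ultimately show ?thesis
    by (simp add: negligible_iff_null_sets null_sets_completion_iff)
qed

text \<open>In a chart over a basis vector other than \<open>(0, \<i>)\<close> the imaginary part of \<open>w\<close> is one of the parameters,
  so its zero set is a coordinate hyperplane. These charts cover the set in question, because there
  the coordinate along \<open>(0, \<i>)\<close> vanishes and another one does not.\<close>

lemma emeasure_surface_real_w:
  fixes \<sigma> :: "('k::finite) cpoint measure"
  assumes m: "m \<ge> 1" and \<sigma>: "is_surface_measure (frontier (egg m)) \<sigma>"
  shows "emeasure \<sigma> {p \<in> frontier (egg m). Im (snd p) = 0} = 0"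
proof -
  let ?S = "frontier (egg m) :: 'k cpoint set"
  let ?N = "{p \<in> ?S. Im (snd p) = 0}"
  define I where "I = (Basis - {(0, \<i>)} :: 'k cpoint set) \<times> {1, -1 :: real}"
  have sr: "sets \<sigma> = {B \<in> sets borel. B \<subseteq> ?S}"
  proof -
    have "sets \<sigma> = sets (restrict_space borel ?S)" using \<sigma> by (simp add: is_surface_measure_def)
    also have "\<dots> = {B \<in> sets borel. B \<subseteq> ?S}" by (subst sets_restrict_space) auto
    finally show ?thesis .
  qed
  have iB: "(0, \<i>) \<in> (Basis :: 'k cpoint set)" by (auto simp: Basis_prod_def Basis_complex_def)
  have ip: "p \<bullet> (0, \<i>) = Im (snd p)" for p :: "'k cpoint" by (simp add: inner_prod_def)
  have Nb: "?N \<in> sets borel"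
    by (intro borel_closed closed_Collect_conj closed_Collect_eq continuous_intros) simp
  have NW: "?N \<inter> {p. s * (p \<bullet> b) > 0} \<in> null_sets \<sigma>" if "(b, s) \<in> I" for b s
  proof -
    have b: "b \<in> Basis" "b \<noteq> (0, \<i>)" "s = 1 \<or> s = -1" using that by (auto simp: I_def)
    obtain U \<phi> D \<pi> where c: "regular_patch ?S U \<phi> D" "\<phi> ` U = ?S \<inter> {p. s * (p \<bullet> b) > 0}"
       "\<forall>c\<in>Basis - {b}. \<exists>e\<in>Basis. \<forall>u. \<phi> u \<bullet> c = u \<bullet> e"
      using egg_chart[OF m b(1,3)] by blast
    obtain e where e: "e \<in> Basis" "\<And>u. \<phi> u \<bullet> (0, \<i>) = u \<bullet> e" using c(3) iB b by blast
    let ?B = "?N \<inter> {p. s * (p \<bullet> b) > 0}"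
    have Bb: "?B \<in> sets borel"
      by (intro sets.Int[OF Nb] borel_open open_Collect_less continuous_intros)
    have Bs: "?B \<in> sets \<sigma>" unfolding sr using Bb by auto
    have "emeasure \<sigma> ?B = (\<integral>\<^sup>+u. indicator U u * indicator ?B (\<phi> u) * ennreal (gram_jacobian (D u)) \<partial>lborel)"
      by (rule \<sigma>[unfolded is_surface_measure_def, THEN conjunct2, rule_format, OF c(1) Bs]) (unfold c(2), auto)
    also have "\<dots> = integral\<^sup>N (lborel :: 'k hparam measure) (\<lambda>_. 0)"
    proof (rule nn_integral_cong_AE)
      have "AE u in lborel. u \<notin> {u. u \<bullet> e = 0}" by (rule AE_not_in[OF hyperplane_null[OF e(1)]])
      then show "AE u in lborel. indicator U u * indicator ?B (\<phi> u) * ennreal (gram_jacobian (D u)) = 0"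
      proof eventually_elim
        case (elim u)
        then have "Im (snd (\<phi> u)) \<noteq> 0" using e(2)[of u] unfolding ip by simp
        then show ?case by simp
      qed
    qed
    finally show ?thesis using Bs by (simp add: null_sets_def)
  qed
  have sub: "?N \<subseteq> (\<Union>x\<in>I. ?N \<inter> {p. snd x * (p \<bullet> fst x) > 0})"
  proof
    fix p assume p: "p \<in> ?N"
    then have "p \<noteq> 0" using m unfolding frontier_egg[OF m] by (auto simp: power_0_left)
    then obtain b where b: "b \<in> Basis" "p \<bullet> b \<noteq> 0" using euclidean_all_zero_iff[of p] by blast
    have "b \<noteq> (0, \<i>)" using b p ip[of p] by auto
    then have "(b, sgn (p \<bullet> b)) \<in> I" using b by (auto simp: I_def sgn_if)
    then show "p \<in> (\<Union>x\<in>I. ?N \<inter> {p. snd x * (p \<bullet> fst x) > 0})"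
      using b p by (intro UN_I) (auto simp: sgn_if)
  qed
  have "countable I" by (auto simp: I_def intro!: countable_finite)
  then have null: "(\<Union>x\<in>I. ?N \<inter> {p. snd x * (p \<bullet> fst x) > 0}) \<in> null_sets \<sigma>"
  proof (rule null_sets_UN')
    fix x assume "x \<in> I"
    then show "?N \<inter> {p. snd x * (p \<bullet> fst x) > 0} \<in> null_sets \<sigma>" using NW[of "fst x" "snd x"] by simp
  qed
  have "?N \<in> sets \<sigma>" unfolding sr using Nb by auto
  then have "?N \<in> null_sets \<sigma>" by (rule null_sets_subset[OF null _ sub])
  then show ?thesis by (rule null_setsD1)
qed

section \<open>The Fefferman density\<close>

text \<open>Gaussian elimination: multiples of the lower rows clear the border row, and after transposition
  the border column, leaving the Schur complement in the corner.\<close>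

lemma det_bordered_diagonal:
  fixes x y h :: "'a::finite \<Rightarrow> complex" and c :: complex
  assumes h: "\<And>j. h j \<noteq> 0"
  shows "det (\<chi> a b. case a of
            None \<Rightarrow> (case b of None \<Rightarrow> c | Some l \<Rightarrow> x l)
          | Some j \<Rightarrow> (case b of None \<Rightarrow> y j | Some l \<Rightarrow> if j = l then h j else 0)) =
    (c - (\<Sum>j\<in>UNIV. x j * y j / h j)) * (\<Prod>j\<in>UNIV. h j)" (is "det ?A = ?rhs")
proof -
  define A where "A = ?A"
  let ?c = "c - (\<Sum>j\<in>UNIV. x j * y j / h j)"
  define B :: "complex ^ 'a option ^ 'a option" where
    "B = (\<chi> a b. case a of
            None \<Rightarrow> (case b of None \<Rightarrow> ?c | Some l \<Rightarrow> y l)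
          | Some j \<Rightarrow> (case b of None \<Rightarrow> 0 | Some l \<Rightarrow> if j = l then h j else 0))"
  define C :: "complex ^ 'a option ^ 'a option" where
    "C = (\<chi> a b. if a = b then (case a of None \<Rightarrow> ?c | Some j \<Rightarrow> h j) else 0)"
  define v where "v = (\<Sum>j\<in>UNIV. (- x j / h j) *s row (Some j) A)"
  define w where "w = (\<Sum>j\<in>UNIV. (- y j / h j) *s row (Some j) B)"
  have v: "v \<in> vec.span {row j A |j. j \<noteq> None}"
    unfolding v_def
  proof (rule vec.span_sum, rule vec.span_scale, rule vec.span_base)
    fix j :: 'a
    show "row (Some j) A \<in> {row j A |j. j \<noteq> None}"
      by (rule CollectI, rule exI[of _ "Some j"]) simp
  qed
  have w: "w \<in> vec.span {row j B |j. j \<noteq> None}"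
    unfolding w_def
  proof (rule vec.span_sum, rule vec.span_scale, rule vec.span_base)
    fix j :: 'a
    show "row (Some j) B \<in> {row j B |j. j \<noteq> None}"
      by (rule CollectI, rule exI[of _ "Some j"]) simp
  qed
  have vn: "v $ None = - (\<Sum>j\<in>UNIV. x j * y j / h j)"
    unfolding v_def by (simp add: row_def A_def sum_negf)
  have vs: "v $ Some l = - x l" for l
    unfolding v_def A_def
    by (simp add: sum_component row_def if_distrib h cong: if_cong)
  have wn: "w $ None = 0" unfolding w_def B_def by (simp add: row_def)
  have ws: "w $ Some l = - y l" for l
    unfolding w_def B_def
    by (simp add: sum_component row_def if_distrib h cong: if_cong)
  have "det A = det (\<chi> k. if k = None then row None A + v else row k A)"
    using det_row_span[OF v] by simp
  also have "(\<chi> k. if k = None then row None A + v else row k A) = transpose B"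
    by (auto simp: vec_eq_iff transpose_def A_def B_def row_def vn vs split: option.splits)
  also have "det (transpose B) = det (\<chi> k. if k = None then row None B + w else row k B)"
    using det_row_span[OF w] by simp
  also have "(\<chi> k. if k = None then row None B + w else row k B) = C"
    by (auto simp: vec_eq_iff C_def B_def row_def wn ws split: option.splits)
  also have "det C = (\<Prod>i\<in>UNIV. C $ i $ i)"
    by (rule det_diagonal) (simp add: C_def)
  also have "\<dots> = ?rhs"
    by (simp add: UNIV_option_conv prod.reindex C_def)
  finally show ?thesis unfolding A_def .
qed

lemma egg_defining_has_derivative:
  "(egg_defining m has_derivative
     (\<lambda>v. 2 * (fst p \<bullet> fst v) + real m * (2 * (snd p \<bullet> snd v)) * (snd p \<bullet> snd p) ^ (m - 1))) (at p)"
proof -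
  have *: "egg_defining m = (\<lambda>p. fst p \<bullet> fst p + (snd p \<bullet> snd p) ^ m - 1)"
    by (simp add: egg_defining_def fun_eq_iff norm_even_power_inner power2_norm_eq_inner)
  show ?thesis unfolding *
    by (auto intro!: derivative_eq_intros simp: inner_commute algebra_simps)
qed

lemma complex_egg_defining_frechet:
  "frechet_derivative (\<lambda>q. complex_of_real (egg_defining m q)) (at p) =
    (\<lambda>v. complex_of_real (2 * (fst p \<bullet> fst v) + real m * (2 * (snd p \<bullet> snd v)) * (snd p \<bullet> snd p) ^ (m - 1)))"
  by (rule frechet_derivative_at[OF bounded_linear.has_derivative[OF bounded_linear_of_real egg_defining_has_derivative], symmetric])

lemma fst_coord_vec: "fst (coord_vec (Some j) c) = axis j c" "fst (coord_vec None c) = 0"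
  and snd_coord_vec: "snd (coord_vec (Some j) c) = 0" "snd (coord_vec None c) = c"
  by (simp_all add: coord_vec_def)

lemma wirtinger_egg_defining:
  "wirtinger (Some j) (\<lambda>q. complex_of_real (egg_defining m q)) p = cnj (fst p $ j)"
  "wirtinger None (\<lambda>q. complex_of_real (egg_defining m q)) p = of_nat m * cnj (snd p) * of_real ((snd p \<bullet> snd p) ^ (m - 1))"
  by (simp_all add: wirtinger_def complex_egg_defining_frechet fst_coord_vec snd_coord_vec
      inner_axis complex_eq_iff inner_complex_def algebra_simps)

lemma wirtinger_bar_egg_defining:
  "wirtinger_bar (Some j) (\<lambda>q. complex_of_real (egg_defining m q)) = (\<lambda>p. fst p $ j)"
  "wirtinger_bar None (\<lambda>q. complex_of_real (egg_defining m q)) = (\<lambda>p. of_nat m * snd p * of_real ((snd p \<bullet> snd p) ^ (m - 1)))"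
  by (simp_all add: fun_eq_iff wirtinger_bar_def complex_egg_defining_frechet fst_coord_vec snd_coord_vec
      inner_axis complex_eq_iff inner_complex_def algebra_simps)

lemma wirtinger_second_z:
  "wirtinger a (\<lambda>p::('k::finite) cpoint. fst p $ l) p = (if a = Some l then 1 else 0)"
proof -
  have "bounded_linear (\<lambda>p::'k cpoint. fst p $ l)"
    by (rule bounded_linear_compose[OF bounded_linear_vec_nth bounded_linear_fst])
  then have "((\<lambda>p::'k cpoint. fst p $ l) has_derivative (\<lambda>v. fst v $ l)) (at p)"
    by (rule bounded_linear_imp_has_derivative)
  then have "frechet_derivative (\<lambda>p::'k cpoint. fst p $ l) (at p) = (\<lambda>v. fst v $ l)"
    by (rule frechet_derivative_at[symmetric])
  then show ?thesis
    by (cases a) (simp_all add: wirtinger_def fst_coord_vec axis_def)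
qed

text \<open>The mixed second derivative of \<open>|w|\<^sup>2\<^sup>m\<close> is \<open>m\<^sup>2 |w|\<^bsup>2m-2\<^esup>\<close>.\<close>

lemma wirtinger_second_w:
  assumes m: "m \<ge> 1"
  shows "wirtinger a (\<lambda>p::('k::finite) cpoint. of_nat m * snd p * of_real ((snd p \<bullet> snd p) ^ (m - 1))) p =
    (if a = None then of_real ((real m)\<^sup>2 * (snd p \<bullet> snd p) ^ (m - 1)) else 0)"
proof -
  let ?f = "\<lambda>p::'k cpoint. of_nat m * snd p * of_real ((snd p \<bullet> snd p) ^ (m - 1)) :: complex"
  let ?D = "\<lambda>v. of_nat m * snd v * of_real ((snd p \<bullet> snd p) ^ (m - 1)) +
     of_nat m * snd p * of_real (real (m - 1) * (2 * (snd p \<bullet> snd v)) * (snd p \<bullet> snd p) ^ (m - 2)) :: complex"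
  have "(?f has_derivative ?D) (at p)"
    by (auto intro!: derivative_eq_intros simp: inner_commute algebra_simps numeral_2_eq_2)
  then have fr: "frechet_derivative ?f (at p) = ?D"
    by (rule frechet_derivative_at[symmetric])
  show ?thesis
  proof (cases a)
    case None
    have pw: "real (m - 1) * (snd p \<bullet> snd p) ^ (m - 1) = real (m - 1) * ((snd p \<bullet> snd p) * (snd p \<bullet> snd p) ^ (m - 2))"
    proof (cases "m = 1")
      case False
      then have "m - 1 = Suc (m - 2)" using m by simp
      then show ?thesis by simp
    qed simp
    have "wirtinger None ?f p = of_nat m * of_real ((snd p \<bullet> snd p) ^ (m - 1)) +
      of_nat m * (snd p * cnj (snd p)) * of_real (real (m - 1) * (snd p \<bullet> snd p) ^ (m - 2))"
      unfolding wirtinger_def fr snd_coord_vec by (simp add: complex_eq_iff inner_complex_def algebra_simps)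
    also have "snd p * cnj (snd p) = of_real (snd p \<bullet> snd p)"
      by (simp add: complex_mult_cnj inner_complex_def power2_eq_square)
    also have "of_nat m * of_real ((snd p \<bullet> snd p) ^ (m - 1)) + of_nat m * of_real (snd p \<bullet> snd p) * of_real (real (m - 1) * (snd p \<bullet> snd p) ^ (m - 2))
      = complex_of_real (real m * (snd p \<bullet> snd p) ^ (m - 1) + real m * (real (m - 1) * ((snd p \<bullet> snd p) * (snd p \<bullet> snd p) ^ (m - 2))))"
      by (simp add: mult_ac)
    also have "\<dots> = of_real ((real m)\<^sup>2 * (snd p \<bullet> snd p) ^ (m - 1))"
      unfolding pw[symmetric] using m by (simp add: of_nat_diff power2_eq_square algebra_simps)
    finally show ?thesis using None by simp
  next
    case (Some j)
    show ?thesis unfolding Some wirtinger_def fr by (simp add: snd_coord_vec)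
  qed
qed

text \<open>The complex Hessian is diagonal, so \<open>det_bordered_diagonal\<close> applies where its entry for \<open>w\<close> is
  nonzero. Where that entry vanishes, a whole row of the bordered matrix does.\<close>

lemma fefferman_M_egg:
  fixes p :: "('k::finite) cpoint"
  assumes m: "m \<ge> 1"
  shows "fefferman_M (egg_defining m) p =
    (real m)\<^sup>2 * (cmod (snd p)) ^ (2 * (m - 1)) * ((norm (fst p))\<^sup>2 + cmod (snd p) ^ (2 * m))"
proof -
  let ?s = "snd p \<bullet> snd p"
  define x where "x = (\<lambda>a. case a of None \<Rightarrow> of_nat m * snd p * of_real (?s ^ (m - 1)) | Some j \<Rightarrow> fst p $ j)"
  define y where "y = (\<lambda>a. case a of None \<Rightarrow> of_nat m * cnj (snd p) * of_real (?s ^ (m - 1)) | Some j \<Rightarrow> cnj (fst p $ j))"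
  define h where "h = (\<lambda>a::'k option. case a of None \<Rightarrow> of_real ((real m)\<^sup>2 * ?s ^ (m - 1)) | Some j \<Rightarrow> (1 :: complex))"
  have A: "bordered_hessian (egg_defining m) p = (\<chi> a b. case a of
            None \<Rightarrow> (case b of None \<Rightarrow> 0 | Some l \<Rightarrow> x l)
          | Some j \<Rightarrow> (case b of None \<Rightarrow> y j | Some l \<Rightarrow> if j = l then h j else 0))"
    unfolding bordered_hessian_def Let_def
    by (auto simp: vec_eq_iff x_def y_def h_def wirtinger_egg_defining wirtinger_bar_egg_defining
        wirtinger_second_z wirtinger_second_w[OF m, simplified] split: option.splits)
  have s: "cmod (snd p) ^ (2 * j) = ?s ^ j" for j by (rule norm_even_power_inner)
  show ?thesis
  proof (cases "?s ^ (m - 1) = 0")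
    case True
    then have "h None = 0" "y None = 0" by (simp_all add: h_def y_def)
    then have "row (Some None) (bordered_hessian (egg_defining m) p) = 0"
      unfolding A by (auto simp: vec_eq_iff row_def split: option.splits)
    then have "det (bordered_hessian (egg_defining m) p) = 0" by (rule det_zero_row)
    then show ?thesis using True by (simp add: fefferman_M_def s)
  next
    case False
    then have h: "h j \<noteq> 0" for j using m by (auto simp: h_def split: option.splits)
    have "det (bordered_hessian (egg_defining m) p) = (0 - (\<Sum>j\<in>UNIV. x j * y j / h j)) * (\<Prod>j\<in>UNIV. h j)"
      unfolding A by (rule det_bordered_diagonal) (rule h)
    also have "(\<Prod>j\<in>UNIV. h j) = of_real ((real m)\<^sup>2 * ?s ^ (m - 1))"
      by (simp add: UNIV_option_conv prod.reindex h_def)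
    also have "(\<Sum>j\<in>UNIV. x j * y j / h j) = x None * y None / h None + (\<Sum>j\<in>UNIV. fst p $ j * cnj (fst p $ j))"
      by (simp add: UNIV_option_conv sum.reindex x_def y_def h_def)
    also have "(\<Sum>j\<in>UNIV. fst p $ j * cnj (fst p $ j)) = of_real ((norm (fst p))\<^sup>2)"
      by (simp add: complex_mult_cnj norm_vec_def L2_set_def sum_nonneg cmod_power2)
    also have "x None * y None / h None = of_real (?s ^ m)"
    proof -
      have "x None * y None = of_real ((real m)\<^sup>2 * ?s ^ (m - 1)) * (snd p * cnj (snd p)) * of_real (?s ^ (m - 1))"
        by (simp add: x_def y_def power2_eq_square mult_ac)
      also have "snd p * cnj (snd p) = of_real ?s"
        by (simp add: complex_mult_cnj inner_complex_def power2_eq_square)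
      finally have "x None * y None / h None = of_real ?s * of_real (?s ^ (m - 1))"
        using h[of None] by (simp add: h_def)
      also have "\<dots> = of_real (?s ^ m)"
        using m by (cases m) auto
      finally show ?thesis .
    qed
    finally have "det (bordered_hessian (egg_defining m) p) =
       complex_of_real (- ((?s ^ m + (norm (fst p))\<^sup>2) * ((real m)\<^sup>2 * ?s ^ (m - 1))))"
      by (simp add: algebra_simps)
    then show ?thesis unfolding fefferman_M_def s
      by (simp only: Re_complex_of_real) (simp add: algebra_simps)
  qed
qed

lemma norm_real_gradient_egg:
  assumes m: "m \<ge> 1"
  shows "norm (real_gradient (egg_defining m) p) =
     sqrt (4 * (norm (fst p))\<^sup>2 + 4 * (real m)\<^sup>2 * cmod (snd p) ^ (2 * (2 * m - 1)))"
proof -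
  let ?s = "snd p \<bullet> snd p"
  define g where "g = (2 *\<^sub>R fst p, (2 * real m * ?s ^ (m - 1)) *\<^sub>R snd p)"
  have fr: "frechet_derivative (egg_defining m) (at p) = (\<lambda>v. g \<bullet> v)"
    using frechet_derivative_at[OF egg_defining_has_derivative[of m p]]
    by (simp add: fun_eq_iff g_def inner_prod_def algebra_simps)
  have "real_gradient (egg_defining m) p = g"
    unfolding real_gradient_def fr by (rule euclidean_representation)
  moreover have "norm g ^ 2 = 4 * (norm (fst p))\<^sup>2 + 4 * (real m)\<^sup>2 * (?s ^ (m - 1) * ?s ^ (m - 1) * ?s)"
    unfolding power2_norm_eq_inner g_def by (simp add: inner_prod_def power2_eq_square algebra_simps)
  moreover have "?s ^ (m - 1) * ?s ^ (m - 1) * ?s = cmod (snd p) ^ (2 * (2 * m - 1))"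
  proof -
    have "?s ^ (m - 1) * ?s ^ (m - 1) * ?s = ?s ^ (2 * m - 1)"
      using m by (cases m) (simp_all add: mult_2 power_add)
    then show ?thesis by (simp add: norm_even_power_inner)
  qed
  ultimately show ?thesis by (metis norm_ge_zero real_sqrt_abs2 real_sqrt_unique)
qed

section \<open>Polar coordinates on the boundary\<close>

lemma gram_jacobian_cong:
  assumes "\<And>i j. D (axis i 1) \<bullet> D (axis j 1) = E (axis i 1) \<bullet> E (axis j 1)"
  shows "gram_jacobian D = gram_jacobian E"
  unfolding gram_jacobian_def by (simp add: assms)

text \<open>The Gram matrix is \<open>I + a a\<^sup>T\<close>. Rotating the parameters so that a basis vector points along \<open>a\<close>
  diagonalizes it.\<close>

lemma gram_jacobian_rank_one:
  fixes a :: "real ^ 'n"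
  shows "gram_jacobian (\<lambda>x. (x, a \<bullet> x)) = sqrt (1 + a \<bullet> a)"
proof -
  obtain k :: 'n where True by simp
  have "norm (norm a *\<^sub>R axis k (1::real)) = norm a" by simp
  then obtain f where f: "orthogonal_transformation f" "f (norm a *\<^sub>R axis k (1::real)) = a"
    by (rule orthogonal_transformation_exists)
  have lf: "linear f" and ff: "f x \<bullet> f y = x \<bullet> y" for x y
    using f(1) by (auto simp: orthogonal_transformation_def)
  have df: "\<bar>det (matrix f)\<bar> = 1"
    using f(1) det_orthogonal_matrix[of "matrix f"] orthogonal_transformation_matrix[of f] by auto
  have lE: "linear (\<lambda>x. (x, a \<bullet> x))" by (auto intro!: linearI simp: inner_add_right)
  have "gram_jacobian (\<lambda>x. (x, a \<bullet> x)) = gram_jacobian (\<lambda>v. (f v, a \<bullet> f v))"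
    using gram_jacobian_compose[OF lE lf] df by simp
  also have "\<dots> = sqrt (det (\<chi> i j. if i = j then (if i = k then 1 + a \<bullet> a else 1) else 0 :: real ^ 'n ^ 'n))"
  proof -
    have afx: "a \<bullet> f (axis i 1) = (if i = k then norm a else 0)" for i
      using ff[of "norm a *\<^sub>R axis k 1" "axis i 1"] unfolding f(2)
      by (simp add: inner_axis_axis)
    have "(\<chi> i j. (f (axis i 1), a \<bullet> f (axis i 1)) \<bullet> (f (axis j 1), a \<bullet> f (axis j 1))) =
      (\<chi> i j. if i = j then (if i = k then 1 + a \<bullet> a else 1) else 0 :: real ^ 'n ^ 'n)"
      by (auto simp: vec_eq_iff inner_prod_def ff afx inner_axis_axis simp flip: power2_norm_eq_inner power2_eq_square)
    then show ?thesis by (simp add: gram_jacobian_def)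
  qed
  also have "det (\<chi> i j. if i = j then (if i = k then 1 + a \<bullet> a else 1) else 0 :: real ^ 'n ^ 'n) = 1 + a \<bullet> a"
    by (subst det_diagonal) simp_all
  finally show ?thesis .
qed

definition polar_radius :: "nat \<Rightarrow> complex ^ 'k \<Rightarrow> real" where
  "polar_radius m z = (1 - (norm z)\<^sup>2) powr (1 / (2 * real m))"

definition polar_point :: "nat \<Rightarrow> (complex ^ 'k) \<times> real \<Rightarrow> ('k::finite) cpoint" where
  "polar_point m = (\<lambda>(z, t). (z, of_real (polar_radius m z) * cis t))"

definition polar_domain :: "((complex ^ 'k::finite) \<times> real) set" where
  "polar_domain = {(z, t). norm z < 1 \<and> - pi < t \<and> t < pi}"

definition polar_radius_deriv :: "nat \<Rightarrow> complex ^ 'k \<Rightarrow> complex ^ 'k \<Rightarrow> real" where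
  "polar_radius_deriv m z v = - (z \<bullet> v) / real m * (1 - (norm z)\<^sup>2) powr (1 / (2 * real m) - 1)"

definition polar_deriv :: "nat \<Rightarrow> (complex ^ 'k) \<times> real \<Rightarrow> (complex ^ 'k) \<times> real \<Rightarrow> ('k::finite) cpoint" where
  "polar_deriv m p v = (fst v, of_real (polar_radius_deriv m (fst p) (fst v)) * cis (snd p)
     + of_real (polar_radius m (fst p) * snd v) * (\<i> * cis (snd p)))"

lemma one_minus_norm_pos: "norm z < 1 \<Longrightarrow> 0 < 1 - (norm z)\<^sup>2"
  by (simp add: abs_square_less_1)

lemma polar_radius_pos: "norm z < 1 \<Longrightarrow> polar_radius m z > 0"
  using one_minus_norm_pos[of z] by (simp add: polar_radius_def)

lemma polar_radius_power:
  assumes "norm z < 1" "m \<ge> 1"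
  shows "polar_radius m z ^ (2 * m) = 1 - (norm z)\<^sup>2"
  using one_minus_norm_pos[OF assms(1)] assms(2)
  by (simp add: polar_radius_def powr_realpow[symmetric] powr_powr)

lemma polar_radius_has_derivative:
  assumes "norm z < 1" "m \<ge> 1"
  shows "(polar_radius m has_derivative polar_radius_deriv m z) (at z)"
proof -
  have x: "0 < 1 - z \<bullet> z" using one_minus_norm_pos[OF assms(1)] by (simp add: power2_norm_eq_inner)
  have "((\<lambda>z. (1 - z \<bullet> z) powr (1 / (2 * real m))) has_derivative
      (\<lambda>v. - (2 * (z \<bullet> v)) * (1 / (2 * real m) * (1 - z \<bullet> z) powr (1 / (2 * real m) - 1)))) (at z)"
  proof (rule DERIV_compose_FDERIV[where f = "\<lambda>x. x powr (1 / (2 * real m))" and g = "\<lambda>z. 1 - z \<bullet> z"])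
    show "((\<lambda>z. 1 - z \<bullet> z) has_derivative (\<lambda>v. - (2 * (z \<bullet> v)))) (at z)"
      by (auto intro!: derivative_eq_intros simp: inner_commute)
    show "((\<lambda>x. x powr (1 / (2 * real m))) has_real_derivative 1 / (2 * real m) * (1 - z \<bullet> z) powr (1 / (2 * real m) - 1)) (at (1 - z \<bullet> z))"
      using x by (rule has_real_derivative_powr)
  qed
  then show ?thesis
    by (simp add: polar_radius_def[abs_def] polar_radius_deriv_def[abs_def] power2_norm_eq_inner field_simps)
qed

lemma cis_has_derivative: "(cis has_derivative (\<lambda>v. of_real v * (\<i> * cis t))) (at t)"
proof -
  have "(cis has_vector_derivative \<i> * cis t) (at t)"
  proof -
    have "((\<lambda>t. exp (\<i> * of_real t)) has_vector_derivative \<i> * exp (\<i> * of_real t)) (at t)"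
      by (rule has_vector_derivative_real_field) (auto intro!: derivative_eq_intros)
    then show ?thesis by (simp add: cis_conv_exp[abs_def])
  qed
  then show ?thesis by (simp add: has_vector_derivative_def scaleR_conv_of_real)
qed

lemma polar_point_has_derivative:
  assumes p: "p \<in> polar_domain" and m: "m \<ge> 1"
  shows "(polar_point m has_derivative polar_deriv m p) (at p)"
proof -
  have n: "norm (fst p) < 1" using p by (auto simp: polar_domain_def)
  have 1: "((\<lambda>q::(complex^'a) \<times> real. complex_of_real (polar_radius m (fst q))) has_derivative (\<lambda>v. complex_of_real (polar_radius_deriv m (fst p) (fst v)))) (at p)"
    by (rule bounded_linear.has_derivative[OF bounded_linear_of_real])
      (rule has_derivative_compose[OF bounded_linear_imp_has_derivative[OF bounded_linear_fst] polar_radius_has_derivative[OF n m]])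
  have 2: "((\<lambda>q::(complex^'a) \<times> real. cis (snd q)) has_derivative (\<lambda>v. of_real (snd v) * (\<i> * cis (snd p)))) (at p)"
    by (rule has_derivative_compose[OF bounded_linear_imp_has_derivative[OF bounded_linear_snd] cis_has_derivative])
  have 3: "polar_point m = (\<lambda>q::(complex^'a) \<times> real. (fst q, of_real (polar_radius m (fst q)) * cis (snd q)))"
    by (auto simp: polar_point_def fun_eq_iff)
  have 4: "polar_deriv m p = (\<lambda>v. (fst v, complex_of_real (polar_radius m (fst p)) * (of_real (snd v) * (\<i> * cis (snd p))) + complex_of_real (polar_radius_deriv m (fst p) (fst v)) * cis (snd p)))"
    by (auto simp: polar_deriv_def fun_eq_iff)
  show ?thesis
    unfolding 3 4
    by (rule has_derivative_Pair[OF bounded_linear_imp_has_derivative[OF bounded_linear_fst] has_derivative_mult[OF 1 2]])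
qed

text \<open>The radial and angular unit vectors \<open>cis t\<close> and \<open>\<i> * cis t\<close> are orthonormal in \<open>\<complex> = \<real>\<^sup>2\<close>.\<close>

lemma polar_deriv_inner:
  "polar_deriv m p v \<bullet> polar_deriv m p w =
     fst v \<bullet> fst w + polar_radius_deriv m (fst p) (fst v) * polar_radius_deriv m (fst p) (fst w)
      + (polar_radius m (fst p))\<^sup>2 * (snd v * snd w)"
proof -
  define c where "c = cos (snd p)"
  define d where "d = sin (snd p)"
  have cis: "cis (snd p) = Complex c d" by (simp add: c_def d_def complex_eq_iff)
  have cd: "c * c + d * d = 1" using sin_cos_squared_add2[of "snd p"] by (simp add: c_def d_def power2_eq_square)
  have "polar_deriv m p v \<bullet> polar_deriv m p w = fst v \<bullet> fst w +
     (polar_radius_deriv m (fst p) (fst v) * polar_radius_deriv m (fst p) (fst w)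
      + (polar_radius m (fst p))\<^sup>2 * (snd v * snd w)) * (c * c + d * d)"
    unfolding polar_deriv_def inner_prod_def inner_complex_def power2_eq_square cis
    by simp (simp add: algebra_simps)
  then show ?thesis by (simp add: cd)
qed

lemma open_polar_domain: "open polar_domain"
proof -
  have *: "polar_domain = {p :: (complex^'a) \<times> real. norm (fst p) < 1 \<and> - pi < snd p \<and> snd p < pi}"
    by (auto simp: polar_domain_def)
  show ?thesis unfolding *
    by (intro open_Collect_conj open_Collect_less continuous_intros)
qed

lemma inj_on_polar_point: "inj_on (polar_point m) polar_domain"
proof (rule inj_onI)
  fix p q :: "(complex^'a) \<times> real" assume *: "p \<in> polar_domain" "q \<in> polar_domain" "polar_point m p = polar_point m q"
  then have f: "fst p = fst q" by (auto simp: polar_point_def case_prod_beta)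
  have n: "norm (fst p) < 1" using * by (auto simp: polar_domain_def)
  then have "cis (snd p) = cis (snd q)"
    using * f polar_radius_pos[OF n, of m] by (auto simp: polar_point_def case_prod_beta)
  moreover have "Arg (cis (snd p)) = snd p" "Arg (cis (snd q)) = snd q"
    using * by (auto intro!: Arg_cis simp: polar_domain_def)
  ultimately show "p = q" using f by (metis prod_eqI)
qed

text \<open>The polar patch leaves out the boundary points whose \<open>w\<close> is a nonpositive real; they lie in the null
  set \<open>Im w = 0\<close>.\<close>

lemma polar_point_image:
  assumes m: "m \<ge> 1"
  shows "polar_point m ` polar_domain \<subseteq> (frontier (egg m) :: ('k::finite) cpoint set)" (is ?A)
    and "{p \<in> frontier (egg m). Im (snd p) \<noteq> 0} \<subseteq> (polar_point m ` polar_domain :: 'k cpoint set)" (is ?B)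
proof -
  show ?A
    unfolding frontier_egg[OF m]
    using m by (auto simp: polar_domain_def polar_point_def norm_mult polar_radius_power abs_of_pos polar_radius_pos power_mult_distrib)
  show ?B
  proof clarify
    fix z :: "complex^'k" and w assume p: "(z, w) \<in> frontier (egg m)" and i: "Im (snd (z, w)) \<noteq> 0"
    have w0: "w \<noteq> 0" using i by auto
    have e: "(norm z)\<^sup>2 + cmod w ^ (2 * m) = 1" using p unfolding frontier_egg[OF m] by simp
    moreover have "cmod w ^ (2 * m) > 0" using w0 by simp
    ultimately have "(norm z)\<^sup>2 < 1" by linarith
    then have n: "norm z < 1" by (simp add: abs_square_less_1)
    have "polar_radius m z ^ (2 * m) = cmod w ^ (2 * m)"
      using polar_radius_power[OF n m] e by simp
    then have r: "polar_radius m z = cmod w"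
      using polar_radius_pos[OF n, of m] m by (metis norm_ge_zero less_imp_le power_eq_imp_eq_base mult_pos_pos zero_less_numeral less_le_trans zero_less_one)
    have "Arg w \<noteq> pi" using i Arg_eq_pi[of w] by auto
    then have "(z, Arg w) \<in> polar_domain" using n Arg_bounded[of w] by (auto simp: polar_domain_def)
    moreover have "polar_point m (z, Arg w) = (z, w)"
      using rcis_cmod_Arg[of w] by (simp add: polar_point_def r rcis_def)
    ultimately show "(z, w) \<in> polar_point m ` polar_domain" by force
  qed
qed

lemma polar_regular_patch:
  fixes J :: "('k::finite) hparam \<Rightarrow> (complex ^ 'k) \<times> real"
  assumes m: "m \<ge> 1" and J: "linear J" "bij_betw J Basis Basis"
  shows "regular_patch (frontier (egg m)) (J -` polar_domain) (\<lambda>u. polar_point m (J u)) (\<lambda>u v. polar_deriv m (J u) (J v))"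
proof -
  have blJ: "bounded_linear J" using J(1) by (simp add: linear_conv_bounded_linear)
  have JJ: "J x \<bullet> J y = x \<bullet> y" for x y
    using basis_map_inner[OF J(1)] J(2) by (auto simp: bij_betw_def)
  have injJ: "inj J"
  proof (rule injI)
    fix x y assume "J x = J y"
    then have "J (x - y) = 0" by (simp add: linear_diff[OF J(1)])
    then have "(x - y) \<bullet> (x - y) = 0" using JJ[of "x - y" "x - y"] by simp
    then show "x = y" by simp
  qed
  have oU: "open (J -` polar_domain)"
    using open_polar_domain linear_continuous_on[OF blJ] by (rule open_vimage)
  show ?thesis unfolding regular_patch_def
  proof (intro conjI ballI allI)
    show "open (J -` polar_domain)" by (rule oU)
    show "inj_on (\<lambda>u. polar_point m (J u)) (J -` polar_domain)"
    proof (rule inj_onI)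
      fix x y assume "x \<in> J -` polar_domain" "y \<in> J -` polar_domain" "polar_point m (J x) = polar_point m (J y)"
      then have "J x = J y" using inj_onD[OF inj_on_polar_point, of m "J x" "J y"] by simp
      then show "x = y" by (rule injD[OF injJ])
    qed
    show "(\<lambda>u. polar_point m (J u)) ` (J -` polar_domain) \<subseteq> frontier (egg m)"
      using polar_point_image(1)[OF m] by auto
    fix u assume u: "u \<in> J -` polar_domain"
    then show "((\<lambda>u. polar_point m (J u)) has_derivative (\<lambda>v. polar_deriv m (J u) (J v))) (at u)"
      by (intro has_derivative_compose[OF bounded_linear_imp_has_derivative[OF blJ] polar_point_has_derivative] m) auto
    show "inj (\<lambda>v. polar_deriv m (J u) (J v))"
    proof (rule injI)
      fix x y assume e: "polar_deriv m (J u) (J x) = polar_deriv m (J u) (J y)"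
      have f: "fst (J x) = fst (J y)" using e by (simp add: polar_deriv_def)
      have "polar_radius m (fst (J u)) > 0" using u by (auto simp: polar_domain_def intro: polar_radius_pos)
      then have "snd (J x) = snd (J y)" using e f by (simp add: polar_deriv_def)
      then have "J x = J y" using f by (simp add: prod_eq_iff)
      then show "x = y" using injJ by (auto dest: injD)
    qed
  next
    fix v
    have n: "0 < 1 - (norm (fst (J u)))\<^sup>2" if "u \<in> J -` polar_domain" for u
    proof (rule one_minus_norm_pos)
      show "norm (fst (J u)) < 1" using that by (auto simp: polar_domain_def)
    qed
    have n0: "(norm (fst (J u)))\<^sup>2 \<noteq> 1" if "J u \<in> polar_domain" for u
      using n[of u] that by simp
    have cJ: "continuous_on A J" for A using blJ by (rule linear_continuous_on)
    let ?U = "J -` polar_domain"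
    have c0: "continuous_on ?U (\<lambda>u. fst (J u))" "continuous_on ?U (\<lambda>u. snd (J u))"
      by (rule continuous_on_fst[OF cJ], rule continuous_on_snd[OF cJ])
    have c1: "continuous_on ?U (\<lambda>u. 1 - (norm (fst (J u)))\<^sup>2)"
      by (intro continuous_on_diff continuous_on_const continuous_on_power continuous_on_norm c0)
    have c2: "continuous_on ?U (\<lambda>u. (1 - (norm (fst (J u)))\<^sup>2) powr a)" for a
      by (rule continuous_on_powr[OF c1 continuous_on_const]) (use n0 in auto)
    have c3: "continuous_on ?U (\<lambda>u. cis (snd (J u)))"
    proof (rule continuous_on_compose2[OF _ c0(2)])
      show "continuous_on UNIV cis"
        using cis_has_derivative has_derivative_continuous by (blast intro: continuous_at_imp_continuous_on)
    qed auto
    have c4: "continuous_on ?U (\<lambda>u. fst (J u) \<bullet> fst (J v))"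
      by (intro continuous_on_inner c0 continuous_on_const)
    show "continuous_on ?U (\<lambda>u. polar_deriv m (J u) (J v))"
      unfolding polar_deriv_def polar_radius_deriv_def polar_radius_def divide_inverse
      by (intro continuous_on_Pair continuous_on_add continuous_on_mult continuous_on_of_real continuous_on_const
          continuous_on_minus c2 c3 c4)
  qed
qed

text \<open>After rescaling the angular parameter by the radius, the Gram matrix becomes that of a graph
  \<open>x \<mapsto> (x, a \<bullet> x)\<close>, where \<open>a\<close> is the gradient of the radius.\<close>

lemma gram_jacobian_polar:
  fixes J :: "('k::finite) hparam \<Rightarrow> (complex ^ 'k) \<times> real"
  assumes J: "linear J" "bij_betw J Basis Basis" and p: "norm (fst p) < 1"
  shows "gram_jacobian (\<lambda>v. polar_deriv m p (J v)) =
    polar_radius m (fst p) * sqrt (1 + (norm (fst p))\<^sup>2 / (real m)\<^sup>2 * (1 - (norm (fst p))\<^sup>2) powr (1 / real m - 2))"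
proof -
  let ?R = "polar_radius m (fst p)"
  define k where "k = - (1 / real m) * (1 - (norm (fst p))\<^sup>2) powr (1 / (2 * real m) - 1)"
  define a :: "'k hparam" where "a = (\<chi> i. k * (fst p \<bullet> fst (J (axis i 1))))"
  have JB: "J (axis i 1) \<in> Basis" for i using J(2) by (auto simp: bij_betw_def Basis_vec_def)
  have JJ: "J x \<bullet> J y = x \<bullet> y" for x y
    using basis_map_inner[OF J(1)] J(2) by (auto simp: bij_betw_def)
  define d where "d i = (if J (axis i 1) = (0, 1) then ?R else 1)" for i
  define L where "L x = (\<chi> i. d i * x $ i)" for x :: "'k hparam"
  have linL: "linear L" by (auto intro!: linearI simp: L_def vec_eq_iff algebra_simps)
  have Jc: "J (axis i 1) = (0, 1) \<or> (snd (J (axis i 1)) = 0 \<and> J (axis i 1) \<noteq> (0,1))" for i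
    using JB[of i] by (auto simp: Basis_prod_def)
  have RD: "polar_radius_deriv m (fst p) (fst (J (axis i 1))) = a $ i" for i
    by (simp add: polar_radius_deriv_def a_def k_def)
  \<comment> \<open>The map \<open>L\<close> rescales the angular parameter; \<open>a\<close> has no angular component, so \<open>L\<close> does not change \<open>a \<bullet> x\<close>.\<close>
  have "gram_jacobian (\<lambda>v. polar_deriv m p (J v)) = gram_jacobian (\<lambda>v. (L v, a \<bullet> L v))"
  proof (rule gram_jacobian_cong)
    fix i j
    have La: "L (axis i 1) = d i *\<^sub>R axis i 1" for i by (auto simp: L_def vec_eq_iff axis_def)
    have da: "d i * a $ i = a $ i" for i using Jc[of i] by (auto simp: d_def a_def)
    have ip: "J (axis i 1) \<bullet> J (axis j 1) = (if i = j then 1 else 0)" for i j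
      by (simp add: JJ inner_axis_axis)
    have "polar_deriv m p (J (axis i 1)) \<bullet> polar_deriv m p (J (axis j 1)) =
      fst (J (axis i 1)) \<bullet> fst (J (axis j 1)) + ?R\<^sup>2 * (snd (J (axis i 1)) * snd (J (axis j 1))) + a $ i * a $ j"
      unfolding polar_deriv_inner RD by simp
    also have "fst (J (axis i 1)) \<bullet> fst (J (axis j 1)) + ?R\<^sup>2 * (snd (J (axis i 1)) * snd (J (axis j 1))) = (if i = j then d i * d j else 0)"
      using Jc[of i] Jc[of j] ip[of i j] by (auto simp: inner_prod_def d_def power2_eq_square split: if_splits)
    also have "(if i = j then d i * d j else 0) + a $ i * a $ j = (L (axis i 1), a \<bullet> L (axis i 1)) \<bullet> (L (axis j 1), a \<bullet> L (axis j 1))"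
      unfolding La by (simp add: inner_prod_def inner_axis_axis inner_axis[of a] da)
    finally show "polar_deriv m p (J (axis i 1)) \<bullet> polar_deriv m p (J (axis j 1)) =
        (L (axis i 1), a \<bullet> L (axis i 1)) \<bullet> (L (axis j 1), a \<bullet> L (axis j 1))"
      .
  qed
  also have "\<dots> = \<bar>det (matrix L)\<bar> * gram_jacobian (\<lambda>v. (v, a \<bullet> v))"
    by (rule gram_jacobian_compose[OF _ linL]) (auto intro!: linearI simp: inner_add_right)
  also have "gram_jacobian (\<lambda>v. (v, a \<bullet> v)) = sqrt (1 + a \<bullet> a)" by (rule gram_jacobian_rank_one)
  also have "det (matrix L) = ?R"
  proof -
    have "(0, 1) \<in> J ` Basis" using J(2) by (auto simp: bij_betw_def Basis_prod_def)
    then obtain i0 where i0: "J (axis i0 1) = (0, 1)" by (auto simp: Basis_vec_def)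
    have un: "J (axis i 1) = (0, 1) \<longleftrightarrow> i = i0" for i
      using i0 JJ[of "axis i 1" "axis i0 1"] by (auto simp: inner_axis_axis split: if_splits)
    have "det (matrix L) = (\<Prod>i\<in>UNIV. matrix L $ i $ i)"
      by (rule det_diagonal) (simp add: matrix_def L_def axis_def)
    also have "\<dots> = (\<Prod>i\<in>UNIV. if i = i0 then ?R else 1)"
      by (simp add: matrix_def L_def d_def un)
    finally show ?thesis by simp
  qed
  also have "a \<bullet> a = (norm (fst p))\<^sup>2 / (real m)\<^sup>2 * (1 - (norm (fst p))\<^sup>2) powr (1 / real m - 2)"
  proof -
    have "a \<bullet> a = k\<^sup>2 * (\<Sum>i\<in>UNIV. (fst p \<bullet> fst (J (axis i 1)))\<^sup>2)"
      by (simp add: inner_vec_def a_def power_mult_distrib power2_eq_square sum_distrib_left mult_ac)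
    also have "(\<Sum>i\<in>UNIV. (fst p \<bullet> fst (J (axis i 1)))\<^sup>2) = (\<Sum>b\<in>Basis. ((fst p, 0::real) \<bullet> J b)\<^sup>2)"
    proof -
      have "(Basis :: 'k hparam set) = (\<lambda>i. axis i 1) ` UNIV" by (auto simp: Basis_vec_def)
      then have B: "(\<Sum>b\<in>(Basis :: 'k hparam set). f b) = sum f ((\<lambda>i. axis i 1) ` UNIV)" for f :: "'k hparam \<Rightarrow> real"
        by simp
      have "inj (\<lambda>i. axis i 1 :: 'k hparam)" by (auto simp: inj_def axis_eq_axis)
      then show ?thesis unfolding B by (simp add: sum.reindex inner_prod_def)
    qed
    also have "\<dots> = (\<Sum>b\<in>Basis. ((fst p, 0::real) \<bullet> b)\<^sup>2)"
      by (rule sum.reindex_bij_betw[OF J(2)])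
    also have "\<dots> = (fst p, 0::real) \<bullet> (fst p, 0)"
      by (subst euclidean_inner) (simp add: power2_eq_square)
    also have "\<dots> = (norm (fst p))\<^sup>2" by (simp add: power2_norm_eq_inner)
    also have "k\<^sup>2 = 1 / (real m)\<^sup>2 * (1 - (norm (fst p))\<^sup>2) powr (1 / real m - 2)"
      using one_minus_norm_pos[OF p]
      by (simp add: k_def power_mult_distrib power_divide powr_power)
    finally show ?thesis by simp
  qed
  finally show ?thesis using polar_radius_pos[OF p, of m] by simp
qed

text \<open>The density of the Fefferman measure with respect to \<open>dz dt\<close>.\<close>

definition polar_density :: "nat \<Rightarrow> (complex ^ ('k::finite)) \<times> real \<Rightarrow> real" where
  "polar_density m q = real m powr (2 / (real CARD('k) + 2)) / (2 * real m)
     * (1 - (norm (fst q))\<^sup>2) powr (mu_egg (CARD('k) + 1) m - 1)"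

lemma measurable_polar_density:
  "polar_density m \<in> borel_measurable (borel :: ((complex ^ ('k::finite)) \<times> real) measure)"
proof -
  have [measurable]: "(\<lambda>q::(complex ^ 'k) \<times> real. norm (fst q)) \<in> borel_measurable borel"
    by (intro borel_measurable_continuous_onI continuous_intros)
  show ?thesis unfolding polar_density_def[abs_def] by measurable
qed

text \<open>With \<open>x = 1 - |z|\<^sup>2\<close>, the square root in the Gram determinant also occurs in the length of the
  gradient and cancels; powers of \<open>x\<close> remain, and their exponents add up to \<open>\<mu> - 1\<close>.\<close>

lemma polar_jacobian_eq:
  fixes J :: "('k::finite) hparam \<Rightarrow> (complex ^ 'k) \<times> real"
  assumes m: "m \<ge> 1" and J: "linear J" "bij_betw J Basis Basis" and q: "q \<in> polar_domain"
  shows "gram_jacobian (\<lambda>v. polar_deriv m q (J v)) *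
     (fefferman_M (egg_defining m) (polar_point m q) powr (1 / (real CARD('k) + 2))
        / norm (real_gradient (egg_defining m) (polar_point m q))) = polar_density m q"
proof -
  define x where "x = 1 - (norm (fst q))\<^sup>2"
  have n: "norm (fst q) < 1" using q by (auto simp: polar_domain_def)
  have x: "0 < x" unfolding x_def by (rule one_minus_norm_pos[OF n])
  have m0: "real m > 0" using m by simp
  have R: "cmod (snd (polar_point m q)) = x powr (1 / (2 * real m))"
    using polar_radius_pos[OF n, of m] by (simp add: polar_point_def case_prod_beta norm_mult polar_radius_def x_def)
  have f: "fst (polar_point m q) = fst q" by (simp add: polar_point_def case_prod_beta)
  define Q where "Q = 1 + (norm (fst q))\<^sup>2 / (real m)\<^sup>2 * x powr (1 / real m - 2)"
  have Q: "Q > 0" unfolding Q_def by (intro add_pos_nonneg) auto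
  have Rp: "cmod (snd (polar_point m q)) ^ (2 * j) = x powr (real j / real m)" for j
    unfolding R using x by (simp add: powr_power)
  have M: "fefferman_M (egg_defining m) (polar_point m q) = (real m)\<^sup>2 * x powr ((real m - 1) / real m)"
  proof -
    have "real (m - 1) = real m - 1" using m by (simp add: of_nat_diff)
    moreover have "x powr (real m / real m) = x" using m0 x by simp
    ultimately show ?thesis unfolding fefferman_M_egg[OF m] Rp f by (simp add: x_def)
  qed
  have Mp: "fefferman_M (egg_defining m) (polar_point m q) powr (1 / (real CARD('k) + 2)) =
     real m powr (2 / (real CARD('k) + 2)) * x powr ((real m - 1) / (real m * (real CARD('k) + 2)))"
  proof -
    have m2: "(real m)\<^sup>2 = real m powr 2" using m0 by simp
    show ?thesis unfolding M m2 powr_mult powr_powr by (simp add: divide_simps)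
  qed
  have G: "norm (real_gradient (egg_defining m) (polar_point m q)) = 2 * real m * x powr (1 - 1 / (2 * real m)) * sqrt Q"
  proof -
    have e: "(real (2 * m - 1)) / real m = 2 - 1 / real m" using m by (simp add: of_nat_diff field_simps)
    have xx: "x powr (2 - 1 / real m) * x powr (1 / real m - 2) = 1"
      using x by (simp flip: powr_add)
    have "4 * (norm (fst q))\<^sup>2 + 4 * (real m)\<^sup>2 * x powr (2 - 1 / real m) = (2 * real m)\<^sup>2 * (x powr (2 - 1 / real m) * Q)"
    proof -
      have "(2 * real m)\<^sup>2 * (x powr (2 - 1 / real m) * Q) =
        4 * (real m)\<^sup>2 * x powr (2 - 1 / real m) + 4 * (norm (fst q))\<^sup>2 * (x powr (2 - 1 / real m) * x powr (1 / real m - 2))"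
        unfolding Q_def using m0 by (simp add: field_simps power2_eq_square)
      then show ?thesis unfolding xx by simp
    qed
    also have "\<dots> = (2 * real m)\<^sup>2 * ((x powr (1 - 1 / (2 * real m)))\<^sup>2 * Q)"
      using x by (simp add: powr_power field_simps)
    finally show ?thesis
      unfolding norm_real_gradient_egg[OF m] Rp f e
      using m0 by (simp add: real_sqrt_mult)
  qed
  have "gram_jacobian (\<lambda>v. polar_deriv m q (J v)) = x powr (1 / (2 * real m)) * sqrt Q"
    unfolding gram_jacobian_polar[OF J n] Q_def by (simp add: polar_radius_def x_def)
  then have "gram_jacobian (\<lambda>v. polar_deriv m q (J v)) *
     (fefferman_M (egg_defining m) (polar_point m q) powr (1 / (real CARD('k) + 2))
        / norm (real_gradient (egg_defining m) (polar_point m q))) =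
     real m powr (2 / (real CARD('k) + 2)) / (2 * real m) *
      (x powr (1 / (2 * real m)) * x powr ((real m - 1) / (real m * (real CARD('k) + 2))) / x powr (1 - 1 / (2 * real m)))"
    unfolding Mp G using Q m0 x by (simp add: field_simps)
  also have "x powr (1 / (2 * real m)) * x powr ((real m - 1) / (real m * (real CARD('k) + 2))) / x powr (1 - 1 / (2 * real m))
     = x powr (1 / (2 * real m) + (real m - 1) / (real m * (real CARD('k) + 2)) - (1 - 1 / (2 * real m)))"
    using x by (simp only: powr_add powr_diff)
  also have "1 / (2 * real m) + (real m - 1) / (real m * (real CARD('k) + 2)) - (1 - 1 / (2 * real m)) = mu_egg (CARD('k) + 1) m - 1"
    using m0 by (simp add: mu_egg_def divide_simps) (simp add: algebra_simps)
  finally show ?thesis by (simp add: polar_density_def x_def)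
qed

text \<open>The surface measure is the image of its polar density, since the polar patch covers the boundary
  up to the null set \<open>Im w = 0\<close>.\<close>

theorem nn_integral_fefferman_measure:
  fixes h :: "('k::finite) cpoint \<Rightarrow> ennreal"
  assumes m: "m \<ge> 1" and h: "h \<in> borel_measurable borel"
  shows "(\<integral>\<^sup>+p. h p \<partial>fefferman_measure m) =
     (\<integral>\<^sup>+q. indicator polar_domain q * (ennreal (polar_density m q) * h (polar_point m q)) \<partial>lborel)"
proof -
  let ?S = "frontier (egg m) :: 'k cpoint set"
  define \<sigma> where "\<sigma> = surface_measure ?S"
  have \<sigma>: "is_surface_measure ?S \<sigma>" unfolding \<sigma>_def by (rule is_surface_measure_egg[OF m])
  have s\<sigma>: "sets \<sigma> = sets (restrict_space borel ?S)" using \<sigma> by (simp add: is_surface_measure_def)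
  have sr: "sets \<sigma> = {B \<in> sets borel. B \<subseteq> ?S}"
    unfolding s\<sigma> by (subst sets_restrict_space) auto
  have card: "card (Basis :: ((complex ^ 'k) \<times> real) set) = DIM('k hparam)" by simp
  obtain J :: "'k hparam \<Rightarrow> (complex ^ 'k) \<times> real" where J: "linear J" "bij_betw J Basis Basis"
    using exists_basis_map[OF finite_Basis card] by blast
  have blJ: "bounded_linear J" using J(1) by (simp add: linear_conv_bounded_linear)
  have JJ: "J x \<bullet> J y = x \<bullet> y" for x y
    using basis_map_inner[OF J(1)] J(2) by (auto simp: bij_betw_def)
  define U where "U = J -` polar_domain"
  define \<phi> where "\<phi> u = polar_point m (J u)" for u
  define D where "D u v = polar_deriv m (J u) (J v)" for u v
  have p: "regular_patch ?S U \<phi> D"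
    unfolding U_def \<phi>_def[abs_def] D_def[abs_def] by (rule polar_regular_patch[OF m J])
  have oU: "open U" and D: "\<And>v. continuous_on U (\<lambda>u. D u v)" using p by (auto simp: regular_patch_def)
  let ?N = "{p \<in> ?S. Im (snd p) = 0}"
  have Nb: "?N \<in> sets borel"
    by (intro borel_closed closed_Collect_conj closed_Collect_eq continuous_intros) simp
  have N: "?N \<in> null_sets \<sigma>"
    using emeasure_surface_real_w[OF m \<sigma>] Nb unfolding null_sets_def sr by auto
  have "0 \<in> polar_domain" by (simp add: polar_domain_def zero_prod_def)
  then have "polar_point m 0 \<in> ?S" using polar_point_image(1)[OF m] by blast
  then obtain p0 where p0: "p0 \<in> ?S" by blast
  \<comment> \<open>Outside the parameter domain \<open>f\<close> takes a boundary point as value, so that it maps into the space of \<open>\<sigma>\<close>.\<close>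
  define f where "f u = (if u \<in> U then \<phi> u - p0 else 0) + p0" for u
  have fU: "f u = \<phi> u" if "u \<in> U" for u using that by (simp add: f_def)
  have fb[measurable]: "f \<in> borel_measurable borel"
    unfolding f_def[abs_def] using oU
    by (intro borel_measurable_add borel_measurable_const borel_measurable_if_continuous_on
        continuous_on_diff continuous_on_const regular_patch_continuous_on[OF p]) auto
  have fm: "f \<in> measurable borel \<sigma>"
    unfolding measurable_cong_sets[OF refl s\<sigma>]
  proof (rule measurable_restrict_space2)
    show "f \<in> space borel \<rightarrow> ?S"
      using p p0 by (auto simp: f_def regular_patch_def image_subset_iff)
  qed (rule fb)
  define c where "c u = (if u \<in> U then gram_jacobian (D u) else 0)" for u
  have [measurable]: "c \<in> borel_measurable borel" unfolding c_def[abs_def]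
    using oU D by (intro borel_measurable_if_continuous_on continuous_on_gram_jacobian) auto
  have "(0, 1) \<in> J ` Basis" using J(2) by (auto simp: bij_betw_def Basis_prod_def)
  then obtain e where e: "e \<in> Basis" "J e = (0, 1)" by auto
  have ae: "AE u in lborel. snd (J u) \<noteq> 0"
  proof -
    have "u \<bullet> e = snd (J u)" for u using JJ[of u e] by (simp add: e(2) inner_prod_def)
    then show ?thesis using AE_not_in[OF hyperplane_null[OF e(1)]] by simp
  qed
  have area: "\<sigma> = distr (density lborel (\<lambda>u. ennreal (c u))) \<sigma> f"
  proof (rule measure_eqI)
    fix B assume B: "B \<in> sets \<sigma>"
    then have Bb[measurable]: "B \<in> sets borel" and BS: "B \<subseteq> ?S" unfolding sr by auto
    have BN: "B - ?N \<in> sets \<sigma>" unfolding sr using Bb BS Nb by auto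
    have "B - ?N \<subseteq> \<phi> ` U"
    proof
      fix p assume "p \<in> B - ?N"
      then have "p \<in> {p \<in> ?S. Im (snd p) \<noteq> 0}" using BS by auto
      then obtain q where q: "q \<in> polar_domain" "p = polar_point m q"
        using polar_point_image(2)[OF m] by blast
      have "J (\<Sum>b\<in>Basis. (q \<bullet> J b) *\<^sub>R b) = (\<Sum>b\<in>Basis. (q \<bullet> J b) *\<^sub>R J b)"
        by (simp add: linear_sum[OF J(1)] linear_scale[OF J(1)])
      also have "\<dots> = (\<Sum>b\<in>Basis. (q \<bullet> b) *\<^sub>R b)"
        by (rule sum.reindex_bij_betw[OF J(2)])
      also have "\<dots> = q" by (rule euclidean_representation)
      finally obtain u where "J u = q" by blast
      then show "p \<in> \<phi> ` U" using q by (auto simp: \<phi>_def U_def)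
    qed
    have "emeasure \<sigma> B = emeasure \<sigma> (B - ?N)"
      using emeasure_Diff_null_set[OF N B] by simp
    also have "\<dots> = (\<integral>\<^sup>+u. indicator U u * indicator (B - ?N) (\<phi> u) * ennreal (gram_jacobian (D u)) \<partial>lborel)"
      by (rule \<sigma>[unfolded is_surface_measure_def, THEN conjunct2, rule_format, OF p BN]) fact
    also have "\<dots> = (\<integral>\<^sup>+u. ennreal (c u) * indicator (f -` B) u \<partial>lborel)"
    proof (rule nn_integral_cong_AE)
      show "AE u in lborel. indicator U u * indicator (B - ?N) (\<phi> u) * ennreal (gram_jacobian (D u)) = ennreal (c u) * indicator (f -` B) u"
        using ae
      proof eventually_elim
        case (elim u)
        show ?case
        proof (cases "u \<in> U")
          case True
          then have d: "J u \<in> polar_domain" by (simp add: U_def)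
          then have n: "norm (fst (J u)) < 1" and t: "- pi < snd (J u)" "snd (J u) < pi" by (auto simp: polar_domain_def)
          have "sin (snd (J u)) \<noteq> 0" using sin_eq_0_pi[OF t] elim by auto
          then have "Im (snd (\<phi> u)) \<noteq> 0"
            using polar_radius_pos[OF n, of m] by (simp add: \<phi>_def polar_point_def case_prod_beta)
          then show ?thesis using True by (auto simp: c_def fU split: split_indicator)
        qed (simp add: c_def)
      qed
    qed
    also have "\<dots> = emeasure (distr (density lborel (\<lambda>u. ennreal (c u))) \<sigma> f) B"
    proof -
      have "f -` B \<in> sets borel" using measurable_sets[OF fb Bb] by simp
      then show ?thesis using fm B by (subst emeasure_distr) (auto simp: emeasure_density)
    qed
    finally show "emeasure \<sigma> B = emeasure (distr (density lborel (\<lambda>u. ennreal (c u))) \<sigma> f) B" .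
  qed simp
  define w where "w p = ennreal (fefferman_M (egg_defining m) p powr (1 / (real CARD('k) + 2))
                     / norm (real_gradient (egg_defining m) p))" for p :: "'k cpoint"
  have wb[measurable]: "w \<in> borel_measurable borel"
  proof -
    have [measurable]: "(\<lambda>p::'k cpoint. norm (fst p)) \<in> borel_measurable borel" "(\<lambda>p::'k cpoint. norm (snd p)) \<in> borel_measurable borel"
      by (intro borel_measurable_continuous_onI continuous_intros)+
    show ?thesis unfolding w_def[abs_def] fefferman_M_egg[OF m] norm_real_gradient_egg[OF m] by measurable
  qed
  have tr: "g \<in> borel_measurable \<sigma>" if "g \<in> borel_measurable borel" for g :: "'k cpoint \<Rightarrow> ennreal"
    using measurable_restrict_space1[OF that, of ?S] measurable_cong_sets[OF s\<sigma> refl] by blast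
  have "(\<integral>\<^sup>+p. h p \<partial>fefferman_measure m) = (\<integral>\<^sup>+p. w p * h p \<partial>\<sigma>)"
    unfolding fefferman_measure_def \<sigma>_def[symmetric] w_def[symmetric]
    by (rule nn_integral_density[OF tr[OF wb] tr[OF h]])
  also have "\<dots> = (\<integral>\<^sup>+p. w p * h p \<partial>distr (density lborel (\<lambda>u. ennreal (c u))) \<sigma> f)"
    using area by simp
  also have "\<dots> = (\<integral>\<^sup>+u. w (f u) * h (f u) \<partial>density lborel (\<lambda>u. ennreal (c u)))"
    using fm tr[OF borel_measurable_times_ennreal[OF wb h]] by (subst nn_integral_distr) auto
  also have "\<dots> = (\<integral>\<^sup>+u. ennreal (c u) * (w (f u) * h (f u)) \<partial>lborel)"
    using h by (subst nn_integral_density) auto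
  also have "\<dots> = (\<integral>\<^sup>+u. indicator polar_domain (J u) * (ennreal (polar_density m (J u)) * h (polar_point m (J u))) \<partial>lborel)"
  proof (intro nn_integral_cong)
    fix u
    show "ennreal (c u) * (w (f u) * h (f u)) = indicator polar_domain (J u) * (ennreal (polar_density m (J u)) * h (polar_point m (J u)))"
    proof (cases "u \<in> U")
      case True
      then have d: "J u \<in> polar_domain" by (simp add: U_def)
      have "ennreal (c u) * w (f u) = ennreal (polar_density m (J u))"
        using True polar_jacobian_eq[OF m J d]
        by (simp add: c_def w_def fU \<phi>_def D_def[abs_def] flip: ennreal_mult'')
      then show ?thesis using d True by (simp add: fU \<phi>_def flip: mult.assoc)
    qed (simp add: c_def U_def)
  qed
  also have "\<dots> = (\<integral>\<^sup>+q. indicator polar_domain q * (ennreal (polar_density m q) * h (polar_point m q)) \<partial>lborel)"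
  proof (rule nn_integral_lborel_basis_map[OF J])
    define g where "g q = (if q \<in> polar_domain then polar_point m q else 0)" for q :: "(complex ^ 'k) \<times> real"
    have gb[measurable]: "g \<in> borel_measurable borel"
      unfolding g_def[abs_def]
      by (intro borel_measurable_if_continuous_on continuous_at_imp_continuous_on ballI borel_open open_polar_domain)
         (rule has_derivative_continuous[OF polar_point_has_derivative[OF _ m]])
    have [measurable]: "polar_domain \<in> sets (borel :: ((complex ^ 'k) \<times> real) measure)"
      by (rule borel_open[OF open_polar_domain])
    note [measurable] = measurable_polar_density[where 'k = 'k]
    note [measurable] = h
    have "(\<lambda>q. indicator polar_domain q * (ennreal (polar_density m q) * h (g q))) \<in> borel_measurable borel"
      by measurable
    also have "(\<lambda>q. indicator polar_domain q * (ennreal (polar_density m q) * h (g q))) =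
       (\<lambda>q. indicator polar_domain q * (ennreal (polar_density m q) * h (polar_point m q)))"
      by (auto simp: fun_eq_iff g_def split: split_indicator)
    finally show "(\<lambda>q. indicator polar_domain q * (ennreal (polar_density m q) * h (polar_point m q))) \<in> borel_measurable borel" .
  qed
  finally show ?thesis .
qed

section \<open>Circle means and Taylor coefficients\<close>

text \<open>The normalized angular measure of the circle, as a probability measure on angles.\<close>

definition circ :: "real measure" where
  "circ = density lborel (\<lambda>t. indicator {-pi..pi} t * ennreal (1 / (2 * pi)))"

lemma sets_circ[simp, measurable_cong]: "sets circ = sets borel" and space_circ[simp]: "space circ = UNIV"
  by (simp_all add: circ_def)

lemma emeasure_circ_UNIV: "emeasure circ UNIV = 1"
proof -
  have "emeasure circ UNIV = (\<integral>\<^sup>+t. indicator {-pi..pi} t * ennreal (1 / (2 * pi)) \<partial>lborel)"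
    by (simp add: circ_def emeasure_density)
  also have "\<dots> = ennreal (2 * pi) * ennreal (1 / (2 * pi))"
    by (subst nn_integral_multc) auto
  also have "\<dots> = 1" by (simp flip: ennreal_mult)
  finally show ?thesis .
qed

lemma finite_measure_circ: "finite_measure circ"
  by (rule finite_measureI) (simp add: emeasure_circ_UNIV)

lemma sigma_finite_circ: "sigma_finite_measure circ"
  using finite_measure_circ by (rule finite_measure.axioms(1))

lemma integral_circ_const[simp]: "(\<integral>t. (c::complex) \<partial>circ) = c"
  by (simp add: measure_def emeasure_circ_UNIV)

lemma circ_integral:
  fixes g :: "real \<Rightarrow> complex"
  assumes g: "continuous_on UNIV g"
  shows "integrable circ g" "(\<integral>t. g t \<partial>circ) = integral {-pi..pi} g / (2 * pi)"
proof -
  have gb: "g \<in> borel_measurable borel" using g by (rule borel_measurable_continuous_onI)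
  have int: "set_integrable lborel {-pi..pi} g"
    by (rule borel_integrable_atLeastAtMost') (rule continuous_on_subset[OF g], simp)
  have circ: "circ = density lborel (\<lambda>t. ennreal (indicator {-pi..pi} t / (2 * pi)))"
    unfolding circ_def by (intro density_cong) (auto split: split_indicator)
  have e: "(indicator {-pi..pi} t / (2 * pi)) *\<^sub>R g t = (1 / (2 * pi)) *\<^sub>R (indicator {-pi..pi} t *\<^sub>R g t)" for t
    by simp
  show "integrable circ g"
    unfolding circ using gb int unfolding set_integrable_def
    by (subst integrable_density) (auto simp: e simp del: scaleR_scaleR)
  have "(\<integral>t. g t \<partial>circ) = (\<integral>t. (indicator {-pi..pi} t / (2 * pi)) *\<^sub>R g t \<partial>lborel)"
    unfolding circ using gb by (subst integral_density) auto
  also have "\<dots> = (1 / (2 * pi)) *\<^sub>R (LINT t:{-pi..pi}|lborel. g t)"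
    unfolding e set_lebesgue_integral_def by (rule integral_scaleR_right)
  also have "(LINT t:{-pi..pi}|lborel. g t) = integral {-pi..pi} g"
    by (rule set_borel_integral_eq_integral(2)[OF int])
  finally show "(\<integral>t. g t \<partial>circ) = integral {-pi..pi} g / (2 * pi)"
    by (simp add: scaleR_conv_of_real)
qed

lemma integral_circ_cis: "(\<integral>t. cis (of_int i * t) \<partial>circ) = (if i = 0 then 1 else 0)"
proof (cases "i = 0")
  case False
  have c: "continuous_on UNIV (\<lambda>t. cis (of_int i * t))"
    by (intro continuous_intros)
  have "((\<lambda>t. cis (of_int i * t)) has_integral (cis (of_int i * pi) / (\<i> * of_int i) - cis (of_int i * (-pi)) / (\<i> * of_int i))) {-pi..pi}"
  proof (rule fundamental_theorem_of_calculus)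
    fix t :: real
    show "((\<lambda>t. cis (of_int i * t) / (\<i> * of_int i)) has_vector_derivative cis (of_int i * t)) (at t within {-pi..pi})"
      unfolding cis_conv_exp
      using False by (auto intro!: derivative_eq_intros has_vector_derivative_real_field) (subst mult.commute[of _ \<i>], simp)
  qed simp
  moreover have "cis (of_int i * pi) = cis (of_int i * (-pi))"
    by (simp add: complex_eq_iff sin_times_pi_eq_0)
  ultimately have "integral {-pi..pi} (\<lambda>t. cis (of_int i * t)) = 0"
    by (simp add: integral_unique)
  then show ?thesis using False circ_integral(2)[OF c] by simp
qed (simp add: measure_def emeasure_circ_UNIV)

definition taylor_coeff :: "(complex \<Rightarrow> complex) \<Rightarrow> nat \<Rightarrow> complex" where
  "taylor_coeff f j = (deriv ^^ j) f 0 / fact j"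

lemma taylor_coeff_sums:
  assumes "f holomorphic_on ball 0 R" "cmod w < R"
  shows "(\<lambda>n. taylor_coeff f n * w ^ n) sums f w"
  using holomorphic_power_series[of f 0 R w] assms by (simp add: taylor_coeff_def)

text \<open>On the circle of radius \<open>r\<close> the Taylor series of \<open>f\<close> converges uniformly, and the exponentials are
  orthonormal.\<close>

lemma circ_mean_taylor_coeff:
  assumes f: "f holomorphic_on ball 0 R" and r: "0 \<le> r" "r < R"
  shows "(\<integral>t. f (of_real r * cis t) * cis (- (real j * t)) \<partial>circ) = taylor_coeff f j * of_real r ^ j"
proof -
  define u where "u n t = taylor_coeff f n * of_real r ^ n * cis (of_int (int n - int j) * t)" for n t
  have ut: "u n t = taylor_coeff f n * (of_real r * cis t) ^ n * cis (- (real j * t))" for n t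
  proof -
    have "cis (of_int (int n - int j) * t) = cis (real n * t + - (real j * t))"
      by (simp add: algebra_simps)
    also have "\<dots> = cis t ^ n * cis (- (real j * t))"
      by (metis Complex.DeMoivre cis_mult)
    finally have "cis (of_int (int n - int j) * t) = cis t ^ n * cis (- (real j * t))" .
    then show ?thesis by (simp add: u_def power_mult_distrib)
  qed
  have us: "(\<lambda>n. u n t) sums (f (of_real r * cis t) * cis (- (real j * t)))" for t
    unfolding ut using r by (intro sums_mult2 taylor_coeff_sums[OF f]) (simp add: norm_mult)
  define r' where "r' = (r + R) / 2"
  have r': "r < r'" "r' < R" using r by (auto simp: r'_def)
  have sm: "summable (\<lambda>n. cmod (taylor_coeff f n) * r ^ n)"
  proof -
    have "summable (\<lambda>n. taylor_coeff f n * of_real r' ^ n)"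
      using taylor_coeff_sums[OF f, of "of_real r'"] r r' by (auto intro: sums_summable)
    then have "summable (\<lambda>n. norm (taylor_coeff f n * (of_real r) ^ n))"
      by (rule powser_insidea) (use r r' in auto)
    then show ?thesis using r by (simp add: norm_mult norm_power)
  qed
  have nu: "norm (u n t) = cmod (taylor_coeff f n) * r ^ n" for n t
    using r by (simp add: u_def norm_mult norm_power)
  have cu: "continuous_on UNIV (u n)" for n unfolding u_def[abs_def] by (intro continuous_intros)
  have "(\<lambda>n. \<integral>t. u n t \<partial>circ) sums (\<integral>t. (\<Sum>n. u n t) \<partial>circ)"
  proof (rule sums_integral)
    show "integrable circ (u n)" for n by (rule circ_integral(1)[OF cu])
    show "AE t in circ. summable (\<lambda>n. norm (u n t))" using sm by (simp add: nu)
    show "summable (\<lambda>n. \<integral>t. norm (u n t) \<partial>circ)" using sm by (simp add: nu measure_def emeasure_circ_UNIV)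
  qed
  also have "(\<lambda>n. \<integral>t. u n t \<partial>circ) = (\<lambda>n. if n = j then taylor_coeff f j * of_real r ^ j else 0)"
    unfolding u_def by (auto simp: fun_eq_iff integral_circ_cis simp del: of_int_diff)
  finally have "(\<lambda>n. if n = j then taylor_coeff f j * of_real r ^ j else 0) sums (\<integral>t. (\<Sum>n. u n t) \<partial>circ)" .
  moreover have "(\<lambda>n. if n = j then taylor_coeff f j * of_real r ^ j else 0) sums (taylor_coeff f j * of_real r ^ j)"
    using sums_single[of j "\<lambda>_. taylor_coeff f j * of_real r ^ j"] by simp
  ultimately have "(\<integral>t. (\<Sum>n. u n t) \<partial>circ) = taylor_coeff f j * of_real r ^ j"
    by (rule sums_unique2)
  then show ?thesis using us by (simp add: sums_iff)
qed

lemma circ_mean_value: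
  assumes "f holomorphic_on ball 0 R" "1 < R"
  shows "(\<integral>t. f (cis t) \<partial>circ) = f 0"
  using circ_mean_taylor_coeff[OF assms(1), of 1 0] assms(2) by (simp add: taylor_coeff_def)

lemma continuous_on_circ_mean:
  fixes F :: "'a::topological_space \<Rightarrow> real \<Rightarrow> complex"
  assumes F: "continuous_on (Z \<times> UNIV) (\<lambda>(z, t). F z t)"
  shows "continuous_on Z (\<lambda>z. \<integral>t. F z t \<partial>circ)"
proof -
  have "continuous_on UNIV (F z)" if "z \<in> Z" for z
  proof -
    have "continuous_on UNIV (\<lambda>t::real. (z, t))" by (intro continuous_intros)
    from continuous_on_compose2[OF F this] show ?thesis using that by auto
  qed
  then have e: "(\<integral>t. F z t \<partial>circ) = integral (cbox (-pi) pi) (F z) / (2 * pi)" if "z \<in> Z" for z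
    using circ_integral(2) that by simp
  have "continuous_on (Z \<times> cbox (-pi) pi) (\<lambda>(z, t). F z t)"
    by (rule continuous_on_subset[OF F]) auto
  then have "continuous_on Z (\<lambda>z. integral (cbox (-pi) pi) (F z))"
    by (rule integral_continuous_on_param)
  then have "continuous_on Z (\<lambda>z. integral (cbox (-pi) pi) (F z) / (2 * pi))"
    by (intro continuous_intros) auto
  then show ?thesis using e by (simp cong: continuous_on_cong)
qed

text \<open>By Cauchy's formula the derivative of \<open>h\<close> in the complex parameter is itself a circle mean over a
  small circle, hence jointly continuous. This allows differentiation under the integral sign.\<close>

lemma holomorphic_on_circ_mean:
  fixes h :: "complex \<Rightarrow> real \<Rightarrow> complex"
  assumes V: "open V" and c: "continuous_on (V \<times> UNIV) (\<lambda>(l, t). h l t)"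
    and hol: "\<And>t. (\<lambda>l. h l t) holomorphic_on V"
  shows "(\<lambda>l. \<integral>t. h l t \<partial>circ) holomorphic_on V"
  unfolding holomorphic_on_def
proof
  fix l0 assume l0: "l0 \<in> V"
  obtain e where e: "e > 0" "ball l0 e \<subseteq> V" using V l0 by (meson openE)
  define \<rho> where "\<rho> = e / 3"
  have \<rho>: "\<rho> > 0" "e = 3 * \<rho>" using e by (auto simp: \<rho>_def)
  let ?U = "ball l0 \<rho>"
  have sh: "l + x \<in> V" if "l \<in> ?U" "cmod x < 2 * \<rho>" for l x
  proof -
    have "dist l0 (l + x) \<le> dist l0 l + cmod x"
      by (metis add_diff_cancel_left' dist_commute dist_norm dist_triangle)
    then have "dist l0 (l + x) < e" using that \<rho> by simp
    then show ?thesis using e by auto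
  qed
  have dl: "deriv (\<lambda>l. h l t) l = (\<integral>s. h (l + of_real \<rho> * cis s) t * cis (- s) \<partial>circ) / of_real \<rho>" if l: "l \<in> ?U" for l t
  proof -
    have hs: "(\<lambda>x. h (l + x) t) holomorphic_on ball 0 (2 * \<rho>)"
    proof -
      have "(\<lambda>x. l + x) holomorphic_on ball 0 (2 * \<rho>)" by (intro holomorphic_intros)
      moreover have "(\<lambda>x. l + x) ` ball 0 (2 * \<rho>) \<subseteq> V"
        by (intro image_subsetI, rule sh[OF l]) simp
      ultimately show ?thesis
        using holomorphic_on_compose_gen[OF _ hol[of t]] by (simp add: o_def)
    qed
    have "(\<integral>s. h (l + of_real \<rho> * cis s) t * cis (- s) \<partial>circ) = taylor_coeff (\<lambda>x. h (l + x) t) 1 * of_real \<rho>"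
      using circ_mean_taylor_coeff[OF hs, of \<rho> 1] \<rho> by simp
    moreover have "taylor_coeff (\<lambda>x. h (l + x) t) 1 = deriv (\<lambda>l. h l t) l"
    proof -
      have "(\<lambda>l. h l t) field_differentiable at l"
        using hol[of t] V sh[OF l, of 0] \<rho> by (auto intro: holomorphic_on_imp_differentiable_at)
      then have "((\<lambda>l. h l t) has_field_derivative deriv (\<lambda>l. h l t) l) (at (l + 0))"
        by (simp add: field_differentiable_derivI)
      then have "((\<lambda>x. h (l + x) t) has_field_derivative deriv (\<lambda>l. h l t) l) (at 0)"
      proof -
        assume *: "((\<lambda>l. h l t) has_field_derivative deriv (\<lambda>l. h l t) l) (at (l + 0))"
        have "((\<lambda>x. l + x) has_field_derivative 1) (at 0)" by (auto intro!: derivative_eq_intros)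
        from DERIV_chain2[where g = "\<lambda>x. l + x" and x = 0, OF * this] show ?thesis by simp
      qed
      then show ?thesis by (simp add: taylor_coeff_def DERIV_imp_deriv)
    qed
    ultimately show ?thesis using \<rho> by simp
  qed
  have cd: "continuous_on (?U \<times> UNIV) (\<lambda>(l, t). deriv (\<lambda>l. h l t) l)"
  proof -
    have "continuous_on ((?U \<times> UNIV) \<times> UNIV) (\<lambda>(p, s). h (fst p + of_real \<rho> * cis s) (snd p) * cis (- s))"
    proof -
      have "continuous_on ((?U \<times> UNIV) \<times> UNIV) (\<lambda>q. (fst (fst q) + of_real \<rho> * cis (snd q), snd (fst q)))"
        by (intro continuous_intros)
      then have "continuous_on ((?U \<times> UNIV) \<times> UNIV) (\<lambda>q. (\<lambda>(l, t). h l t) (fst (fst q) + of_real \<rho> * cis (snd q), snd (fst q)))"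
        by (rule continuous_on_compose2[OF c]) (use sh \<rho> in \<open>auto simp: norm_mult\<close>)
      then show ?thesis
        by (auto simp: case_prod_beta intro!: continuous_intros)
    qed
    then have "continuous_on (?U \<times> UNIV) (\<lambda>p. \<integral>s. h (fst p + of_real \<rho> * cis s) (snd p) * cis (- s) \<partial>circ)"
      by (rule continuous_on_circ_mean)
    then have "continuous_on (?U \<times> UNIV) (\<lambda>p. (\<integral>s. h (fst p + of_real \<rho> * cis s) (snd p) * cis (- s) \<partial>circ) / of_real \<rho>)"
      using \<rho> by (intro continuous_intros) auto
    then show ?thesis
      by (rule continuous_on_eq) (auto simp: dl)
  qed
  have UV: "?U \<subseteq> V" using sh[of _ 0] \<rho> by auto
  have ct: "continuous_on UNIV (h l)" if "l \<in> V" for l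
  proof -
    have "continuous_on UNIV (\<lambda>t::real. (l, t))" by (intro continuous_intros)
    from continuous_on_compose2[OF c this] show ?thesis using that by auto
  qed
  have "(\<lambda>l. integral (cbox (-pi) pi) (h l)) holomorphic_on ?U"
  proof (rule leibniz_rule_holomorphic)
    show "((\<lambda>x. h x t) has_field_derivative deriv (\<lambda>l. h l t) x) (at x within ?U)" if "x \<in> ?U" for x t
      using hol[of t] V that UV
      by (metis field_differentiable_derivI has_field_derivative_at_within holomorphic_on_imp_differentiable_at subsetD)
    show "h x integrable_on cbox (-pi) pi" if "x \<in> ?U" for x
      using UV that by (intro integrable_continuous continuous_on_subset[OF ct]) auto
    show "continuous_on (?U \<times> cbox (-pi) pi) (\<lambda>(l, t). deriv (\<lambda>l. h l t) l)"
      by (rule continuous_on_subset[OF cd]) auto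
  qed simp
  then have "(\<lambda>l. integral (cbox (-pi) pi) (h l) / (2 * pi)) holomorphic_on ?U"
    by (intro holomorphic_intros) auto
  then have "(\<lambda>l. \<integral>t. h l t \<partial>circ) holomorphic_on ?U"
    by (rule holomorphic_transform) (use ct UV circ_integral(2) in auto)
  then have "(\<lambda>l. \<integral>t. h l t \<partial>circ) field_differentiable at l0"
    using \<rho> by (auto intro: holomorphic_on_imp_differentiable_at)
  then show "(\<lambda>l. \<integral>t. h l t \<partial>circ) field_differentiable at l0 within V"
    by (rule field_differentiable_at_within)
qed

section \<open>Gaussian and ball integrals of homogeneous functions\<close>

lemma nn_integral_lborel_scaleR:
  fixes f :: "'a::euclidean_space \<Rightarrow> ennreal"
  assumes f[measurable]: "f \<in> borel_measurable borel" and c: "c > 0"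
  shows "(\<integral>\<^sup>+x. f x \<partial>lborel) = ennreal (c ^ DIM('a)) * (\<integral>\<^sup>+x. f (c *\<^sub>R x) \<partial>lborel)"
proof -
  have "(\<integral>\<^sup>+x. f x \<partial>lborel) = (\<integral>\<^sup>+x. f x \<partial>density (distr lborel borel (\<lambda>x. 0 + c *\<^sub>R x)) (\<lambda>_. ennreal (\<bar>c\<bar> ^ DIM('a))))"
    using c lborel_affine[of c "0::'a"] by simp
  also have "\<dots> = (\<integral>\<^sup>+x. ennreal (c ^ DIM('a)) * f (c *\<^sub>R x) \<partial>lborel)"
    using c by (subst nn_integral_density) (auto simp: nn_integral_distr)
  also have "\<dots> = ennreal (c ^ DIM('a)) * (\<integral>\<^sup>+x. f (c *\<^sub>R x) \<partial>lborel)"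
    by (rule nn_integral_cmult) auto
  finally show ?thesis .
qed

lemma nn_integral_Gamma:
  assumes "a > (0::real)"
  shows "(\<integral>\<^sup>+t. indicator {0<..} t * ennreal (t powr (a - 1) * exp (- t)) \<partial>lborel) = ennreal (Gamma a)"
proof -
  have "((\<lambda>t. t powr (a - 1) / exp t) has_integral Gamma a) {0..}"
    using Gamma_integral_real[OF assms] .
  then have "((\<lambda>t. if t \<in> {0<..} then t powr (a - 1) * exp (- t) else 0) has_integral Gamma a) UNIV"
  proof -
    assume "((\<lambda>t. t powr (a - 1) / exp t) has_integral Gamma a) {0..}"
    then have "((\<lambda>t. if t \<in> {0..} then t powr (a - 1) / exp t else 0) has_integral Gamma a) UNIV"
      by (simp only: has_integral_restrict_UNIV)
    then show ?thesis
      by (rule has_integral_spike[of "{0}", rotated 2]) (auto simp: exp_minus divide_inverse)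
  qed
  then have "(\<integral>\<^sup>+t. ennreal (if t \<in> {0<..} then t powr (a - 1) * exp (- t) else 0) \<partial>lborel) = ennreal (Gamma a)"
    by (intro nn_integral_has_integral_lborel) auto
  moreover have "(\<integral>\<^sup>+t. ennreal (if t \<in> {0<..} then t powr (a - 1) * exp (- t) else 0) \<partial>lborel)
     = (\<integral>\<^sup>+t. indicator {0<..} t * ennreal (t powr (a - 1) * exp (- t)) \<partial>lborel)"
    by (intro nn_integral_cong) (auto split: split_indicator)
  ultimately show ?thesis by simp
qed

text \<open>Integrate \<open>h(z) (T - |z|\<^sup>2)\<^bsup>s\<^esup> e\<^bsup>-T\<^esup>\<close> over all \<open>z\<close> and \<open>T\<close> with \<open>|z|\<^sup>2 < T\<close>. The integral over \<open>T\<close> is a Gamma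
  function times the Gaussian. The integral over \<open>z\<close>, by homogeneity, is a power of \<open>T\<close> times the
  integral over the unit ball, and then the integral over \<open>T\<close> is again a Gamma function. Thus
  weighted integrals over the ball are traded for Gaussian ones without polar coordinates.\<close>

theorem nn_integral_homogeneous_ball_gaussian:
  fixes h :: "'a::euclidean_space \<Rightarrow> ennreal"
  assumes h[measurable]: "h \<in> borel_measurable borel"
    and hom: "\<And>r z. r > 0 \<Longrightarrow> h (r *\<^sub>R z) = ennreal (r powr (2 * d)) * h z"
    and s: "s > -1" and d: "d \<ge> 0"
  shows "ennreal (Gamma (s + 1)) * (\<integral>\<^sup>+z. h z * ennreal (exp (- (norm z)\<^sup>2)) \<partial>lborel) =
    ennreal (Gamma (d + real DIM('a) / 2 + s + 1)) *
      (\<integral>\<^sup>+z. indicator (ball 0 1) z * (h z * ennreal ((1 - (norm z)\<^sup>2) powr s)) \<partial>lborel)"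
    (is "?G * ?L = ?G' * ?I")
proof -
  have [measurable]: "ball (0::'a) 1 \<in> sets borel" by simp
  let ?k = "real DIM('a) / 2"
  let ?F = "\<lambda>z T. indicator {t. (norm z)\<^sup>2 < t} T * (h z * ennreal ((T - (norm z)\<^sup>2) powr s * exp (- T)))"
  have inner: "(\<integral>\<^sup>+T. ?F z T \<partial>lborel) = ?G * (h z * ennreal (exp (- (norm z)\<^sup>2)))" for z
  proof -
    have "(\<integral>\<^sup>+T. ?F z T \<partial>lborel) = (\<integral>\<^sup>+t. ?F z ((norm z)\<^sup>2 + t) \<partial>lborel)"
      using nn_integral_real_affine[of "?F z" 1 "(norm z)\<^sup>2"] by simp
    also have "\<dots> = (\<integral>\<^sup>+t. (h z * ennreal (exp (- (norm z)\<^sup>2))) * (indicator {0<..} t * ennreal (t powr (s + 1 - 1) * exp (- t))) \<partial>lborel)"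
    proof (intro nn_integral_cong)
      fix t :: real
      have "t powr s * exp (- ((norm z)\<^sup>2 + t)) = exp (- (norm z)\<^sup>2) * (t powr s * exp (- t))"
        by (simp add: exp_add[symmetric])
      then have "ennreal (t powr s * exp (- ((norm z)\<^sup>2 + t))) = ennreal (exp (- (norm z)\<^sup>2)) * ennreal (t powr s * exp (- t))"
        using ennreal_mult'[OF exp_ge_zero, of "- (norm z)\<^sup>2" "t powr s * exp (- t)"] by (simp only:)
      then show "?F z ((norm z)\<^sup>2 + t) = (h z * ennreal (exp (- (norm z)\<^sup>2))) * (indicator {0<..} t * ennreal (t powr (s + 1 - 1) * exp (- t)))"
        by (simp add: mult_ac split: split_indicator)
    qed
    also have "\<dots> = (h z * ennreal (exp (- (norm z)\<^sup>2))) * ?G"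
      using nn_integral_Gamma[of "s + 1"] s by (subst nn_integral_cmult) auto
    finally show ?thesis by (simp add: mult_ac)
  qed
  have outer: "(\<integral>\<^sup>+z. ?F z T \<partial>lborel) = indicator {0<..} T * ennreal (T powr (d + ?k + s) * exp (- T)) * ?I" for T
  proof (cases "T > 0")
    case False
    then have "indicator {t. (norm z)\<^sup>2 < t} T = (0::ennreal)" for z :: 'a
    proof -
      have "\<not> (norm z)\<^sup>2 < T" using False zero_le_power2[of "norm z"] by linarith
      then show ?thesis by simp
    qed
    then show ?thesis using False by simp
  next
    case True
    define c where "c = sqrt T"
    have c: "c > 0" "c\<^sup>2 = T" using True by (auto simp: c_def)
    have cp: "c powr a = T powr (a / 2)" for a
      using True by (simp add: c_def powr_half_sqrt[symmetric] powr_powr)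
    have "(\<integral>\<^sup>+z. ?F z T \<partial>lborel) = ennreal (c ^ DIM('a)) * (\<integral>\<^sup>+z. ?F (c *\<^sub>R z) T \<partial>lborel)"
      by (rule nn_integral_lborel_scaleR[OF _ c(1)]) measurable
    also have "(\<integral>\<^sup>+z. ?F (c *\<^sub>R z) T \<partial>lborel) =
       (\<integral>\<^sup>+z. ennreal (T powr (d + s) * exp (- T)) * (indicator (ball 0 1) z * (h z * ennreal ((1 - (norm z)\<^sup>2) powr s))) \<partial>lborel)"
    proof (intro nn_integral_cong)
      fix z :: 'a
      have n: "(norm (c *\<^sub>R z))\<^sup>2 = T * (norm z)\<^sup>2" using c by (simp add: power_mult_distrib)
      have iff: "T * (norm z)\<^sup>2 < T \<longleftrightarrow> norm z < 1" using True by (simp add: abs_square_less_1)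
      show "?F (c *\<^sub>R z) T = ennreal (T powr (d + s) * exp (- T)) * (indicator (ball 0 1) z * (h z * ennreal ((1 - (norm z)\<^sup>2) powr s)))"
      proof (cases "norm z < 1")
        case z: True
        then have p: "0 < 1 - (norm z)\<^sup>2" by (simp add: abs_square_less_1)
        have e: "(T - T * (norm z)\<^sup>2) powr s = T powr s * (1 - (norm z)\<^sup>2) powr s"
          using True p by (simp add: powr_mult[symmetric] algebra_simps)
        show ?thesis
          unfolding n e hom[OF c(1)] cp using z iff True
          by (simp add: powr_add ennreal_mult' mult_ac)
      next
        case z: False
        then have "\<not> (norm (c *\<^sub>R z))\<^sup>2 < T" unfolding n iff .
        then have "indicator {t. (norm (c *\<^sub>R z))\<^sup>2 < t} T = (0::ennreal)" by simp
        then show ?thesis using z by simp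
      qed
    qed
    also have "\<dots> = ennreal (T powr (d + s) * exp (- T)) * ?I"
      by (rule nn_integral_cmult) measurable
    also have "c ^ DIM('a) = T powr ?k"
      using cp[of "real DIM('a)"] c by (simp add: powr_realpow)
    finally show ?thesis using True
      by (simp add: powr_add ennreal_mult' mult_ac)
  qed
  have "?G * ?L = (\<integral>\<^sup>+z. ?G * (h z * ennreal (exp (- (norm z)\<^sup>2))) \<partial>lborel)"
    by (rule nn_integral_cmult[symmetric]) measurable
  also have "\<dots> = (\<integral>\<^sup>+z. \<integral>\<^sup>+T. ?F z T \<partial>lborel \<partial>lborel)" by (simp only: inner)
  also have "\<dots> = (\<integral>\<^sup>+T. \<integral>\<^sup>+z. ?F z T \<partial>lborel \<partial>lborel)"
    by (rule lborel_pair.Fubini') measurable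
  also have "\<dots> = (\<integral>\<^sup>+T. indicator {0<..} T * ennreal (T powr (d + ?k + s + 1 - 1) * exp (- T)) * ?I \<partial>lborel)"
    by (simp add: outer)
  also have "\<dots> = ?G' * ?I"
  proof (subst nn_integral_multc)
    have "d + ?k + s + 1 > 0" using d s by (simp add: add_nonneg_pos)
    then show "(\<integral>\<^sup>+T. indicator {0<..} T * ennreal (T powr (d + ?k + s + 1 - 1) * exp (- T)) \<partial>lborel) * ?I = ?G' * ?I"
      by (simp only: nn_integral_Gamma)
  qed measurable
  finally show ?thesis .
qed

text \<open>The case \<open>h = 1\<close>, \<open>s = 0\<close> of the comparison, combined with the volume of the unit ball.\<close>

lemma nn_integral_gaussian:
  "(\<integral>\<^sup>+z. ennreal (exp (- (norm (z::'a::euclidean_space))\<^sup>2)) \<partial>lborel) = ennreal (pi powr (real DIM('a) / 2))"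
proof -
  have "ennreal (Gamma (0 + 1)) * (\<integral>\<^sup>+z. 1 * ennreal (exp (- (norm (z::'a))\<^sup>2)) \<partial>lborel) =
    ennreal (Gamma (0 + real DIM('a) / 2 + 0 + 1)) *
      (\<integral>\<^sup>+z. indicator (ball 0 1) z * (1 * ennreal ((1 - (norm (z::'a))\<^sup>2) powr 0)) \<partial>lborel)"
    by (rule nn_integral_homogeneous_ball_gaussian) auto
  also have "(\<integral>\<^sup>+z. indicator (ball 0 1) z * (1 * ennreal ((1 - (norm (z::'a))\<^sup>2) powr 0)) \<partial>lborel) = (\<integral>\<^sup>+z. indicator (ball (0::'a) 1) z \<partial>lborel)"
  proof (intro nn_integral_cong)
    fix z :: 'a
    show "indicator (ball 0 1) z * (1 * ennreal ((1 - (norm z)\<^sup>2) powr 0)) = indicator (ball 0 1) z"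
      using abs_square_less_1[of "norm z"] by (auto split: split_indicator)
  qed
  also have "\<dots> = ennreal (unit_ball_vol (real DIM('a)))"
    using emeasure_ball[of 1 "0::'a"] by simp
  also have "ennreal (Gamma (0 + real DIM('a) / 2 + 0 + 1)) * \<dots> = ennreal (pi powr (real DIM('a) / 2))"
    by (subst ennreal_mult[symmetric]) (auto simp: unit_ball_vol_def Gamma_real_pos_exp add_nonneg_pos less_imp_le Gamma_real_pos)
  finally show ?thesis by simp
qed

section \<open>A reproducing formula of Fock type\<close>

lemma herm_add_left: "herm (x + y) z = herm x z + herm y z"
  by (simp add: herm_def algebra_simps sum.distrib)
lemma herm_add_right: "herm x (y + z) = herm x y + herm x z"
  by (simp add: herm_def algebra_simps sum.distrib)
lemma herm_smult_left: "herm (c *s x) y = c * herm x y"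
  by (simp add: herm_def sum_distrib_left mult_ac)
lemma herm_smult_right: "herm x (c *s y) = cnj c * herm x y"
  by (simp add: herm_def sum_distrib_left mult_ac)
lemma cnj_herm: "cnj (herm x y) = herm y x"
  by (simp add: herm_def mult.commute)
lemma herm_self: "herm x x = of_real ((norm x)\<^sup>2)"
  by (simp add: herm_def complex_mult_cnj norm_vec_def L2_set_def sum_nonneg cmod_power2)

lemma norm_smult: "norm (c *s (x :: complex ^ 'k)) = cmod c * norm x"
proof -
  have "(\<Sum>i\<in>UNIV. (cmod (c * x $ i))\<^sup>2) = (cmod c)\<^sup>2 * (\<Sum>i\<in>UNIV. (cmod (x $ i))\<^sup>2)"
    by (simp add: norm_mult power_mult_distrib sum_distrib_left)
  then show ?thesis by (simp add: norm_vec_def L2_set_def real_sqrt_mult)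
qed

lemma cmod_herm_le: "cmod (herm x y) \<le> norm x * norm y"
proof -
  have "cmod (herm x y) \<le> (\<Sum>i\<in>UNIV. \<bar>norm (x $ i)\<bar> * \<bar>norm (y $ i)\<bar>)"
    unfolding herm_def by (rule order_trans[OF norm_sum]) (simp add: norm_mult)
  also have "\<dots> \<le> L2_set (\<lambda>i. norm (x $ i)) UNIV * L2_set (\<lambda>i. norm (y $ i)) UNIV"
    by (rule L2_set_mult_ineq)
  finally show ?thesis by (simp add: norm_vec_def)
qed

lemma continuous_on_herm[continuous_intros]:
  "continuous_on S f \<Longrightarrow> continuous_on S g \<Longrightarrow> continuous_on S (\<lambda>x. herm (f x) (g x))"
  unfolding herm_def by (intro continuous_intros)

lemma continuous_on_smult[continuous_intros]:
  fixes g :: "'a::topological_space \<Rightarrow> complex ^ 'k"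
  shows "continuous_on S f \<Longrightarrow> continuous_on S g \<Longrightarrow> continuous_on S (\<lambda>x. f x *s g x)"
  unfolding vector_scalar_mult_def by (intro continuous_intros)

lemma scaleR_eq_smult: "r *\<^sub>R (x :: complex ^ 'k) = of_real r *s x"
  by (simp add: vec_eq_iff scaleR_conv_of_real[symmetric])

lemma herm_scaleR_right: "herm x (r *\<^sub>R y) = of_real r * herm x y"
  by (simp add: scaleR_eq_smult herm_smult_right)

lemma orthogonal_rotation:
  assumes "cmod c = 1"
  shows "orthogonal_transformation (\<lambda>z :: complex ^ 'k. c *s z)"
  unfolding orthogonal_transformation
  by (auto intro!: linearI simp: norm_smult assms vec_eq_iff algebra_simps)

lemma integral_lborel_rotation:
  fixes g :: "complex ^ 'k \<Rightarrow> 'b::{banach, second_countable_topology}"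
  assumes g: "g \<in> borel_measurable borel" and c: "cmod c = 1"
  shows "(\<integral>z. g (c *s z) \<partial>lborel) = (\<integral>z. g z \<partial>lborel)"
    and "integrable lborel g \<Longrightarrow> integrable lborel (\<lambda>z. g (c *s z))"
proof -
  have m: "(\<lambda>z :: complex ^ 'k. c *s z) \<in> borel_measurable borel"
    by (intro borel_measurable_continuous_onI continuous_intros)
  have d: "distr lborel borel (\<lambda>z :: complex ^ 'k. c *s z) = lborel"
    by (rule lborel_distr_isometry[OF orthogonal_rotation[OF c]])
  have "(\<integral>z. g z \<partial>distr lborel borel (\<lambda>z. c *s z)) = (\<integral>z. g (c *s z) \<partial>lborel)"
    using m g by (subst integral_distr) auto
  then show "(\<integral>z. g (c *s z) \<partial>lborel) = (\<integral>z. g z \<partial>lborel)" unfolding d ..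
  assume "integrable lborel g"
  then have "integrable (distr lborel borel (\<lambda>z. c *s z)) g" unfolding d .
  then show "integrable lborel (\<lambda>z. g (c *s z))"
    using m g by (subst (asm) integrable_distr_eq) auto
qed

text \<open>Each rotation \<open>z \<mapsto> cis t *s z\<close> preserves Lebesgue measure; average over \<open>t\<close> and exchange the integrals.\<close>

lemma integral_rotation_average:
  fixes g :: "complex ^ 'k \<Rightarrow> complex"
  assumes g: "integrable lborel g"
  shows "(\<integral>z. g z \<partial>lborel) = (\<integral>z. (\<integral>t. g (cis t *s z) \<partial>circ) \<partial>lborel)"
proof -
  interpret circ: sigma_finite_measure circ by (rule sigma_finite_circ)
  interpret P: pair_sigma_finite circ "lborel :: (complex ^ 'k) measure" ..
  have gm[measurable]: "g \<in> borel_measurable borel" using g by simp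
  have rm: "(\<lambda>p::real \<times> (complex ^ 'k). cis (fst p) *s snd p) \<in> borel_measurable borel"
    by (intro borel_measurable_continuous_onI continuous_intros)
  have m: "(\<lambda>(t, z). g (cis t *s z)) \<in> borel_measurable (circ \<Otimes>\<^sub>M lborel)"
  proof -
    have s: "sets (circ \<Otimes>\<^sub>M (lborel :: (complex ^ 'k) measure)) = sets borel"
      by (metis borel_prod sets_circ sets_lborel sets_pair_measure_cong)
    show ?thesis
      unfolding case_prod_beta measurable_cong_sets[OF s refl]
      by (rule measurable_compose[OF rm gm])
  qed
  have "integrable (circ \<Otimes>\<^sub>M lborel) (\<lambda>(t, z). g (cis t *s z))"
  proof (rule P.Fubini_integrable[OF m])
    have "(\<integral>z. norm (g (cis t *s z)) \<partial>lborel) = (\<integral>z. norm (g z) \<partial>lborel)" for t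
      by (rule integral_lborel_rotation(1)) auto
    then show "integrable circ (\<lambda>t. \<integral>z. norm (case (t, z) of (t, z) \<Rightarrow> g (cis t *s z)) \<partial>lborel)"
      using finite_measure.integrable_const[OF finite_measure_circ] by simp
    show "AE t in circ. integrable lborel (\<lambda>z. case (t, z) of (t, z) \<Rightarrow> g (cis t *s z))"
      using integral_lborel_rotation(2)[OF gm _ g] by simp
  qed
  from P.Fubini_integral[OF this]
  have "(\<integral>z. (\<integral>t. g (cis t *s z) \<partial>circ) \<partial>lborel) = (\<integral>t. (\<integral>z. g (cis t *s z) \<partial>lborel) \<partial>circ)" .
  also have "\<dots> = (\<integral>t. (\<integral>z. g z \<partial>lborel) \<partial>circ)"
    by (simp add: integral_lborel_rotation(1)[OF gm])
  also have "\<dots> = (\<integral>z. g z \<partial>lborel)" by (rule integral_circ_const)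
  finally show ?thesis by simp
qed

lemma integrable_gaussian_half:
  "integrable lborel (\<lambda>z :: 'a::euclidean_space. exp (- (norm z)\<^sup>2 / 2))"
proof (rule integrableI_nonneg)
  have m: "(\<lambda>z :: 'a. ennreal (exp (- (norm z)\<^sup>2 / 2))) \<in> borel_measurable borel" by measurable
  have "(\<integral>\<^sup>+z. ennreal (exp (- (norm (z::'a))\<^sup>2 / 2)) \<partial>lborel)
    = ennreal (sqrt 2 ^ DIM('a)) * (\<integral>\<^sup>+z. ennreal (exp (- (norm (sqrt 2 *\<^sub>R (z::'a)))\<^sup>2 / 2)) \<partial>lborel)"
    by (rule nn_integral_lborel_scaleR[OF m]) simp
  also have "\<dots> = ennreal (sqrt 2 ^ DIM('a)) * (\<integral>\<^sup>+z. ennreal (exp (- (norm (z::'a))\<^sup>2)) \<partial>lborel)"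
    by (simp add: power_mult_distrib)
  finally show "(\<integral>\<^sup>+z. ennreal (exp (- (norm (z::'a))\<^sup>2 / 2)) \<partial>lborel) < \<infinity>"
    unfolding nn_integral_gaussian by (simp add: ennreal_mult_less_top)
qed auto

lemma integrable_exponential_type_gaussian:
  fixes g :: "'a::euclidean_space \<Rightarrow> complex"
  assumes m: "g \<in> borel_measurable borel" and b: "\<And>z. cmod (g z) \<le> C * exp (a * norm z)"
  shows "integrable lborel (\<lambda>z. g z * of_real (exp (- (norm z)\<^sup>2)))"
proof (rule Bochner_Integration.integrable_bound)
  have C: "C \<ge> 0" using order_trans[OF norm_ge_zero b[of 0]] by simp
  show "integrable lborel (\<lambda>z :: 'a. C * exp (a\<^sup>2 / 2) * exp (- (norm z)\<^sup>2 / 2))"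
    by (intro integrable_mult_right integrable_gaussian_half)
  show "(\<lambda>z. g z * of_real (exp (- (norm z)\<^sup>2))) \<in> borel_measurable lborel" using m by measurable
  show "AE z in lborel. norm (g z * of_real (exp (- (norm z)\<^sup>2))) \<le> norm (C * exp (a\<^sup>2 / 2) * exp (- (norm z)\<^sup>2 / 2))"
  proof (rule AE_I2)
    fix z :: 'a
    have "norm (g z * of_real (exp (- (norm z)\<^sup>2))) \<le> C * exp (a * norm z) * exp (- (norm z)\<^sup>2)"
      using b[of z] by (simp add: norm_mult mult_right_mono)
    also have "\<dots> = C * exp (a * norm z - (norm z)\<^sup>2)" by (simp add: exp_add[symmetric])
    also have "\<dots> \<le> C * exp (a\<^sup>2 / 2 + - (norm z)\<^sup>2 / 2)"
    proof (intro mult_left_mono C)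
      \<comment> \<open>The linear exponent costs only half of the Gaussian: \<open>a r \<le> a\<^sup>2/2 + r\<^sup>2/2\<close>.\<close>
      have "0 \<le> (a - norm z)\<^sup>2" by simp
      then have "a * norm z - (norm z)\<^sup>2 \<le> a\<^sup>2 / 2 + - (norm z)\<^sup>2 / 2"
        by (simp add: power2_eq_square algebra_simps)
      then show "exp (a * norm z - (norm z)\<^sup>2) \<le> exp (a\<^sup>2 / 2 + - (norm z)\<^sup>2 / 2)" by simp
    qed
    also have "\<dots> = C * exp (a\<^sup>2 / 2) * exp (- (norm z)\<^sup>2 / 2)" unfolding exp_add by simp
    finally show "norm (g z * of_real (exp (- (norm z)\<^sup>2))) \<le> norm (C * exp (a\<^sup>2 / 2) * exp (- (norm z)\<^sup>2 / 2))"
      using C by (simp add: abs_mult)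
  qed
qed

lemma integral_gaussian_complex:
  "(\<integral>z. complex_of_real (exp (- (norm (z :: complex ^ 'k))\<^sup>2)) \<partial>lborel) = of_real (pi ^ CARD('k))"
proof -
  have "(\<integral>z. exp (- (norm (z :: complex ^ 'k))\<^sup>2) \<partial>lborel) = enn2real (ennreal (pi powr (real DIM(complex ^ 'k) / 2)))"
    by (subst integral_eq_nn_integral) (simp_all add: nn_integral_gaussian del: DIM_cart)
  also have "\<dots> = pi ^ CARD('k)" by (simp add: powr_realpow)
  finally show ?thesis by simp
qed

text \<open>Substituting \<open>z = \<zeta> + u\<close> turns \<open>exp (\<langle>\<zeta>, z\<rangle> - |z|\<^sup>2)\<close> into \<open>exp (- \<langle>u, \<zeta>\<rangle> - |u|\<^sup>2)\<close>. Averaging over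
  rotations of \<open>u\<close> then replaces the rest of the integrand by its value \<open>A \<zeta>\<close> at \<open>u = 0\<close>. The
  hypothesis \<open>mean\<close> is the mean value property of \<open>A(\<zeta> + l u) exp (- l \<langle>u, \<zeta>\<rangle>)\<close> as a function of \<open>l\<close>.\<close>

theorem fock_reproducing:
  fixes A :: "complex ^ 'k \<Rightarrow> complex"
  assumes m: "A \<in> borel_measurable borel" and b: "\<And>z. cmod (A z) \<le> C * exp (a * norm z)"
    and mean: "\<And>u. (\<integral>t. A (\<zeta> + cis t *s u) * exp (- (cis t * herm u \<zeta>)) \<partial>circ) = A \<zeta>"
  shows "(\<integral>z. A z * exp (herm \<zeta> z) * of_real (exp (- (norm z)\<^sup>2)) \<partial>lborel) = of_real (pi ^ CARD('k)) * A \<zeta>"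
proof -
  have C: "C \<ge> 0" using order_trans[OF norm_ge_zero b[of 0]] by simp
  let ?g = "\<lambda>z. A z * exp (herm \<zeta> z) * of_real (exp (- (norm z)\<^sup>2))"
  let ?h = "\<lambda>u. A (\<zeta> + u) * exp (- herm u \<zeta>) * of_real (exp (- (norm u)\<^sup>2))"
  have hm: "(\<lambda>z. herm \<zeta> z) \<in> borel_measurable borel" "(\<lambda>z. herm z \<zeta>) \<in> borel_measurable borel"
    by (intro borel_measurable_continuous_onI continuous_intros)+
  have gm[measurable]: "?g \<in> borel_measurable borel" using m hm by measurable
  have gh: "?g (\<zeta> + u) = ?h u" for u
  proof -
    have "herm \<zeta> (\<zeta> + u) - herm (\<zeta> + u) (\<zeta> + u) = - herm u \<zeta> - herm u u"
      by (simp add: herm_add_left herm_add_right)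
    then have "exp (herm \<zeta> (\<zeta> + u)) * of_real (exp (- (norm (\<zeta> + u))\<^sup>2)) = exp (- herm u \<zeta>) * of_real (exp (- (norm u)\<^sup>2))"
      by (simp add: herm_self exp_of_real[symmetric] exp_add[symmetric])
    then show ?thesis by (simp only: mult.assoc)
  qed
  have hi: "integrable lborel ?h"
  proof (rule integrable_exponential_type_gaussian[where C = "C * exp (\<bar>a\<bar> * norm \<zeta>)" and a = "\<bar>a\<bar> + norm \<zeta>"])
    show "(\<lambda>u. A (\<zeta> + u) * exp (- herm u \<zeta>)) \<in> borel_measurable borel" using m hm by measurable
    fix u
    have 1: "cmod (A (\<zeta> + u)) \<le> C * exp (\<bar>a\<bar> * (norm \<zeta> + norm u))"
    proof (rule order_trans[OF b])
      have "a * norm (\<zeta> + u) \<le> \<bar>a\<bar> * (norm \<zeta> + norm u)"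
        by (intro mult_mono) (auto simp: norm_triangle_ineq)
      then show "C * exp (a * norm (\<zeta> + u)) \<le> C * exp (\<bar>a\<bar> * (norm \<zeta> + norm u))"
        using C by (intro mult_left_mono) auto
    qed
    have 2: "cmod (exp (- herm u \<zeta>)) \<le> exp (norm u * norm \<zeta>)"
      using cmod_herm_le[of u \<zeta>] abs_Re_le_cmod[of "herm u \<zeta>"] by (simp add: norm_exp_eq_Re)
    have "cmod (A (\<zeta> + u) * exp (- herm u \<zeta>)) \<le> C * exp (\<bar>a\<bar> * (norm \<zeta> + norm u)) * exp (norm u * norm \<zeta>)"
      unfolding norm_mult using C by (intro mult_mono 1 2) auto
    also have "\<dots> = C * exp (\<bar>a\<bar> * norm \<zeta>) * exp ((\<bar>a\<bar> + norm \<zeta>) * norm u)"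
      by (simp add: mult.assoc exp_add[symmetric] algebra_simps)
    finally show "cmod (A (\<zeta> + u) * exp (- herm u \<zeta>)) \<le> C * exp (\<bar>a\<bar> * norm \<zeta>) * exp ((\<bar>a\<bar> + norm \<zeta>) * norm u)" .
  qed
  have "(\<integral>z. ?g z \<partial>lborel) = (\<integral>z. ?g z \<partial>distr lborel borel (\<lambda>u. \<zeta> + 1 *\<^sub>R u))"
    using lborel_affine[of 1 \<zeta>] by (simp add: density_1)
  also have "\<dots> = (\<integral>u. ?g (\<zeta> + u) \<partial>lborel)"
    by (subst integral_distr) auto
  also have "\<dots> = (\<integral>u. ?h u \<partial>lborel)" by (simp only: gh)
  also have "\<dots> = (\<integral>u. (\<integral>t. ?h (cis t *s u) \<partial>circ) \<partial>lborel)"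
    by (rule integral_rotation_average[OF hi])
  also have "\<dots> = (\<integral>u. A \<zeta> * of_real (exp (- (norm (u :: complex ^ 'k))\<^sup>2)) \<partial>lborel)"
    unfolding norm_smult herm_smult_left using mean by simp
  also have "\<dots> = of_real (pi ^ CARD('k)) * A \<zeta>"
    unfolding integral_mult_right_zero integral_gaussian_complex by (rule mult.commute)
  finally show ?thesis .
qed

text \<open>Split a real function into positive and negative parts, both of which are homogeneous.\<close>

lemma integral_homogeneous_real:
  fixes u :: "'a::euclidean_space \<Rightarrow> real"
  assumes m[measurable]: "u \<in> borel_measurable borel"
    and hom: "\<And>r z. r > 0 \<Longrightarrow> u (r *\<^sub>R z) = r ^ (2 * N) * u z" and s: "s > -1"
    and i: "integrable lborel (\<lambda>z. u z * exp (- (norm z)\<^sup>2))"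
  shows "integrable lborel (\<lambda>z. indicator (ball 0 1) z * (u z * (1 - (norm z)\<^sup>2) powr s))"
    and "Gamma (s + 1) * (\<integral>z. u z * exp (- (norm z)\<^sup>2) \<partial>lborel) =
      Gamma (real N + real DIM('a) / 2 + s + 1) * (\<integral>z. indicator (ball 0 1) z * (u z * (1 - (norm z)\<^sup>2) powr s) \<partial>lborel)"
proof -
  let ?v = "\<lambda>z. indicator (ball 0 1) z * (u z * (1 - (norm z)\<^sup>2) powr s)"
  let ?g = "Gamma (s + 1)" and ?g' = "Gamma (real N + real DIM('a) / 2 + s + 1)"
  have g: "?g > 0" using s by (intro Gamma_real_pos) auto
  have g': "?g' > 0" using s by (intro Gamma_real_pos) (auto intro!: add_nonneg_pos)
  have [measurable]: "ball (0::'a) 1 \<in> sets borel" by simp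
  have vm[measurable]: "?v \<in> borel_measurable borel" by measurable
  have key: "ennreal ?g * (\<integral>\<^sup>+z. ennreal (w z * exp (- (norm z)\<^sup>2)) \<partial>lborel) =
      ennreal ?g' * (\<integral>\<^sup>+z. ennreal (indicator (ball 0 1) z * (w z * (1 - (norm z)\<^sup>2) powr s)) \<partial>lborel)"
    if wm: "w \<in> borel_measurable borel" and wh: "\<And>r z. r > 0 \<Longrightarrow> w (r *\<^sub>R z) = r ^ (2 * N) * w z" for w :: "'a \<Rightarrow> real"
  proof -
    have "ennreal ?g * (\<integral>\<^sup>+z. ennreal (w z) * ennreal (exp (- (norm z)\<^sup>2)) \<partial>lborel) =
      ennreal ?g' * (\<integral>\<^sup>+z. indicator (ball 0 1) z * (ennreal (w z) * ennreal ((1 - (norm z)\<^sup>2) powr s)) \<partial>lborel)"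
    proof (rule nn_integral_homogeneous_ball_gaussian)
      fix r :: real and z :: 'a assume r: "r > 0"
      have "r powr (2 * real N) = r ^ (2 * N)" using r powr_realpow[of r "2 * N"] by simp
      then show "ennreal (w (r *\<^sub>R z)) = ennreal (r powr (2 * real N)) * ennreal (w z)"
        using r by (simp add: wh ennreal_mult')
    qed (use wm s in auto)
    moreover have "ennreal (w z) * ennreal (exp (- (norm z)\<^sup>2)) = ennreal (w z * exp (- (norm z)\<^sup>2))" for z
      by (simp add: ennreal_mult'')
    moreover have "indicator (ball 0 1) z * (ennreal (w z) * ennreal ((1 - (norm z)\<^sup>2) powr s)) =
       ennreal (indicator (ball 0 1) z * (w z * (1 - (norm z)\<^sup>2) powr s))" for z
      by (auto simp: ennreal_mult'' split: split_indicator)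
    ultimately show ?thesis by simp
  qed
  show vi: "integrable lborel ?v"
  proof (rule integrableI_bounded)
    have "ennreal ?g' * (\<integral>\<^sup>+z. ennreal (norm (?v z)) \<partial>lborel) = ennreal ?g * (\<integral>\<^sup>+z. ennreal (norm (u z * exp (- (norm z)\<^sup>2))) \<partial>lborel)"
      using key[of "\<lambda>z. \<bar>u z\<bar>"] by (simp add: hom abs_mult)
    also have "\<dots> < \<infinity>" using i by (auto simp: integrable_iff_bounded ennreal_mult_less_top)
    finally show "(\<integral>\<^sup>+z. ennreal (norm (?v z)) \<partial>lborel) < \<infinity>"
      using g' by (auto simp: ennreal_mult_less_top)
  qed simp
  have p: "?g * enn2real (\<integral>\<^sup>+z. ennreal (u z * exp (- (norm z)\<^sup>2)) \<partial>lborel) = ?g' * enn2real (\<integral>\<^sup>+z. ennreal (?v z) \<partial>lborel)"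
    using arg_cong[OF key[OF m hom], of enn2real] g g' by (simp add: enn2real_mult)
  have n: "?g * enn2real (\<integral>\<^sup>+z. ennreal (- (u z * exp (- (norm z)\<^sup>2))) \<partial>lborel) = ?g' * enn2real (\<integral>\<^sup>+z. ennreal (- ?v z) \<partial>lborel)"
    using arg_cong[OF key[of "\<lambda>z. - u z"], of enn2real] g g' hom by (simp add: enn2real_mult)
  show "?g * (\<integral>z. u z * exp (- (norm z)\<^sup>2) \<partial>lborel) = ?g' * (\<integral>z. ?v z \<partial>lborel)"
    unfolding real_lebesgue_integral_def[OF i] real_lebesgue_integral_def[OF vi]
    using p n by (simp add: right_diff_distrib)
qed

lemma integral_homogeneous_complex:
  fixes h :: "'a::euclidean_space \<Rightarrow> complex"
  assumes m: "h \<in> borel_measurable borel"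
    and hom: "\<And>r z. r > 0 \<Longrightarrow> h (r *\<^sub>R z) = of_real (r ^ (2 * N)) * h z" and s: "s > -1"
    and i: "integrable lborel (\<lambda>z. h z * of_real (exp (- (norm z)\<^sup>2)))"
  shows "of_real (Gamma (s + 1)) * (\<integral>z. h z * of_real (exp (- (norm z)\<^sup>2)) \<partial>lborel) =
      of_real (Gamma (real N + real DIM('a) / 2 + s + 1)) *
        (\<integral>z. of_real (indicator (ball 0 1) z * (1 - (norm z)\<^sup>2) powr s) * h z \<partial>lborel)"
proof -
  let ?v = "\<lambda>z. of_real (indicator (ball 0 1) z * (1 - (norm z)\<^sup>2) powr s) * h z"
  have iR: "integrable lborel (\<lambda>z. Re (h z) * exp (- (norm z)\<^sup>2))" and iI: "integrable lborel (\<lambda>z. Im (h z) * exp (- (norm z)\<^sup>2))"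
    using integrable_Re[OF i] integrable_Im[OF i] by simp_all
  have mR: "(\<lambda>z. Re (h z)) \<in> borel_measurable borel" and mI: "(\<lambda>z. Im (h z)) \<in> borel_measurable borel"
    using m by measurable
  have hR: "Re (h (r *\<^sub>R z)) = r ^ (2 * N) * Re (h z)" and hI: "Im (h (r *\<^sub>R z)) = r ^ (2 * N) * Im (h z)"
    if "r > 0" for r z
    using hom[OF that] by simp_all
  note R = integral_homogeneous_real[OF mR hR s iR] and I = integral_homogeneous_real[OF mI hI s iI]
  have Rv: "Re (?v z) = indicator (ball 0 1) z * (Re (h z) * (1 - (norm z)\<^sup>2) powr s)"
    and Iv: "Im (?v z) = indicator (ball 0 1) z * (Im (h z) * (1 - (norm z)\<^sup>2) powr s)" for z
    by simp_all
  have vi: "integrable lborel ?v"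
  proof -
    have "integrable lborel (\<lambda>z. complex_of_real (Re (?v z)) + \<i> * complex_of_real (Im (?v z)))"
      unfolding Rv Iv by (intro Bochner_Integration.integrable_add integrable_mult_right integrable_of_real R(1) I(1))
    then show ?thesis unfolding complex_eq[symmetric] .
  qed
  show ?thesis
  proof (rule complex_eqI)
    show "Re (of_real (Gamma (s + 1)) * (\<integral>z. h z * of_real (exp (- (norm z)\<^sup>2)) \<partial>lborel)) =
      Re (of_real (Gamma (real N + real DIM('a) / 2 + s + 1)) * (\<integral>z. ?v z \<partial>lborel))"
      using R(2) integral_Re[OF i] integral_Re[OF vi] unfolding Rv by simp
    show "Im (of_real (Gamma (s + 1)) * (\<integral>z. h z * of_real (exp (- (norm z)\<^sup>2)) \<partial>lborel)) =
      Im (of_real (Gamma (real N + real DIM('a) / 2 + s + 1)) * (\<integral>z. ?v z \<partial>lborel))"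
      using I(2) integral_Im[OF i] integral_Im[OF vi] unfolding Iv by simp
  qed
qed

section \<open>Homogeneous expansion in the ball\<close>

lemma taylor_coeff_scale:
  assumes f: "f holomorphic_on ball 0 R" and R: "R > 0"
  shows "taylor_coeff (\<lambda>l. f (c * l)) M = c ^ M * taylor_coeff f M"
proof -
  define S where "S = ball (0::complex) (R / (cmod c + 1))"
  have c: "cmod c + 1 > 0" by (simp add: add_nonneg_pos)
  have "(deriv ^^ M) (\<lambda>l. f (c * l)) 0 = c ^ M * (deriv ^^ M) f (c * 0)"
  proof (rule higher_deriv_compose_linear[OF f])
    show "open S" "open (ball (0::complex) R)" by (auto simp: S_def)
    show "0 \<in> S" using R c by (simp add: S_def)
    fix w assume "w \<in> S"
    then have w: "cmod w * (cmod c + 1) < R" using c by (simp add: S_def pos_less_divide_eq)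
    have "cmod (c * w) \<le> cmod w * (cmod c + 1)" by (simp add: norm_mult algebra_simps)
    then show "c * w \<in> ball 0 R" using w by simp
  qed
  then show ?thesis by (simp add: taylor_coeff_def)
qed

lemma taylor_coeff_exp: "taylor_coeff (\<lambda>l. exp (x * l)) M = x ^ M / fact M"
proof -
  have "(deriv ^^ M) (\<lambda>l. exp (x * l)) = (\<lambda>l. x ^ M * exp (x * l))"
  proof (induction M)
    case (Suc M)
    have "deriv (\<lambda>l. x ^ M * exp (x * l)) l = x ^ Suc M * exp (x * l)" for l
      by (rule DERIV_imp_deriv) (auto intro!: derivative_eq_intros)
    then show ?case using Suc by simp
  qed simp
  then show ?thesis by (simp add: taylor_coeff_def)
qed

lemma circ_mean_exp:
  "(\<integral>t. cis (real M * t) * exp (cis (- t) * x) \<partial>circ) = x ^ M / fact M"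
proof -
  have "(\<integral>t. exp (cnj x * (of_real 1 * cis t)) * cis (- (real M * t)) \<partial>circ) = taylor_coeff (\<lambda>l. exp (cnj x * l)) M * of_real 1 ^ M"
    by (rule circ_mean_taylor_coeff[of _ 2]) (auto intro!: holomorphic_intros)
  then have "cnj (\<integral>t. exp (cnj x * cis t) * cis (- (real M * t)) \<partial>circ) = x ^ M / fact M"
    by (simp add: taylor_coeff_exp)
  moreover have "cnj (\<integral>t. exp (cnj x * cis t) * cis (- (real M * t)) \<partial>circ) = (\<integral>t. cis (real M * t) * exp (cis (- t) * x) \<partial>circ)"
    by (simp flip: Bochner_Integration.integral_cnj add: exp_cnj cis_cnj mult_ac)
  ultimately show ?thesis by simp
qed

text \<open>Holomorphy in several variables is used only through restriction to complex lines, together with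
  continuity. Taylor coefficients in \<open>w\<close> of a holomorphic function of \<open>(z, w)\<close> are seen to have these
  two properties directly, since they are circle means.\<close>

locale line_holomorphic =
  fixes a :: "complex ^ 'k \<Rightarrow> complex"
  assumes cont: "continuous_on (ball 0 1) a"
    and hol: "\<And>z u. (\<lambda>l. a (z + l *s u)) holomorphic_on {l. norm (z + l *s u) < 1}"
begin

text \<open>The homogeneous part of degree \<open>M\<close> of the expansion of \<open>a\<close> at the origin.\<close>

definition homog :: "nat \<Rightarrow> complex ^ 'k \<Rightarrow> complex" where
  "homog M z = taylor_coeff (\<lambda>l. a (l *s z)) M"

lemma hol_ray:
  assumes "R * norm z \<le> 1"
  shows "(\<lambda>l. a (l *s z)) holomorphic_on ball 0 R"
proof (cases "R > 0")
  case True
  have "(\<lambda>l. a (0 + l *s z)) holomorphic_on {l. norm (0 + l *s z) < 1}" by (rule hol)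
  then have "(\<lambda>l. a (l *s z)) holomorphic_on {l. cmod l * norm z < 1}" by (simp add: norm_smult)
  then show ?thesis
  proof (rule holomorphic_on_subset, intro subsetI, simp)
    fix l assume l: "cmod l < R"
    show "cmod l * norm z < 1"
    proof (cases "z = 0")
      case False
      then have "cmod l * norm z < R * norm z" using l by simp
      then show ?thesis using assms by simp
    qed simp
  qed
qed (simp add: ball_empty not_less holomorphic_on_def)

lemma homog_mean:
  assumes r: "r > 0" "r * norm z < 1"
  shows "homog M z * of_real r ^ M = (\<integral>t. a ((of_real r * cis t) *s z) * cis (- (real M * t)) \<partial>circ)"
proof -
  obtain R where R: "r < R" "R * norm z \<le> 1"
  proof (cases "z = 0")
    case True
    show ?thesis by (rule that[of "r + 1"]) (auto simp: True)
  next
    case False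
    show ?thesis by (rule that[of "1 / norm z"]) (use r False in \<open>auto simp: field_simps\<close>)
  qed
  show ?thesis
    using circ_mean_taylor_coeff[OF hol_ray[OF R(2)], of r M] r R by (simp add: homog_def)
qed

lemma homog_smult: "homog M (c *s z) = c ^ M * homog M z"
proof -
  have e: "\<exists>R>0. R * norm z \<le> 1"
  proof (cases "z = 0")
    case True
    then show ?thesis by (intro exI[of _ 1]) simp
  next
    case False
    then show ?thesis by (intro exI[of _ "1 / norm z"]) simp
  qed
  then obtain R where R: "R > 0" "R * norm z \<le> 1" by blast
  have "taylor_coeff (\<lambda>l. a ((c * l) *s z)) M = c ^ M * taylor_coeff (\<lambda>l. a (l *s z)) M"
    by (rule taylor_coeff_scale[OF hol_ray[OF R(2)] R(1)])
  then show ?thesis by (simp add: homog_def mult_ac)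
qed

text \<open>On the unit ball the homogeneous part is a circle mean of \<open>a\<close>; homogeneity extends this to the whole
  space, by scaling \<open>z\<close> with \<open>1 / (1 + norm z)\<close>.\<close>

lemma continuous_on_homog: "continuous_on UNIV (homog M)"
proof -
  have "continuous_on (ball 0 1) (homog M)"
  proof -
    have "continuous_on (ball 0 1 \<times> UNIV) (\<lambda>p. a (cis (snd p) *s fst p))"
      by (rule continuous_on_compose2[OF cont]) (auto intro!: continuous_intros simp: norm_smult)
    then have "continuous_on (ball 0 1 \<times> UNIV) (\<lambda>(z, t). a (cis t *s z) * cis (- (real M * t)))"
      by (auto simp: case_prod_beta intro!: continuous_intros)
    then have "continuous_on (ball 0 1) (\<lambda>z. \<integral>t. a (cis t *s z) * cis (- (real M * t)) \<partial>circ)"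
      by (rule continuous_on_circ_mean)
    then show ?thesis
      by (rule continuous_on_eq) (use homog_mean[of 1 _ M] in auto)
  qed
  then have 1: "continuous_on UNIV (\<lambda>z. homog M (of_real (1 / (1 + norm z)) *s z))"
  proof (rule continuous_on_compose2)
    show "continuous_on UNIV (\<lambda>z::complex ^ 'k. of_real (1 / (1 + norm z)) *s z)"
      by (intro continuous_intros) (auto simp: add_nonneg_eq_0_iff)
    show "range (\<lambda>z::complex ^ 'k. of_real (1 / (1 + norm z)) *s z) \<subseteq> ball 0 1"
    proof (intro image_subsetI)
      fix z :: "complex ^ 'k"
      have "1 + norm z > 0" by (simp add: add_pos_nonneg)
      then have "norm (complex_of_real (1 / (1 + norm z)) *s z) = norm z / (1 + norm z)"
        unfolding norm_smult norm_of_real by simp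
      also have "\<dots> < 1" using \<open>1 + norm z > 0\<close> by simp
      finally show "complex_of_real (1 / (1 + norm z)) *s z \<in> ball 0 1" by simp
    qed
  qed
  have "homog M z = of_real (1 + norm z) ^ M * homog M (of_real (1 / (1 + norm z)) *s z)" for z
  proof -
    have "1 + norm z > 0" by (simp add: add_pos_nonneg)
    then have e: "(1 + norm z) * (1 / (1 + norm z)) = 1" by simp
    have "complex_of_real (1 + norm z) * complex_of_real (1 / (1 + norm z)) = 1"
      unfolding of_real_mult[symmetric] e by (rule of_real_1)
    then show ?thesis unfolding homog_smult by (simp flip: power_mult_distrib mult.assoc)
  qed
  moreover have "continuous_on UNIV (\<lambda>z::complex ^ 'k. of_real (1 + norm z) ^ M * homog M (of_real (1 / (1 + norm z)) *s z))"
    by (intro continuous_on_mult 1 continuous_intros)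
  ultimately show ?thesis by (metis (no_types, lifting) continuous_on_cong)
qed

lemma homog_bound: "\<exists>C\<ge>0. \<forall>z. cmod (homog M z) \<le> C * norm z ^ M"
proof -
  have "compact (homog M ` cball 0 1)"
    by (intro compact_continuous_image continuous_on_subset[OF continuous_on_homog]) auto
  then obtain C where C: "\<And>z. z \<in> cball 0 1 \<Longrightarrow> cmod (homog M z) \<le> C"
    using compact_imp_bounded bounded_iff by (metis imageI)
  have "C \<ge> 0" using order_trans[OF norm_ge_zero C[of 0]] by simp
  moreover have "cmod (homog M z) \<le> C * norm z ^ M" for z
  proof -
    define v where "v = (if z = 0 then 0 else of_real (1 / norm z) *s z)"
    have "norm v \<le> 1" by (auto simp: v_def norm_smult norm_divide)
    have zv: "z = of_real (norm z) *s v"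
      by (auto simp: v_def simp flip: of_real_mult)
    have "cmod (homog M z) = norm z ^ M * cmod (homog M v)"
      by (subst zv) (simp add: homog_smult norm_mult norm_power)
    also have "\<dots> \<le> norm z ^ M * C" using C[of v] \<open>norm v \<le> 1\<close> by (intro mult_left_mono) auto
    finally show ?thesis by (simp add: mult.commute)
  qed
  ultimately show ?thesis by blast
qed

text \<open>The homogeneous part is holomorphic on complex lines in the whole space: scaling with a small \<open>r\<close>
  moves the relevant part of the line into the unit ball, where the part is a circle mean of \<open>a\<close>. The
  claim is the mean value property along the line through \<open>\<zeta>\<close> in direction \<open>u\<close>.\<close>

lemma homog_line_mean:
  "(\<integral>t. homog M (\<zeta> + cis t *s u) * exp (- (cis t * herm u \<zeta>)) \<partial>circ) = homog M \<zeta>"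
proof -
  \<comment> \<open>With this \<open>r\<close> the points \<open>r (\<zeta> + l u)\<close>, \<open>|l| < 2\<close>, lie in the unit ball; the disc of radius 2 contains the unit circle with room to spare.\<close>
  define r where "r = 1 / (1 + norm \<zeta> + 2 * norm u)"
  have p: "1 + norm \<zeta> + 2 * norm u > 0" by (simp add: add_pos_nonneg)
  have r: "r > 0" using p by (simp add: r_def)
  have rn: "norm (of_real r *s (\<zeta> + l *s u)) < 1" if "cmod l < 2" for l
  proof -
    have "norm (\<zeta> + l *s u) \<le> norm \<zeta> + cmod l * norm u"
      by (metis norm_smult norm_triangle_ineq)
    also have "\<dots> \<le> norm \<zeta> + 2 * norm u" using that by (intro add_left_mono mult_right_mono) auto
    finally have "r * norm (\<zeta> + l *s u) \<le> r * (norm \<zeta> + 2 * norm u)" using r by simp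
    also have "\<dots> < 1" using p by (simp add: r_def field_simps)
    finally show ?thesis using r by (simp only: norm_smult norm_of_real abs_of_pos)
  qed
  let ?h = "\<lambda>l t. a ((of_real r * cis t) *s (\<zeta> + l *s u)) * cis (- (real M * t))"
  have "(\<lambda>l. \<integral>t. ?h l t \<partial>circ) holomorphic_on ball 0 2"
  proof (rule holomorphic_on_circ_mean)
    have "continuous_on (ball 0 2 \<times> UNIV) (\<lambda>p. a ((of_real r * cis (snd p)) *s (\<zeta> + fst p *s u)))"
    proof (rule continuous_on_compose2[OF cont])
      show "(\<lambda>p. (complex_of_real r * cis (snd p)) *s (\<zeta> + fst p *s u)) ` (ball 0 2 \<times> UNIV) \<subseteq> ball 0 1"
      proof (intro image_subsetI)
        fix p :: "complex \<times> real" assume "p \<in> ball 0 2 \<times> UNIV"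
        then have "norm (of_real r *s (\<zeta> + fst p *s u)) < 1" by (intro rn) auto
        moreover have "(of_real r * cis (snd p)) *s v = cis (snd p) *s (of_real r *s v)" for v :: "complex ^ 'k"
          by (simp add: vec_eq_iff mult_ac)
        ultimately show "(of_real r * cis (snd p)) *s (\<zeta> + fst p *s u) \<in> ball 0 1"
          by (simp only: norm_smult[of "cis _"] norm_cis mult_1 mem_ball_0)
      qed
    qed (intro continuous_intros)
    then show "continuous_on (ball 0 2 \<times> UNIV) (\<lambda>(l, t). ?h l t)"
      by (auto simp: case_prod_beta intro!: continuous_intros)
    fix t
    have "(\<lambda>l. a ((of_real r * cis t) *s \<zeta> + l *s ((of_real r * cis t) *s u))) holomorphic_on ball 0 2"
    proof (rule holomorphic_on_subset[OF hol], intro subsetI, simp)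
      fix l assume "cmod l < 2"
      moreover have "(of_real r * cis t) *s \<zeta> + (l * (of_real r * cis t)) *s u = cis t *s (of_real r *s (\<zeta> + l *s u))"
        by (simp add: vec_eq_iff algebra_simps)
      ultimately show "norm ((of_real r * cis t) *s \<zeta> + (l * (of_real r * cis t)) *s u) < 1"
        using rn[of l] by (simp only: norm_smult[of "cis t"] norm_cis mult_1)
    qed
    moreover have "(of_real r * cis t) *s \<zeta> + l *s ((of_real r * cis t) *s u) = (of_real r * cis t) *s (\<zeta> + l *s u)" for l
      by (simp add: vec_eq_iff algebra_simps)
    ultimately have "(\<lambda>l. a ((of_real r * cis t) *s (\<zeta> + l *s u))) holomorphic_on ball 0 2" by (simp only:)
    then show "(\<lambda>l. ?h l t) holomorphic_on ball 0 2" by (intro holomorphic_intros)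
  qed simp
  then have "(\<lambda>l. (\<integral>t. ?h l t \<partial>circ) / of_real r ^ M) holomorphic_on ball 0 2"
    using r by (intro holomorphic_intros) auto
  then have "(\<lambda>l. homog M (\<zeta> + l *s u)) holomorphic_on ball 0 2"
  proof (rule holomorphic_transform)
    fix l :: complex assume "l \<in> ball 0 2"
    then have "r * norm (\<zeta> + l *s u) < 1" using rn[of l] r by (simp only: norm_smult norm_of_real abs_of_pos mem_ball_0)
    from homog_mean[OF r this, of M] show "(\<integral>t. ?h l t \<partial>circ) / of_real r ^ M = homog M (\<zeta> + l *s u)"
      using r by (simp add: field_simps)
  qed
  then have "(\<lambda>l. homog M (\<zeta> + l *s u) * exp (- (l * herm u \<zeta>))) holomorphic_on ball 0 2"
    by (intro holomorphic_intros)
  from circ_mean_value[OF this] show ?thesis by simp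
qed

text \<open>Averaging over rotations of \<open>z\<close>, only the term of degree \<open>M\<close> in the expansion of \<open>exp \<langle>\<zeta>, z\<rangle>\<close> survives
  against a homogeneous function of degree \<open>M\<close>.\<close>

lemma homog_fock:
  "(\<integral>z. homog M z * herm \<zeta> z ^ M * of_real (exp (- (norm z)\<^sup>2)) \<partial>lborel) =
     of_real (pi ^ CARD('k)) * fact M * homog M \<zeta>"
proof -
  have hb[measurable]: "homog M \<in> borel_measurable borel"
    by (rule borel_measurable_continuous_onI[OF continuous_on_homog])
  have hm[measurable]: "(\<lambda>z. herm \<zeta> z) \<in> borel_measurable borel"
    by (intro borel_measurable_continuous_onI continuous_intros)
  obtain C where C: "C \<ge> 0" "\<And>z. cmod (homog M z) \<le> C * norm z ^ M" using homog_bound by blast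
  have Ce: "cmod (homog M z) \<le> C * exp (real M * norm z)" for z
  proof (rule order_trans[OF C(2)], intro mult_left_mono C(1))
    have "norm z \<le> exp (norm z)" using exp_ge_add_one_self[of "norm z"] by linarith
    then have "norm z ^ M \<le> exp (norm z) ^ M" by (intro power_mono) auto
    then show "norm z ^ M \<le> exp (real M * norm z)" by (simp add: exp_of_nat_mult)
  qed
  let ?g = "\<lambda>z. homog M z * exp (herm \<zeta> z) * of_real (exp (- (norm z)\<^sup>2))"
  have gi: "integrable lborel ?g"
  proof (rule integrable_exponential_type_gaussian[where C = C and a = "real M + norm \<zeta>"])
    fix z
    have "cmod (exp (herm \<zeta> z)) \<le> exp (norm \<zeta> * norm z)"
      using cmod_herm_le[of \<zeta> z] complex_Re_le_cmod[of "herm \<zeta> z"] by (simp add: norm_exp_eq_Re)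
    then have "cmod (homog M z * exp (herm \<zeta> z)) \<le> C * exp (real M * norm z) * exp (norm \<zeta> * norm z)"
      unfolding norm_mult using Ce C by (intro mult_mono) auto
    then show "cmod (homog M z * exp (herm \<zeta> z)) \<le> C * exp ((real M + norm \<zeta>) * norm z)"
      by (simp add: exp_add algebra_simps)
  qed measurable
  have "of_real (pi ^ CARD('k)) * homog M \<zeta> = (\<integral>z. ?g z \<partial>lborel)"
    by (rule fock_reproducing[OF hb Ce homog_line_mean, symmetric])
  also have "\<dots> = (\<integral>z. (\<integral>t. ?g (cis t *s z) \<partial>circ) \<partial>lborel)"
    by (rule integral_rotation_average[OF gi])
  also have "\<dots> = (\<integral>z. homog M z * herm \<zeta> z ^ M * of_real (exp (- (norm z)\<^sup>2)) / fact M \<partial>lborel)"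
  proof (rule Bochner_Integration.integral_cong[OF refl])
    fix z
    have "(\<integral>t. ?g (cis t *s z) \<partial>circ) = (\<integral>t. (homog M z * of_real (exp (- (norm z)\<^sup>2))) * (cis (real M * t) * exp (cis (- t) * herm \<zeta> z)) \<partial>circ)"
      by (simp add: homog_smult norm_smult herm_smult_right cis_cnj Complex.DeMoivre mult_ac)
    also have "\<dots> = (homog M z * of_real (exp (- (norm z)\<^sup>2))) * (herm \<zeta> z ^ M / fact M)"
      unfolding integral_mult_right_zero circ_mean_exp ..
    finally show "(\<integral>t. ?g (cis t *s z) \<partial>circ) = homog M z * herm \<zeta> z ^ M * of_real (exp (- (norm z)\<^sup>2)) / fact M"
      by simp
  qed
  also have "\<dots> = (\<integral>z. homog M z * herm \<zeta> z ^ M * of_real (exp (- (norm z)\<^sup>2)) \<partial>lborel) / fact M"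
    by (rule integral_divide_zero)
  finally show ?thesis by (simp add: field_simps)
qed

text \<open>Averaging over rotations replaces \<open>a\<close> by its part of degree \<open>M\<close>. The integrand is then homogeneous of
  degree \<open>2 M\<close> up to the weight, so the integral over the ball is a known multiple of the Gaussian
  integral \<open>homog_fock\<close>.\<close>

theorem ball_reproducing:
  assumes s: "s > -1"
    and i: "integrable lborel (\<lambda>z. of_real (indicator (ball 0 1) z * (1 - (norm z)\<^sup>2) powr s) * a z)"
  shows "(\<integral>z. of_real (indicator (ball 0 1) z * (1 - (norm z)\<^sup>2) powr s) * (a z * herm \<zeta> z ^ M) \<partial>lborel) =
    of_real (pi ^ CARD('k) * Gamma (s + 1) * fact M / Gamma (real M + real CARD('k) + s + 1)) * homog M \<zeta>"
proof -
  let ?w = "\<lambda>z. complex_of_real (indicator (ball 0 1) z * (1 - (norm z)\<^sup>2) powr s)"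
  have hb[measurable]: "homog M \<in> borel_measurable borel"
    by (rule borel_measurable_continuous_onI[OF continuous_on_homog])
  have hm[measurable]: "(\<lambda>z. herm \<zeta> z) \<in> borel_measurable borel"
    by (intro borel_measurable_continuous_onI continuous_intros)
  have gi: "integrable lborel (\<lambda>z. ?w z * (a z * herm \<zeta> z ^ M))"
  proof (rule Bochner_Integration.integrable_bound)
    show "integrable lborel (\<lambda>z. of_real (norm \<zeta> ^ M) * (?w z * a z))"
      by (intro integrable_mult_right i)
    have "(\<lambda>z. (?w z * a z) * herm \<zeta> z ^ M) \<in> borel_measurable lborel"
      using borel_measurable_integrable[OF i] hm by measurable
    then show "(\<lambda>z. ?w z * (a z * herm \<zeta> z ^ M)) \<in> borel_measurable lborel" by (simp add: mult.assoc)
    show "AE z in lborel. norm (?w z * (a z * herm \<zeta> z ^ M)) \<le> norm (of_real (norm \<zeta> ^ M) * (?w z * a z))"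
    proof (rule AE_I2)
      fix z
      show "norm (?w z * (a z * herm \<zeta> z ^ M)) \<le> norm (of_real (norm \<zeta> ^ M) * (?w z * a z))"
      proof (cases "z \<in> ball 0 1")
        case True
        have "cmod (herm \<zeta> z) \<le> norm \<zeta> * norm z" by (rule cmod_herm_le)
        also have "\<dots> \<le> norm \<zeta>" using True by (intro mult_left_le) auto
        finally have "cmod (herm \<zeta> z) ^ M \<le> norm \<zeta> ^ M" by (intro power_mono) auto
        then have "cmod (?w z * a z) * cmod (herm \<zeta> z) ^ M \<le> cmod (?w z * a z) * norm \<zeta> ^ M"
          by (intro mult_left_mono) auto
        then show ?thesis by (simp add: norm_mult norm_power mult_ac)
      qed simp
    qed
  qed
  have "(\<integral>z. ?w z * (a z * herm \<zeta> z ^ M) \<partial>lborel) = (\<integral>z. (\<integral>t. ?w (cis t *s z) * (a (cis t *s z) * herm \<zeta> (cis t *s z) ^ M) \<partial>circ) \<partial>lborel)"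
    by (rule integral_rotation_average[OF gi])
  also have "\<dots> = (\<integral>z. ?w z * (homog M z * herm \<zeta> z ^ M) \<partial>lborel)"
  proof (rule Bochner_Integration.integral_cong[OF refl])
    fix z :: "complex ^ 'k"
    have w: "?w (cis t *s z) = ?w z" for t by (simp add: norm_smult indicator_def)
    have hh: "herm \<zeta> (cis t *s z) ^ M = cis (- (real M * t)) * herm \<zeta> z ^ M" for t
      by (simp add: herm_smult_right cis_cnj power_mult_distrib Complex.DeMoivre)
    have "(\<integral>t. ?w (cis t *s z) * (a (cis t *s z) * herm \<zeta> (cis t *s z) ^ M) \<partial>circ)
      = (\<integral>t. (?w z * herm \<zeta> z ^ M) * (a (cis t *s z) * cis (- (real M * t))) \<partial>circ)"
      unfolding w hh by (simp add: mult_ac)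
    also have "\<dots> = (?w z * herm \<zeta> z ^ M) * (\<integral>t. a (cis t *s z) * cis (- (real M * t)) \<partial>circ)"
      by (rule integral_mult_right_zero)
    also have "\<dots> = ?w z * (homog M z * herm \<zeta> z ^ M)"
      using homog_mean[of 1 z M] by (cases "norm z < 1") auto
    finally show "(\<integral>t. ?w (cis t *s z) * (a (cis t *s z) * herm \<zeta> (cis t *s z) ^ M) \<partial>circ) = ?w z * (homog M z * herm \<zeta> z ^ M)" .
  qed
  finally have 1: "(\<integral>z. ?w z * (a z * herm \<zeta> z ^ M) \<partial>lborel) = (\<integral>z. ?w z * (homog M z * herm \<zeta> z ^ M) \<partial>lborel)" .
  obtain C where C: "C \<ge> 0" "\<And>z. cmod (homog M z) \<le> C * norm z ^ M" using homog_bound by blast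
  let ?h = "\<lambda>z. homog M z * herm \<zeta> z ^ M"
  have "of_real (Gamma (s + 1)) * (\<integral>z. ?h z * of_real (exp (- (norm z)\<^sup>2)) \<partial>lborel) =
      of_real (Gamma (real M + real DIM(complex ^ 'k) / 2 + s + 1)) * (\<integral>z. ?w z * ?h z \<partial>lborel)"
  proof (rule integral_homogeneous_complex[OF _ _ s])
    show "?h \<in> borel_measurable borel" by measurable
    show "?h (r *\<^sub>R z) = of_real (r ^ (2 * M)) * ?h z" if "r > 0" for r z
      unfolding herm_scaleR_right unfolding scaleR_eq_smult homog_smult
      by (simp add: power_mult_distrib power_mult power2_eq_square mult_ac)
    show "integrable lborel (\<lambda>z. ?h z * of_real (exp (- (norm z)\<^sup>2)))"
    proof (rule integrable_exponential_type_gaussian[where C = "C * norm \<zeta> ^ M" and a = "real (2 * M)"])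
      fix z
      have "cmod (?h z) \<le> (C * norm z ^ M) * (norm \<zeta> * norm z) ^ M"
        unfolding norm_mult norm_power using C by (intro mult_mono power_mono cmod_herm_le) auto
      also have "\<dots> = C * norm \<zeta> ^ M * norm z ^ (2 * M)"
        by (simp add: power_mult_distrib power_mult power2_eq_square mult_ac)
      also have "\<dots> \<le> C * norm \<zeta> ^ M * exp (real (2 * M) * norm z)"
      proof (intro mult_left_mono)
        have "norm z \<le> exp (norm z)" using exp_ge_add_one_self[of "norm z"] by linarith
        then have "norm z ^ (2 * M) \<le> exp (norm z) ^ (2 * M)" by (intro power_mono) auto
        then show "norm z ^ (2 * M) \<le> exp (real (2 * M) * norm z)" by (simp only: exp_of_nat_mult)
      qed (use C in auto)
      finally show "cmod (?h z) \<le> C * norm \<zeta> ^ M * exp (real (2 * M) * norm z)" .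
    qed measurable
  qed
  also have "real DIM(complex ^ 'k) / 2 = real CARD('k)" by simp
  finally have 2: "of_real (Gamma (s + 1)) * (of_real (pi ^ CARD('k)) * fact M * homog M \<zeta>) =
      of_real (Gamma (real M + real CARD('k) + s + 1)) * (\<integral>z. ?w z * ?h z \<partial>lborel)"
    unfolding homog_fock .
  have "Gamma (real M + real CARD('k) + s + 1) > 0"
    using s by (intro Gamma_real_pos) (simp add: add_nonneg_pos)
  then have "complex_of_real (Gamma (real M + real CARD('k) + s + 1)) \<noteq> 0" by simp
  then show ?thesis unfolding 1 using 2 by (simp add: field_simps)
qed

end

section \<open>The numerator polynomials\<close>

text \<open>Multiplying the \<open>n\<close>-th coefficient by \<open>n\<close> is the operator \<open>X d/dX\<close>, which raises the order of the pole at
  \<open>1\<close> and the degree of the numerator by at most one. The witness is the numerator of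
  \<open>(u + v X d/dX) (Q / (1 - X)^(k + 1))\<close>.\<close>

lemma power_series_times_linear_factor:
  fixes c :: "nat \<Rightarrow> complex" and Q :: "complex poly"
  assumes deg: "degree Q \<le> k"
    and s: "\<And>X. cmod X < 1 \<Longrightarrow> (\<lambda>n. c n * X ^ n) sums (poly Q X / (1 - X) ^ (k + 1))"
  shows "\<exists>R. degree R \<le> Suc k \<and>
    (\<forall>X. cmod X < 1 \<longrightarrow> (\<lambda>n. (u + v * of_nat n) * c n * X ^ n) sums (poly R X / (1 - X) ^ (Suc k + 1)))"
proof -
  define R where "R = smult u (Q * [:1, -1:]) + smult v ([:0, 1:] * (pderiv Q * [:1, -1:] + smult (of_nat (k + 1)) Q))"
  have "degree R \<le> Suc k"
    unfolding R_def
  proof (intro degree_add_le order_trans[OF degree_smult_le])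
    show "degree (Q * [:1, -1:]) \<le> Suc k"
      by (rule order_trans[OF degree_mult_le]) (use deg in simp)
    have "degree (pderiv Q * [:1, -1:]) \<le> k"
    proof (cases "pderiv Q = 0")
      case False
      then have "degree Q \<noteq> 0" by (simp add: pderiv_eq_0_iff)
      then show ?thesis
        using deg by (intro order_trans[OF degree_mult_le]) (simp add: degree_pderiv)
    qed simp
    moreover have "degree (smult (of_nat (k + 1)) Q) \<le> k"
      using deg by (intro order_trans[OF degree_smult_le])
    ultimately have "degree (pderiv Q * [:1, -1:] + smult (of_nat (k + 1)) Q) \<le> k"
      by (rule degree_add_le)
    then show "degree ([:0, 1:] * (pderiv Q * [:1, -1:] + smult (of_nat (k + 1)) Q)) \<le> Suc k"
      by (intro order_trans[OF degree_mult_le]) simp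
  qed
  moreover have "(\<lambda>n. (u + v * of_nat n) * c n * X ^ n) sums (poly R X / (1 - X) ^ (Suc k + 1))" if X: "cmod X < 1" for X
  proof -
    have X1: "1 - X \<noteq> 0" using X by auto
    define w where "w = 1 - X"
    define wk where "wk = w ^ k"
    have w0: "w \<noteq> 0" "wk \<noteq> 0" using X1 by (auto simp: w_def wk_def)
    have pw: "(1 - X) ^ (k + 1) = w * wk" "(1 - X) ^ (Suc k + 1) = w * (w * wk)" by (simp_all add: w_def wk_def)
    define q where "q = poly Q X"
    define q' where "q' = poly (pderiv Q) X"
    define N where "N = complex_of_nat (k + 1)"
    define f' where "f' = (q' * w + N * q) / (w * (w * wk))"
    have "((\<lambda>X. poly Q X / (1 - X) ^ (k + 1)) has_field_derivative f') (at X)"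
    proof -
      have "((\<lambda>X. (1 - X) ^ (k + 1)) has_field_derivative - (N * wk)) (at X)"
      proof -
        have "((\<lambda>X. 1 - X) has_field_derivative - 1) (at X)" by (auto intro!: derivative_eq_intros)
        from DERIV_power[OF this, of "k + 1"] show ?thesis by (simp add: wk_def w_def N_def algebra_simps)
      qed
      from DERIV_divide[OF poly_DERIV[of Q X] this]
      have "((\<lambda>X. poly Q X / (1 - X) ^ (k + 1)) has_field_derivative
          (q' * (w * wk) - q * (- (N * wk))) / (w * wk * (w * wk))) (at X)"
        using w0 unfolding pw q_def q'_def by simp
      moreover have "(q' * (w * wk) - q * (- (N * wk))) / (w * wk * (w * wk)) = f'"
        using w0 unfolding f'_def by (simp add: field_simps)
      ultimately show ?thesis by simp
    qed
    from termdiffs_sums_strong[of 1 c "\<lambda>X. poly Q X / (1 - X) ^ (k + 1)", OF s this X]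
    have "(\<lambda>n. diffs c n * X ^ n) sums f'" by simp
    then have "(\<lambda>n. X * (diffs c n * X ^ n)) sums (X * f')" by (rule sums_mult)
    then have "(\<lambda>n. of_nat (Suc n) * c (Suc n) * X ^ Suc n) sums (X * f')"
      by (simp add: diffs_def mult_ac)
    then have "(\<lambda>n. of_nat n * c n * X ^ n) sums (X * f')"
      by (subst (asm) sums_Suc_iff) simp
    then have "(\<lambda>n. u * (c n * X ^ n) + v * (of_nat n * c n * X ^ n)) sums (u * (poly Q X / (1 - X) ^ (k + 1)) + v * (X * f'))"
      by (intro sums_add sums_mult s X)
    moreover have "u * (poly Q X / (1 - X) ^ (k + 1)) + v * (X * f') = poly R X / (1 - X) ^ (Suc k + 1)"
    proof -
      have "poly R X = u * (q * w) + v * (X * (q' * w + N * q))"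
        by (simp add: R_def q_def q'_def N_def w_def algebra_simps)
      then show ?thesis using w0 unfolding pw f'_def q_def[symmetric] by (simp add: field_simps)
    qed
    ultimately show ?thesis by (simp add: algebra_simps)
  qed
  ultimately show ?thesis by blast
qed

lemma pochhammer_series_rational:
  "\<exists>P :: complex poly. degree P \<le> k \<and> (\<forall>X. cmod X < 1 \<longrightarrow>
     (\<lambda>\<beta>. complex_of_real (pochhammer (\<mu> + real \<beta> / real m) k) * X ^ \<beta>) sums (poly P X / (1 - X) ^ (k + 1)))"
proof (induction k)
  case 0
  show ?case
    by (rule exI[of _ 1]) (simp add: geometric_sums)
next
  case (Suc k)
  then obtain Q :: "complex poly" where Q: "degree Q \<le> k" "\<And>X. cmod X < 1 \<Longrightarrow>
     (\<lambda>\<beta>. complex_of_real (pochhammer (\<mu> + real \<beta> / real m) k) * X ^ \<beta>) sums (poly Q X / (1 - X) ^ (k + 1))" by blast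
  have "complex_of_real (pochhammer (\<mu> + real \<beta> / real m) (Suc k)) =
    (complex_of_real (\<mu> + real k) + complex_of_real (1 / real m) * of_nat \<beta>) * complex_of_real (pochhammer (\<mu> + real \<beta> / real m) k)" for \<beta>
    by (simp add: pochhammer_Suc algebra_simps)
  then show ?case
    using power_series_times_linear_factor[OF Q, of "complex_of_real (\<mu> + real k)" "complex_of_real (1 / real m)"]
    by (simp only:)
qed

text \<open>Existence is \<open>pochhammer_series_rational\<close>; two such polynomials agree on the unit disc, hence are equal,
  so the definite description is meaningful.\<close>

lemma P_poly_sums:
  assumes "cmod X < 1"
  shows "(\<lambda>\<beta>. complex_of_real (pochhammer (\<mu> + real \<beta> / real m) k) * X ^ \<beta>)
     sums (poly (P_poly m k \<mu>) X / (1 - X) ^ (k + 1))"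
proof -
  let ?p = "\<lambda>P. degree P \<le> k \<and> (\<forall>X. cmod X < 1 \<longrightarrow>
     (\<lambda>\<beta>. complex_of_real (pochhammer (\<mu> + real \<beta> / real m) k) * X ^ \<beta>) sums (poly P X / (1 - X) ^ (k + 1)))"
  obtain P where P: "?p P" using pochhammer_series_rational by blast
  have "Q = P" if Q: "?p Q" for Q
  proof (rule ccontr)
    assume "Q \<noteq> P"
    then have "finite {X. poly (Q - P) X = 0}" by (intro poly_roots_finite) simp
    moreover have "ball (0::complex) 1 \<subseteq> {X. poly (Q - P) X = 0}"
    proof
      fix X :: complex assume "X \<in> ball 0 1"
      then have X: "cmod X < 1" by simp
      then have "1 - X \<noteq> 0" by auto
      moreover have "poly Q X / (1 - X) ^ (k + 1) = poly P X / (1 - X) ^ (k + 1)"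
        using P Q X sums_unique2 by blast
      ultimately show "X \<in> {X. poly (Q - P) X = 0}" by simp
    qed
    ultimately have "finite (ball (0::complex) 1)" by (rule finite_subset[rotated])
    then show False using uncountable_ball[of 1 "0::complex"] by (simp add: countable_finite)
  qed
  then have "?p (P_poly m k \<mu>)" unfolding P_poly_def by (intro theI[of ?p P] P)
  then show ?thesis using assms by blast
qed

section \<open>Integration against the Fefferman measure\<close>

lemma compact_closure_egg:
  assumes m: "m \<ge> 1"
  shows "compact (closure (egg m :: ('k::finite) cpoint set))" "compact (frontier (egg m :: 'k cpoint set))"
proof -
  have "bounded (closure (egg m :: 'k cpoint set))"
  proof (rule boundedI)
    fix p :: "'k cpoint" assume "p \<in> closure (egg m)"
    then have e: "(norm (fst p))\<^sup>2 + cmod (snd p) ^ (2 * m) \<le> 1" unfolding closure_egg[OF m] by simp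
    then have "(norm (fst p))\<^sup>2 \<le> 1" "cmod (snd p) ^ (2 * m) \<le> 1"
      using zero_le_power[OF norm_ge_zero, of "snd p" "2 * m"] zero_le_power2[of "norm (fst p)"] by linarith+
    then have "norm (fst p) \<le> 1" "cmod (snd p) \<le> 1"
      using m by (auto simp: abs_square_le_1 power_le_one_iff)
    then show "norm p \<le> 2" using norm_Pair_le[of "fst p" "snd p"] by simp
  qed
  then show "compact (closure (egg m :: 'k cpoint set))" by (simp add: compact_eq_bounded_closed)
  have "bounded (frontier (egg m :: 'k cpoint set))"
    by (rule bounded_subset[OF \<open>bounded (closure (egg m))\<close>]) (auto simp: frontier_def)
  then show "compact (frontier (egg m :: 'k cpoint set))" by (simp add: compact_eq_bounded_closed)
qed

lemma sets_fefferman_measure: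
  assumes "m \<ge> 1"
  shows "sets (fefferman_measure m) = sets (restrict_space borel (frontier (egg m)))"
  unfolding fefferman_measure_def sets_density
  by (rule is_surface_measure_egg[OF assms, unfolded is_surface_measure_def, THEN conjunct1])

lemma space_fefferman_measure:
  assumes "m \<ge> 1"
  shows "space (fefferman_measure m) = frontier (egg m)"
  using sets_eq_imp_space_eq[OF sets_fefferman_measure[OF assms]] by (simp add: space_restrict_space)

lemma borel_measurable_fefferman_measure:
  fixes F :: "('k::finite) cpoint \<Rightarrow> 'b::topological_space"
  assumes m: "m \<ge> 1" and F: "continuous_on (frontier (egg m)) F"
  shows "F \<in> borel_measurable (fefferman_measure m)"
  using borel_measurable_continuous_on_restrict[OF F] measurable_cong_sets[OF sets_fefferman_measure[OF m] refl] by blast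

lemma mu_egg_pos: "m \<ge> 1 \<Longrightarrow> mu_egg n m > 0"
  by (simp add: mu_egg_def add_nonneg_pos)

lemma polar_density_nonneg: "polar_density m q \<ge> 0"
  by (simp add: polar_density_def)

text \<open>In polar coordinates the total mass is a multiple of the integral of \<open>(1 - |z|\<^sup>2)\<^bsup>\<mu>-1\<^esup>\<close> over the ball,
  finite since \<open>\<mu> > 0\<close>: the comparison with the Gaussian shows this without computing the integral.\<close>

lemma emeasure_fefferman_measure_finite:
  assumes m: "m \<ge> 1"
  shows "emeasure (fefferman_measure m :: ('k::finite) cpoint measure) (space (fefferman_measure m)) < \<infinity>"
proof -
  let ?s = "mu_egg (CARD('k) + 1) m - 1"
  let ?c = "real m powr (2 / (real CARD('k) + 2)) / (2 * real m)"
  have s: "?s > -1" using mu_egg_pos[OF m, of "CARD('k) + 1"] by simp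
  have [measurable]: "ball (0::complex ^ 'k) 1 \<in> sets borel" by simp
  let ?I = "\<integral>\<^sup>+z. indicator (ball 0 1) z * (1 * ennreal ((1 - (norm (z :: complex ^ 'k))\<^sup>2) powr ?s)) \<partial>lborel"
  have g: "Gamma (0 + real DIM(complex ^ 'k) / 2 + ?s + 1) > 0"
    using s by (intro Gamma_real_pos) (simp add: add_nonneg_pos)
  have eq: "ennreal (Gamma (?s + 1)) * (\<integral>\<^sup>+z. 1 * ennreal (exp (- (norm (z :: complex ^ 'k))\<^sup>2)) \<partial>lborel) =
    ennreal (Gamma (0 + real DIM(complex ^ 'k) / 2 + ?s + 1)) * ?I"
    using s by (intro nn_integral_homogeneous_ball_gaussian) auto
  have "ennreal (Gamma (0 + real DIM(complex ^ 'k) / 2 + ?s + 1)) * ?I < \<infinity>"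
    by (subst eq[symmetric]) (simp add: nn_integral_gaussian ennreal_mult_less_top)
  then have I: "?I < \<infinity>" using g by (auto simp: ennreal_mult_less_top)
  have [measurable]: "(polar_domain :: ((complex ^ 'k) \<times> real) set) \<in> sets borel"
    by (rule borel_open[OF open_polar_domain])
  note [measurable] = measurable_polar_density[where 'k = 'k]
  have "emeasure (fefferman_measure m :: 'k cpoint measure) (space (fefferman_measure m)) = (\<integral>\<^sup>+p. 1 \<partial>(fefferman_measure m :: 'k cpoint measure))"
    by simp
  also have "\<dots> = (\<integral>\<^sup>+q. indicator polar_domain q * (ennreal (polar_density m (q :: (complex ^ 'k) \<times> real)) * 1) \<partial>lborel)"
    by (rule nn_integral_fefferman_measure[OF m]) simp
  also have "\<dots> = (\<integral>\<^sup>+q. indicator polar_domain q * (ennreal (polar_density m (q :: (complex ^ 'k) \<times> real)) * 1) \<partial>(lborel \<Otimes>\<^sub>M lborel))"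
    by (simp only: lborel_prod)
  also have "\<dots> = (\<integral>\<^sup>+z. \<integral>\<^sup>+t. indicator polar_domain (z, t) * (ennreal (polar_density m (z :: complex ^ 'k, t)) * 1) \<partial>lborel \<partial>lborel)"
    by (rule lborel.nn_integral_fst[symmetric]) (unfold lborel_prod, measurable)
  also have "\<dots> = (\<integral>\<^sup>+z. \<integral>\<^sup>+t. (ennreal ?c * (indicator (ball 0 1) z * (1 * ennreal ((1 - (norm (z :: complex ^ 'k))\<^sup>2) powr ?s)))) * indicator {-pi<..<pi} t \<partial>lborel \<partial>lborel)"
  proof (intro nn_integral_cong)
    fix z :: "complex ^ 'k" and t :: real
    have "ennreal (polar_density m (z, t)) = ennreal ?c * ennreal ((1 - (norm z)\<^sup>2) powr ?s)"
      unfolding polar_density_def fst_conv by (rule ennreal_mult') simp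
    then show "indicator polar_domain (z, t) * (ennreal (polar_density m (z, t)) * 1) =
        (ennreal ?c * (indicator (ball 0 1) z * (1 * ennreal ((1 - (norm z)\<^sup>2) powr ?s)))) * indicator {-pi<..<pi} t"
      by (simp only: mult_1_right mult_1) (auto simp: polar_domain_def split: split_indicator)
  qed
  also have "\<dots> = (\<integral>\<^sup>+z. (ennreal ?c * (indicator (ball 0 1) z * (1 * ennreal ((1 - (norm (z :: complex ^ 'k))\<^sup>2) powr ?s)))) * ennreal (2 * pi) \<partial>lborel)"
    by (simp add: nn_integral_cmult)
  also have "\<dots> = ennreal ?c * ?I * ennreal (2 * pi)"
    by (subst nn_integral_multc, measurable, subst nn_integral_cmult, measurable)
  also have "\<dots> < \<infinity>" using I by (simp add: ennreal_mult_less_top)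
  finally show ?thesis .
qed

lemma finite_measure_fefferman_measure: "m \<ge> 1 \<Longrightarrow> finite_measure (fefferman_measure m)"
  by (rule finite_measureI, rule less_imp_neq, rule emeasure_fefferman_measure_finite)

lemma fefferman_measure_polar:
  fixes F :: "('k::finite) cpoint \<Rightarrow> complex"
  assumes m: "m \<ge> 1" and F: "F \<in> borel_measurable (fefferman_measure m)"
  shows "(\<integral>p. F p \<partial>fefferman_measure m) =
      (\<integral>q. (indicator polar_domain q * polar_density m q) *\<^sub>R F (polar_point m q) \<partial>lborel)" (is ?A)
    and "integrable (fefferman_measure m) F \<Longrightarrow>
      integrable lborel (\<lambda>q. (indicator polar_domain q * polar_density m q) *\<^sub>R F (polar_point m q))" (is "_ \<Longrightarrow> ?B")
proof -
  let ?S = "frontier (egg m) :: 'k cpoint set"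
  let ?M = "fefferman_measure m :: 'k cpoint measure"
  have "0 \<in> polar_domain" by (simp add: polar_domain_def zero_prod_def)
  then have "polar_point m 0 \<in> ?S" using polar_point_image(1)[OF m] by blast
  then obtain p0 where p0: "p0 \<in> ?S" by blast
  define f where "f q = (if q \<in> polar_domain then polar_point m q - p0 else 0) + p0" for q
  have fD: "f q = polar_point m q" if "q \<in> polar_domain" for q using that by (simp add: f_def)
  have Db[measurable]: "(polar_domain :: ((complex ^ 'k) \<times> real) set) \<in> sets borel"
    by (rule borel_open[OF open_polar_domain])
  note [measurable] = measurable_polar_density[where 'k = 'k]
  have cp: "continuous_on polar_domain (polar_point m :: _ \<Rightarrow> 'k cpoint)"
    by (intro continuous_at_imp_continuous_on ballI has_derivative_continuous[OF polar_point_has_derivative[OF _ m]])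
  have fb[measurable]: "f \<in> borel_measurable borel"
    unfolding f_def[abs_def]
    by (intro borel_measurable_add borel_measurable_const borel_measurable_if_continuous_on Db
        continuous_on_diff continuous_on_const cp)
  have fm: "f \<in> measurable borel ?M"
    unfolding measurable_cong_sets[OF refl sets_fefferman_measure[OF m]]
  proof (rule measurable_restrict_space2)
    have "polar_point m q \<in> ?S" if "q \<in> polar_domain" for q
      by (rule subsetD[OF polar_point_image(1)[OF m] imageI[OF that]])
    then show "f \<in> space borel \<rightarrow> ?S" using p0 by (simp add: f_def)
  qed (rule fb)
  define w where "w q = indicator polar_domain q * polar_density m q" for q :: "(complex ^ 'k) \<times> real"
  have wm[measurable]: "w \<in> borel_measurable borel" unfolding w_def[abs_def] by measurable
  have w0: "w q \<ge> 0" for q by (simp add: w_def polar_density_nonneg)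
  have area: "?M = distr (density lborel (\<lambda>q. ennreal (w q))) ?M f"
  proof (rule measure_eqI)
    fix B assume B: "B \<in> sets ?M"
    then have Bb: "B \<in> sets borel"
      unfolding sets_fefferman_measure[OF m] by (subst (asm) sets_restrict_space) auto
    have vB: "f -` B \<in> sets borel" using measurable_sets[OF fb Bb] by simp
    have "emeasure ?M B = (\<integral>\<^sup>+p. indicator B p \<partial>?M)" using B by simp
    also have "\<dots> = (\<integral>\<^sup>+q. indicator polar_domain q * (ennreal (polar_density m q) * indicator B (polar_point m q)) \<partial>lborel)"
      by (rule nn_integral_fefferman_measure[OF m]) (use Bb in simp)
    also have "\<dots> = (\<integral>\<^sup>+q. ennreal (w q) * indicator (f -` B) q \<partial>lborel)"
      by (intro nn_integral_cong) (auto simp: w_def fD split: split_indicator)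
    also have "\<dots> = emeasure (distr (density lborel (\<lambda>q. ennreal (w q))) ?M f) B"
      using fm B vB by (subst emeasure_distr) (auto simp: emeasure_density)
    finally show "emeasure ?M B = emeasure (distr (density lborel (\<lambda>q. ennreal (w q))) ?M f) B" .
  qed simp
  have fm': "f \<in> measurable (density lborel (\<lambda>q. ennreal (w q))) ?M" using fm by simp
  have Ff: "(\<lambda>q. F (f q)) \<in> borel_measurable lborel" using measurable_compose[OF fm F] by simp
  have e: "w q *\<^sub>R F (f q) = (indicator polar_domain q * polar_density m q) *\<^sub>R F (polar_point m q)" for q
    by (simp add: w_def fD indicator_def)
  have "(\<integral>p. F p \<partial>?M) = (\<integral>p. F p \<partial>distr (density lborel (\<lambda>q. ennreal (w q))) ?M f)"
    using area by simp
  also have "\<dots> = (\<integral>q. F (f q) \<partial>density lborel (\<lambda>q. ennreal (w q)))"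
    by (rule integral_distr[OF fm' F])
  also have "\<dots> = (\<integral>q. w q *\<^sub>R F (f q) \<partial>lborel)"
    by (rule integral_density[OF Ff]) (use w0 in auto)
  finally show ?A unfolding e .
  assume "integrable ?M F"
  then have "integrable (distr (density lborel (\<lambda>q. ennreal (w q))) ?M f) F" using area by simp
  then have "integrable (density lborel (\<lambda>q. ennreal (w q))) (\<lambda>q. F (f q))"
    by (simp add: integrable_distr_eq[OF fm' F])
  then have "integrable lborel (\<lambda>q. w q *\<^sub>R F (f q))"
    by (subst (asm) integrable_density[OF Ff]) (use w0 in auto)
  then show ?B unfolding e .
qed

lemma integral_circ_lborel:
  fixes g :: "real \<Rightarrow> complex"
  assumes g: "continuous_on UNIV g"
  shows "(\<integral>t. indicator {-pi<..<pi} t *\<^sub>R g t \<partial>lborel) = of_real (2 * pi) * (\<integral>t. g t \<partial>circ)"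
proof -
  have gb[measurable]: "g \<in> borel_measurable borel" using g by (rule borel_measurable_continuous_onI)
  have int: "set_integrable lborel {-pi..pi} g"
    by (rule borel_integrable_atLeastAtMost') (rule continuous_on_subset[OF g], simp)
  have "(\<integral>t. indicator {-pi<..<pi} t *\<^sub>R g t \<partial>lborel) = (\<integral>t. indicator {-pi..pi} t *\<^sub>R g t \<partial>lborel)"
  proof (rule integral_cong_AE)
    show "AE t in lborel. indicator {-pi<..<pi} t *\<^sub>R g t = indicator {-pi..pi} t *\<^sub>R g t"
      using AE_lborel_singleton[of pi] AE_lborel_singleton[of "-pi"]
      by eventually_elim (auto split: split_indicator)
  qed measurable
  also have "\<dots> = integral {-pi..pi} g"
    using set_borel_integral_eq_integral(2)[OF int] by (simp add: set_lebesgue_integral_def)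
  finally show ?thesis using circ_integral(2)[OF g] by simp
qed

lemma continuous_on_polar_circle:
  fixes F :: "('k::finite) cpoint \<Rightarrow> complex"
  assumes m: "m \<ge> 1" and F: "continuous_on (frontier (egg m)) F" and z: "norm z < 1"
  shows "continuous_on UNIV (\<lambda>t. F (z, of_real (polar_radius m z) * cis t))"
proof (rule continuous_on_compose2[OF F])
  show "range (\<lambda>t. (z, of_real (polar_radius m z) * cis t)) \<subseteq> frontier (egg m)"
    unfolding frontier_egg[OF m]
    using polar_radius_power[OF z m] polar_radius_pos[OF z, of m] by (auto simp: norm_mult)
qed (intro continuous_intros)

lemma bounded_continuous_frontier_egg:
  fixes F :: "('k::finite) cpoint \<Rightarrow> complex"
  assumes m: "m \<ge> 1" and F: "continuous_on (frontier (egg m)) F"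
  shows "\<exists>B\<ge>0. \<forall>p\<in>frontier (egg m). cmod (F p) \<le> B"
proof -
  have "compact (F ` frontier (egg m))" by (rule compact_continuous_image[OF F compact_closure_egg(2)[OF m]])
  then obtain B where "\<forall>x\<in>F ` frontier (egg m). norm x \<le> B" using compact_imp_bounded bounded_iff by blast
  then show ?thesis by (intro exI[of _ "max B 0"]) (auto simp: le_max_iff_disj)
qed

lemma integrable_continuous_fefferman:
  fixes F :: "('k::finite) cpoint \<Rightarrow> complex"
  assumes m: "m \<ge> 1" and F: "continuous_on (frontier (egg m)) F"
  shows "integrable (fefferman_measure m) F"
proof -
  obtain B where B: "\<forall>p\<in>frontier (egg m). cmod (F p) \<le> B" using bounded_continuous_frontier_egg[OF m F] by blast
  show ?thesis
    by (rule finite_measure.integrable_const_bound[OF finite_measure_fefferman_measure[OF m], of _ B])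
       (use B borel_measurable_fefferman_measure[OF m F] in \<open>auto intro!: AE_I2 simp: space_fefferman_measure[OF m]\<close>)
qed

text \<open>The constant factor of \<open>polar_density\<close>, times \<open>2 \<pi>\<close> from normalizing the circle mean.\<close>

definition polar_const :: "nat \<Rightarrow> nat \<Rightarrow> real" where
  "polar_const k m = 2 * pi * (real m powr (2 / (real k + 2)) / (2 * real m))"

theorem integral_fefferman_measure:
  fixes F :: "('k::finite) cpoint \<Rightarrow> complex"
  assumes m: "m \<ge> 1" and F: "continuous_on (frontier (egg m)) F"
  shows "(\<integral>p. F p \<partial>fefferman_measure m) = of_real (polar_const CARD('k) m) *
      (\<integral>z. of_real (indicator (ball 0 1) z * (1 - (norm z)\<^sup>2) powr (mu_egg (CARD('k) + 1) m - 1)) *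
          (\<integral>t. F (z, of_real (polar_radius m z) * cis t) \<partial>circ) \<partial>lborel)"
    and "integrable lborel (\<lambda>z. of_real (indicator (ball 0 1) z * (1 - (norm z)\<^sup>2) powr (mu_egg (CARD('k) + 1) m - 1)) *
          (\<integral>t. F (z, of_real (polar_radius m z) * cis t) \<partial>circ))"
proof -
  let ?s = "mu_egg (CARD('k) + 1) m - 1"
  let ?c = "real m powr (2 / (real CARD('k) + 2)) / (2 * real m)"
  let ?g = "\<lambda>q. (indicator polar_domain q * polar_density m q) *\<^sub>R F (polar_point m q)"
  let ?v = "\<lambda>z. of_real (indicator (ball 0 1) z * (1 - (norm z)\<^sup>2) powr ?s) * (\<integral>t. F (z, of_real (polar_radius m z) * cis t) \<partial>circ)"
  note Fm = borel_measurable_fefferman_measure[OF m F]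
  have gi: "integrable (lborel \<Otimes>\<^sub>M lborel) ?g"
    unfolding lborel_prod by (rule fefferman_measure_polar(2)[OF m Fm integrable_continuous_fefferman[OF m F]])
  have inner: "(\<integral>t. ?g (z, t) \<partial>lborel) = of_real (polar_const CARD('k) m) * ?v z" for z
  proof (cases "norm z < 1")
    case True
    have "(\<integral>t. ?g (z, t) \<partial>lborel) = (\<integral>t. (?c * (1 - (norm z)\<^sup>2) powr ?s) *\<^sub>R (indicator {-pi<..<pi} t *\<^sub>R F (z, of_real (polar_radius m z) * cis t)) \<partial>lborel)"
      by (intro Bochner_Integration.integral_cong refl)
         (auto simp: polar_domain_def polar_density_def polar_point_def True split: split_indicator)
    also have "\<dots> = (?c * (1 - (norm z)\<^sup>2) powr ?s) *\<^sub>R (of_real (2 * pi) * (\<integral>t. F (z, of_real (polar_radius m z) * cis t) \<partial>circ))"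
      unfolding integral_scaleR_right integral_circ_lborel[OF continuous_on_polar_circle[OF m F True]] ..
    also have "\<dots> = of_real (polar_const CARD('k) m) * ?v z"
      using True by (simp add: polar_const_def scaleR_conv_of_real)
    finally show ?thesis .
  qed (simp add: polar_domain_def)
  have "(\<integral>p. F p \<partial>fefferman_measure m) = (\<integral>q. ?g q \<partial>(lborel \<Otimes>\<^sub>M lborel))"
    unfolding lborel_prod by (rule fefferman_measure_polar(1)[OF m Fm])
  also have "\<dots> = (\<integral>z. (\<integral>t. ?g (z, t) \<partial>lborel) \<partial>lborel)"
    by (rule lborel_pair.integral_fst'[OF gi, symmetric])
  also have "\<dots> = of_real (polar_const CARD('k) m) * (\<integral>z. ?v z \<partial>lborel)"
    unfolding inner by (rule integral_mult_right_zero)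
  finally show "(\<integral>p. F p \<partial>fefferman_measure m) = of_real (polar_const CARD('k) m) * (\<integral>z. ?v z \<partial>lborel)" .
  have "integrable lborel (\<lambda>z. of_real (polar_const CARD('k) m) * ?v z)"
    using lborel_pair.integrable_fst'[OF gi] unfolding inner .
  then have "integrable lborel (\<lambda>z. inverse (of_real (polar_const CARD('k) m)) * (of_real (polar_const CARD('k) m) * ?v z))"
    by (rule integrable_mult_right)
  moreover have "complex_of_real (polar_const CARD('k) m) \<noteq> 0" using m by (simp add: polar_const_def)
  then have "inverse (of_real (polar_const CARD('k) m)) * (of_real (polar_const CARD('k) m) * x) = x" for x :: complex
    by (simp flip: mult.assoc)
  ultimately show "integrable lborel ?v" by (simp only:)
qed

section \<open>Holomorphic functions near the closed egg\<close>

definition complex_differentiable_at :: "(('k::finite) cpoint \<Rightarrow> complex) \<Rightarrow> 'k cpoint \<Rightarrow> bool" where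
  "complex_differentiable_at f p \<longleftrightarrow>
     (\<exists>D. (f has_derivative D) (at p) \<and> (\<forall>c z w. D (c *s z, c * w) = c * D (z, w)))"

lemma holomorphic_several_iff:
  "holomorphic_several f U \<longleftrightarrow> (\<forall>p\<in>U. complex_differentiable_at f p)"
  by (simp add: holomorphic_several_def complex_differentiable_at_def)

lemma complex_differentiable_compose:
  assumes f: "complex_differentiable_at f p" and g: "(g has_field_derivative g') (at (f p))"
  shows "complex_differentiable_at (\<lambda>q. g (f q)) p"
proof -
  obtain D where D: "(f has_derivative D) (at p)" "\<And>c z w. D (c *s z, c * w) = c * D (z, w)"
    using f by (auto simp: complex_differentiable_at_def)
  have "((\<lambda>q. g (f q)) has_derivative (\<lambda>v. g' * D v)) (at p)"
    using has_derivative_compose[OF D(1) g[unfolded has_field_derivative_def]] .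
  then show ?thesis using D(2) unfolding complex_differentiable_at_def
    by (intro exI[of _ "\<lambda>v. g' * D v"]) (simp add: mult_ac)
qed

lemma complex_differentiable_mult:
  assumes f: "complex_differentiable_at f p" and g: "complex_differentiable_at g p"
  shows "complex_differentiable_at (\<lambda>q. f q * g q) p"
proof -
  obtain D where D: "(f has_derivative D) (at p)" "\<And>c z w. D (c *s z, c * w) = c * D (z, w)"
    using f by (auto simp: complex_differentiable_at_def)
  obtain E where E: "(g has_derivative E) (at p)" "\<And>c z w. E (c *s z, c * w) = c * E (z, w)"
    using g by (auto simp: complex_differentiable_at_def)
  show ?thesis unfolding complex_differentiable_at_def
    by (intro exI[of _ "\<lambda>v. f p * E v + D v * g p"] conjI has_derivative_mult D E)
       (simp add: D(2) E(2) algebra_simps)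
qed

lemma complex_differentiable_snd: "complex_differentiable_at snd p"
  unfolding complex_differentiable_at_def
  by (intro exI[of _ snd] conjI bounded_linear_imp_has_derivative bounded_linear_snd) simp

lemma complex_differentiable_herm: "complex_differentiable_at (\<lambda>q. herm (fst q) \<zeta>) p"
proof -
  have "linear (\<lambda>z. herm z \<zeta>)"
    by (rule linearI) (simp_all add: herm_add_left scaleR_eq_smult herm_smult_left scaleR_conv_of_real)
  then have "bounded_linear (\<lambda>q. herm (fst q) \<zeta>)"
    unfolding linear_conv_bounded_linear by (rule bounded_linear_compose[OF _ bounded_linear_fst])
  then show ?thesis
    unfolding complex_differentiable_at_def
    by (intro exI[of _ "\<lambda>q. herm (fst q) \<zeta>"] conjI bounded_linear_imp_has_derivative) (simp_all add: herm_smult_left)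
qed

text \<open>The homogeneity of the derivative under complex scalars makes its restriction to a complex line
  multiplication by a complex number.\<close>

lemma holomorphic_on_slice:
  assumes f: "holomorphic_several f U"
  shows "(\<lambda>l. f (z + l *s u, w + l * v)) holomorphic_on {l. (z + l *s u, w + l * v) \<in> U}"
  unfolding holomorphic_on_def
proof
  fix l assume "l \<in> {l. (z + l *s u, w + l * v) \<in> U}"
  then obtain D where D: "(f has_derivative D) (at (z + l *s u, w + l * v))" "\<And>c z w. D (c *s z, c * w) = c * D (z, w)"
    using f by (auto simp: holomorphic_several_def)
  have "bounded_linear (\<lambda>l::complex. l *s u)"
    by (rule linear_conv_bounded_linear[THEN iffD1], rule linearI)
       (simp_all add: vec_eq_iff algebra_simps)
  then have "((\<lambda>l::complex. (z + l *s u, w + l * v)) has_derivative (\<lambda>l. (0 + l *s u, 0 + l * v))) (at l)"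
    by (intro has_derivative_Pair has_derivative_add has_derivative_const bounded_linear_imp_has_derivative bounded_linear_mult_left)
  then have "((\<lambda>l. f (z + l *s u, w + l * v)) has_derivative (\<lambda>l. D (0 + l *s u, 0 + l * v))) (at l)"
    using D(1) by (rule has_derivative_compose)
  also have "(\<lambda>l. D (0 + l *s u, 0 + l * v)) = (*) (D (u, v))"
    using D(2) by (auto simp: fun_eq_iff mult.commute)
  finally have "((\<lambda>l. f (z + l *s u, w + l * v)) has_field_derivative D (u, v)) (at l)"
    by (simp add: has_field_derivative_def)
  then have "(\<lambda>l. f (z + l *s u, w + l * v)) field_differentiable at l"
    unfolding field_differentiable_def by (rule exI)
  then show "(\<lambda>l. f (z + l *s u, w + l * v)) field_differentiable at l within {l. (z + l *s u, w + l * v) \<in> U}"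
    by (rule field_differentiable_at_within)
qed

lemma holomorphic_several_continuous_on: "holomorphic_several f U \<Longrightarrow> continuous_on U f"
proof (intro continuous_at_imp_continuous_on ballI)
  fix p assume "holomorphic_several f U" "p \<in> U"
  then obtain D where "(f has_derivative D) (at p)" unfolding holomorphic_several_def by meson
  then show "isCont f p" by (rule has_derivative_continuous)
qed

lemma open_superset_of_cball_enlarge:
  assumes S: "open S" "cball (0::complex) r \<subseteq> S"
  shows "\<exists>R>r. ball 0 R \<subseteq> S"
proof (cases "r \<ge> 0")
  case False
  then show ?thesis by (intro exI[of _ 0]) simp
next
  case True
  obtain e where e: "e > 0" "(\<Union>x\<in>cball 0 r. ball x e) \<subseteq> S"
    using compact_subset_open_imp_ball_epsilon_subset[OF compact_cball S] by blast
  have "ball 0 (r + e) \<subseteq> S"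
  proof
    fix y :: complex assume y: "y \<in> ball 0 (r + e)"
    show "y \<in> S"
    proof (cases "cmod y \<le> r")
      case False
      then have y0: "cmod y > 0" using True by linarith
      define x where "x = of_real (r / cmod y) * y"
      have "cmod x = r" using y0 True by (simp add: x_def norm_mult norm_divide)
      moreover have "dist x y = cmod y - r"
      proof -
        have "x - y = of_real (r / cmod y - 1) * y" by (simp add: x_def algebra_simps)
        then have "dist x y = \<bar>r / cmod y - 1\<bar> * cmod y" by (simp only: dist_norm norm_mult norm_of_real)
        also have "\<dots> = (1 - r / cmod y) * cmod y" using False y0 by simp
        also have "\<dots> = cmod y - r" using y0 by (simp add: field_simps)
        finally show ?thesis .
      qed
      ultimately have "x \<in> cball 0 r" "y \<in> ball x e" using y by auto
      then show ?thesis using e(2) by blast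
    next
      case True
      then have "y \<in> cball 0 r" by simp
      then show ?thesis by (rule subsetD[OF S(2)])
    qed
  qed
  then show ?thesis using e(1) by (intro exI[of _ "r + e"]) simp
qed

lemma egg_fiber:
  assumes m: "m \<ge> 1"
  shows "(z, w) \<in> egg m \<longleftrightarrow> norm z < 1 \<and> cmod w < polar_radius m z"
    and "norm z < 1 \<Longrightarrow> cmod w \<le> polar_radius m z \<Longrightarrow> (z, w) \<in> closure (egg m)"
proof -
  have m2: "2 * m > 0" using m by simp
  show "(z, w) \<in> egg m \<longleftrightarrow> norm z < 1 \<and> cmod w < polar_radius m z"
  proof
    assume "(z, w) \<in> egg m"
    then have e: "(norm z)\<^sup>2 + cmod w ^ (2 * m) < 1" by (simp add: egg_def)
    then have "(norm z)\<^sup>2 < 1" using zero_le_power[OF norm_ge_zero, of w "2 * m"] by linarith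
    then have n: "norm z < 1" by (simp add: abs_square_less_1)
    have "cmod w ^ (2 * m) < polar_radius m z ^ (2 * m)" using e polar_radius_power[OF n m] by simp
    then show "norm z < 1 \<and> cmod w < polar_radius m z"
      using n polar_radius_pos[OF n, of m] power_less_imp_less_base by fastforce
  next
    assume a: "norm z < 1 \<and> cmod w < polar_radius m z"
    then have "cmod w ^ (2 * m) < polar_radius m z ^ (2 * m)" using m2 by (intro power_strict_mono) auto
    then show "(z, w) \<in> egg m" using polar_radius_power[of z m] a m by (simp add: egg_def)
  qed
  assume n: "norm z < 1" and w: "cmod w \<le> polar_radius m z"
  then have "cmod w ^ (2 * m) \<le> polar_radius m z ^ (2 * m)" by (intro power_mono) auto
  then show "(z, w) \<in> closure (egg m)" unfolding closure_egg[OF m] using polar_radius_power[OF n m] by simp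
qed

locale egg_holomorphic =
  fixes m :: nat and f :: "('k::finite) cpoint \<Rightarrow> complex" and U :: "'k cpoint set"
  assumes m: "m \<ge> 1" and U: "open U" "closure (egg m) \<subseteq> U" and f: "holomorphic_several f U"
begin

definition w_coeff :: "nat \<Rightarrow> complex ^ 'k \<Rightarrow> complex" where
  "w_coeff g z = taylor_coeff (\<lambda>w. f (z, w)) g"

lemma fiber_holomorphic:
  assumes z: "norm z < 1"
  shows "\<exists>R>polar_radius m z. (\<lambda>w. f (z, w)) holomorphic_on ball 0 R"
proof -
  have S: "open {w. (z, w) \<in> U}"
  proof -
    have "continuous_on UNIV (\<lambda>w::complex. (z, w))" by (intro continuous_intros)
    from open_vimage[OF U(1) this] show ?thesis by (simp add: vimage_def)
  qed
  have C: "cball 0 (polar_radius m z) \<subseteq> {w. (z, w) \<in> U}"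
  proof
    fix w :: complex assume "w \<in> cball 0 (polar_radius m z)"
    then have "(z, w) \<in> closure (egg m)" using egg_fiber(2)[OF m z, of w] by simp
    then show "w \<in> {w. (z, w) \<in> U}" using U(2) by blast
  qed
  obtain R where R: "R > polar_radius m z" "ball 0 R \<subseteq> {w. (z, w) \<in> U}"
    using open_superset_of_cball_enlarge[OF S C] by blast
  have h: "(\<lambda>w. f (z, w)) holomorphic_on {w. (z, w) \<in> U}"
    using holomorphic_on_slice[OF f, of z 0 0 1] by (simp only: vector_smult_rzero add_0_right add_0_left mult_1_right)
  show ?thesis
  proof (intro exI conjI)
    show "polar_radius m z < R" by (rule R(1))
    show "(\<lambda>w. f (z, w)) holomorphic_on ball 0 R" by (rule holomorphic_on_subset[OF h R(2)])
  qed
qed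

lemma w_coeff_mean:
  assumes z: "norm z < 1" and r: "0 \<le> r" "r \<le> polar_radius m z"
  shows "(\<integral>t. f (z, of_real r * cis t) * cis (- (real g * t)) \<partial>circ) = w_coeff g z * of_real r ^ g"
proof -
  obtain R where R: "R > polar_radius m z" "(\<lambda>w. f (z, w)) holomorphic_on ball 0 R"
    using fiber_holomorphic[OF z] by blast
  show ?thesis
    using circ_mean_taylor_coeff[OF R(2), of r g] r R(1) by (simp add: w_coeff_def)
qed

lemma w_coeff_sums:
  assumes "(z, w) \<in> egg m"
  shows "(\<lambda>g. w_coeff g z * w ^ g) sums f (z, w)"
proof -
  have z: "norm z < 1" "cmod w < polar_radius m z" using assms egg_fiber(1)[OF m] by auto
  obtain R where R: "R > polar_radius m z" "(\<lambda>w. f (z, w)) holomorphic_on ball 0 R"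
    using fiber_holomorphic[OF z(1)] by blast
  show ?thesis using taylor_coeff_sums[OF R(2), of w] z R by (simp add: w_coeff_def)
qed

lemma polar_radius_ge:
  assumes "r > 0" "(norm z)\<^sup>2 + r ^ (2 * m) < 1"
  shows "norm z < 1" "r \<le> polar_radius m z"
proof -
  have "(z, of_real r) \<in> egg m" using assms by (simp add: egg_def)
  then have "norm z < 1 \<and> cmod (of_real r) < polar_radius m z" using egg_fiber(1)[OF m] by blast
  then show "norm z < 1" "r \<le> polar_radius m z" using assms by auto
qed

text \<open>Near a given \<open>z\<close> one radius \<open>r\<close> serves for all fibres, so the coefficient is locally a circle mean of
  \<open>f\<close> over a fixed circle; continuity and holomorphy pass to such means.\<close>

lemma w_coeff_line_holomorphic: "line_holomorphic (w_coeff g)"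
proof
  define V where "V r = {z :: complex ^ 'k. (norm z)\<^sup>2 + r ^ (2 * m) < 1}" for r :: real
  have oV: "open (V r)" for r unfolding V_def by (intro open_Collect_less continuous_intros)
  have ex: "\<exists>r>0. z \<in> V r" if "norm z < 1" for z :: "complex ^ 'k"
  proof -
    have p: "polar_radius m z > 0" by (rule polar_radius_pos[OF that])
    have "(z, of_real (polar_radius m z / 2)) \<in> egg m"
      using egg_fiber(1)[OF m, of z "of_real (polar_radius m z / 2)"] p that by (simp add: norm_divide)
    then have "z \<in> V (polar_radius m z / 2)"
      using p by (simp add: V_def egg_def norm_divide power_divide)
    then show ?thesis using p by (intro exI[of _ "polar_radius m z / 2"]) auto
  qed
  have VU: "(z, of_real r * cis t) \<in> U" if "z \<in> V r" "r > 0" for z r t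
  proof -
    have "(z, of_real r * cis t) \<in> egg m" using that by (simp add: V_def egg_def norm_mult)
    then show ?thesis using U(2) closure_subset by blast
  qed
  have cf: "continuous_on U f" by (rule holomorphic_several_continuous_on[OF f])
  have e: "w_coeff g z = (\<integral>t. f (z, of_real r * cis t) * cis (- (real g * t)) \<partial>circ) / of_real r ^ g"
    if "z \<in> V r" "r > 0" for z r
  proof -
    have "(norm z)\<^sup>2 + r ^ (2 * m) < 1" using that by (simp add: V_def)
    from polar_radius_ge[OF \<open>r > 0\<close> this] show ?thesis
      using w_coeff_mean[of z r g] that by simp
  qed
  have cF: "continuous_on (V r \<times> UNIV) (\<lambda>(z, t). f (z, of_real r * cis t) * cis (- (real g * t)))" if r: "r > 0" for r
  proof -
    have "continuous_on (V r \<times> UNIV) (\<lambda>p. f (fst p, of_real r * cis (snd p)))"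
      by (rule continuous_on_compose2[OF cf]) (use VU r in \<open>auto intro!: continuous_intros\<close>)
    then show ?thesis by (auto simp: case_prod_beta intro!: continuous_intros)
  qed
  show "continuous_on (ball 0 1) (w_coeff g)"
  proof (rule continuous_at_imp_continuous_on, rule ballI)
    fix z :: "complex ^ 'k" assume "z \<in> ball 0 1"
    then obtain r where r: "r > 0" "z \<in> V r" using ex by auto
    have "continuous_on (V r) (\<lambda>z. (\<integral>t. f (z, of_real r * cis t) * cis (- (real g * t)) \<partial>circ) / of_real r ^ g)"
      using continuous_on_circ_mean[OF cF[OF r(1)]] r by (intro continuous_intros) auto
    then have "continuous_on (V r) (w_coeff g)"
      by (rule continuous_on_eq) (use e r in auto)
    then show "isCont (w_coeff g) z" using oV r(2) by (simp add: continuous_on_eq_continuous_at)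
  qed
  fix z u :: "complex ^ 'k"
  show "(\<lambda>l. w_coeff g (z + l *s u)) holomorphic_on {l. norm (z + l *s u) < 1}"
    unfolding holomorphic_on_def
  proof
    fix l0 assume "l0 \<in> {l. norm (z + l *s u) < 1}"
    then obtain r where r: "r > 0" "z + l0 *s u \<in> V r" using ex by auto
    define L where "L = {l. z + l *s u \<in> V r}"
    have oL: "open L"
    proof -
      have "continuous_on UNIV (\<lambda>l. z + l *s u)" by (intro continuous_intros)
      from open_vimage[OF oV[of r] this] show ?thesis by (simp add: L_def vimage_def)
    qed
    have "(\<lambda>l. \<integral>t. f (z + l *s u, of_real r * cis t) * cis (- (real g * t)) \<partial>circ) holomorphic_on L"
    proof (rule holomorphic_on_circ_mean[OF oL])
      have "continuous_on (L \<times> UNIV) (\<lambda>p. (\<lambda>(z, t). f (z, of_real r * cis t) * cis (- (real g * t))) (z + fst p *s u, snd p))"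
        by (rule continuous_on_compose2[OF cF[OF r(1)]]) (auto simp: L_def intro!: continuous_intros)
      then show "continuous_on (L \<times> UNIV) (\<lambda>(l, t). f (z + l *s u, of_real r * cis t) * cis (- (real g * t)))"
        by (simp add: case_prod_beta)
      fix t
      have "(\<lambda>l. f (z + l *s u, of_real r * cis t + l * 0)) holomorphic_on L"
        by (rule holomorphic_on_subset[OF holomorphic_on_slice[OF f]]) (use VU r(1) in \<open>auto simp: L_def\<close>)
      then show "(\<lambda>l. f (z + l *s u, of_real r * cis t) * cis (- (real g * t))) holomorphic_on L"
        by (intro holomorphic_intros) simp
    qed
    then have "(\<lambda>l. (\<integral>t. f (z + l *s u, of_real r * cis t) * cis (- (real g * t)) \<partial>circ) / of_real r ^ g) holomorphic_on L"
      using r by (intro holomorphic_intros) auto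
    then have "(\<lambda>l. w_coeff g (z + l *s u)) holomorphic_on L"
      by (rule holomorphic_transform) (use e r in \<open>auto simp: L_def\<close>)
    then have "(\<lambda>l. w_coeff g (z + l *s u)) field_differentiable at l0"
      using oL r(2) by (auto simp: L_def intro: holomorphic_on_imp_differentiable_at)
    then show "(\<lambda>l. w_coeff g (z + l *s u)) field_differentiable at l0 within {l. norm (z + l *s u) < 1}"
      by (rule field_differentiable_at_within)
  qed
qed

text \<open>In polar coordinates the inner mean gives \<open>w_coeff g z\<close> times \<open>R(z)^(2 g) = (1 - |z|\<^sup>2)\<^bsup>g/m\<^esup>\<close>, which
  shifts the exponent of the weight from \<open>\<mu> - 1\<close> to \<open>\<mu> - 1 + g/m\<close>; then apply \<open>ball_reproducing\<close>.\<close>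

lemma monomial_integral:
  shows "(\<integral>p. f p * (cnj (snd p) ^ g * herm \<zeta> (fst p) ^ M) \<partial>fefferman_measure m) =
    of_real (polar_const CARD('k) m * (pi ^ CARD('k) * Gamma (mu_egg (CARD('k) + 1) m + real g / real m) * fact M
       / Gamma (mu_egg (CARD('k) + 1) m + real g / real m + real (CARD('k) + M))))
     * line_holomorphic.homog (w_coeff g) M \<zeta>"
proof -
  interpret L: line_holomorphic "w_coeff g" by (rule w_coeff_line_holomorphic)
  let ?mu = "mu_egg (CARD('k) + 1) m"
  define s where "s = ?mu - 1 + real g / real m"
  have s: "s > -1" using mu_egg_pos[OF m, of "CARD('k) + 1"] by (simp add: s_def add_pos_nonneg)
  have cf: "continuous_on (frontier (egg m)) f"
    by (rule continuous_on_subset[OF holomorphic_several_continuous_on[OF f]]) (use U(2) in \<open>auto simp: frontier_def\<close>)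
  have key: "of_real (indicator (ball 0 1) z * (1 - (norm z)\<^sup>2) powr (?mu - 1)) *
      (\<integral>t. f (z, of_real (polar_radius m z) * cis t) * (cnj (of_real (polar_radius m z) * cis t) ^ g * h) \<partial>circ) =
      of_real (indicator (ball 0 1) z * (1 - (norm z)\<^sup>2) powr s) * (w_coeff g z * h)" for z :: "complex ^ 'k" and h
  proof (cases "norm z < 1")
    case True
    let ?R = "polar_radius m z"
    have R: "?R > 0" by (rule polar_radius_pos[OF True])
    have x: "1 - (norm z)\<^sup>2 > 0" by (rule one_minus_norm_pos[OF True])
    have "(\<integral>t. f (z, of_real ?R * cis t) * (cnj (of_real ?R * cis t) ^ g * h) \<partial>circ) =
        (\<integral>t. (of_real ?R ^ g * h) * (f (z, of_real ?R * cis t) * cis (- (real g * t))) \<partial>circ)"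
      by (simp add: power_mult_distrib cis_cnj Complex.DeMoivre mult_ac)
    also have "\<dots> = (of_real ?R ^ g * h) * (w_coeff g z * of_real ?R ^ g)"
      unfolding integral_mult_right_zero using w_coeff_mean[OF True, of ?R g] R by simp
    also have "\<dots> = of_real (?R ^ (2 * g)) * (w_coeff g z * h)"
      by (simp add: power_mult power2_eq_square power_mult_distrib)
    also have "?R ^ (2 * g) = (1 - (norm z)\<^sup>2) powr (real g / real m)"
      using x by (simp add: polar_radius_def powr_power)
    finally have "of_real ((1 - (norm z)\<^sup>2) powr (?mu - 1)) * (\<integral>t. f (z, of_real ?R * cis t) * (cnj (of_real ?R * cis t) ^ g * h) \<partial>circ)
      = of_real ((1 - (norm z)\<^sup>2) powr (?mu - 1) * (1 - (norm z)\<^sup>2) powr (real g / real m)) * (w_coeff g z * h)"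
      by simp
    also have "(1 - (norm z)\<^sup>2) powr (?mu - 1) * (1 - (norm z)\<^sup>2) powr (real g / real m) = (1 - (norm z)\<^sup>2) powr s"
      unfolding s_def powr_add ..
    finally show ?thesis using True by simp
  qed simp
  let ?F = "\<lambda>h p. f p * (cnj (snd p) ^ g * h (fst p))"
  have cF: "continuous_on (frontier (egg m)) (?F h)" if "continuous_on UNIV h" for h
    by (intro continuous_intros cf continuous_on_compose2[OF that]) auto
  have one: "continuous_on UNIV (\<lambda>z::complex^'k. 1::complex)" by simp
  have hrm: "continuous_on UNIV (\<lambda>z. herm \<zeta> z ^ M)" by (intro continuous_intros)
  have "integrable lborel (\<lambda>z. of_real (indicator (ball 0 1) z * (1 - (norm z)\<^sup>2) powr s) * (w_coeff g z * 1))"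
    using integral_fefferman_measure(2)[OF m cF[OF one]] unfolding fst_conv snd_conv key .
  then have i: "integrable lborel (\<lambda>z. of_real (indicator (ball 0 1) z * (1 - (norm z)\<^sup>2) powr s) * w_coeff g z)"
    by simp
  have "(\<integral>p. f p * (cnj (snd p) ^ g * herm \<zeta> (fst p) ^ M) \<partial>fefferman_measure m) = of_real (polar_const CARD('k) m) *
     (\<integral>z. of_real (indicator (ball 0 1) z * (1 - (norm z)\<^sup>2) powr s) * (w_coeff g z * herm \<zeta> z ^ M) \<partial>lborel)"
    using integral_fefferman_measure(1)[OF m cF[OF hrm]] unfolding fst_conv snd_conv key .
  also have "\<dots> = of_real (polar_const CARD('k) m) * (of_real (pi ^ CARD('k) * Gamma (s + 1) * fact M / Gamma (real M + real CARD('k) + s + 1)) * L.homog M \<zeta>)"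
    by (simp only: L.ball_reproducing[OF s i])
  also have "s + 1 = ?mu + real g / real m" by (simp add: s_def)
  also have "real M + real CARD('k) + s + 1 = ?mu + real g / real m + real (CARD('k) + M)" by (simp add: s_def)
  finally show ?thesis by (simp only: mult.assoc of_real_mult)
qed

lemma homog_sums:
  assumes "norm \<zeta> < 1"
  shows "(\<lambda>M. line_holomorphic.homog (w_coeff g) M \<zeta>) sums w_coeff g \<zeta>"
proof -
  interpret L: line_holomorphic "w_coeff g" by (rule w_coeff_line_holomorphic)
  obtain R where R: "R > 1" "R * norm \<zeta> \<le> 1"
  proof (cases "\<zeta> = 0")
    case True
    show ?thesis by (rule that[of 2]) (auto simp: True)
  next
    case False
    show ?thesis by (rule that[of "1 / norm \<zeta>"]) (use assms False in \<open>auto simp: field_simps\<close>)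
  qed
  show ?thesis
    using taylor_coeff_sums[OF L.hol_ray[OF R(2)], of 1] R by (simp add: L.homog_def)
qed

end

section \<open>Expansion of the kernel\<close>

lemma cmod_powr_of_real:
  assumes "u \<noteq> 0"
  shows "cmod (u powr of_real a) = cmod u powr a"
  using assms by (simp add: powr_def norm_exp_eq_Re)

text \<open>The power of \<open>u\<close> in the denominator of \<open>X\<close> merges with the prefactor, as for the principal branch
  integer powers of \<open>u powr b\<close> are again principal powers.\<close>

lemma powr_times_quotient_power:
  fixes u x :: complex
  assumes "u \<noteq> 0"
  shows "u powr of_real a * (x / u powr of_real b) ^ g = x ^ g * u powr of_real (a - real g * b)"
proof -
  have "(u powr of_real b) ^ g = u powr (of_nat g * of_real b)"
    using assms by (simp add: powr_def exp_of_nat_mult[symmetric] mult_ac)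
  moreover have "u powr of_real (a - real g * b) = u powr of_real a / u powr (of_nat g * of_real b)"
    by (simp add: powr_diff)
  ultimately show ?thesis by (simp add: power_divide)
qed

lemma binomial_series_pochhammer:
  assumes h: "cmod h < 1"
  shows "(\<lambda>M. of_real (pochhammer c M / fact M) * h ^ M) sums ((1 - h) powr of_real (- c))"
proof -
  have "(\<lambda>n. (complex_of_real (- c) gchoose n) * (- h) ^ n) sums (1 + (- h)) powr complex_of_real (- c)"
    by (rule gen_binomial_complex) (use h in simp)
  moreover have "(complex_of_real (- c) gchoose n) * (- h) ^ n = of_real (pochhammer c n / fact n) * h ^ n" for n
  proof -
    have "(complex_of_real (- c) gchoose n) * (- h) ^ n = ((-1) ^ n * (-1) ^ n) * (pochhammer (complex_of_real c) n / fact n) * h ^ n"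
      by (simp add: gbinomial_pochhammer power_minus[of h])
    also have "(-1) ^ n * (-1) ^ n = (1::complex)" by (simp flip: power_mult_distrib)
    finally show ?thesis by (simp add: pochhammer_of_real)
  qed
  ultimately show ?thesis by simp
qed

definition egg_kernel :: "nat \<Rightarrow> ('k::finite) cpoint \<Rightarrow> 'k cpoint \<Rightarrow> complex" where
  "egg_kernel m p q = of_real (C_egg (CARD('k) + 1) m)
     * (1 - herm (fst p) (fst q)) powr of_real (- real CARD('k) - mu_egg (CARD('k) + 1) m)
     * (poly (P_poly m CARD('k) (mu_egg (CARD('k) + 1) m)) (X_egg m p q) / (1 - X_egg m p q) ^ (CARD('k) + 1))"

lemma X_egg_eq: "X_egg m p q = snd p * cnj (snd q) / (1 - herm (fst p) (fst q)) powr of_real (1 / real m)"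
  by (simp add: X_egg_def case_prod_beta)

lemma closure_egg_norm_le:
  assumes m: "m \<ge> 1" and p: "p \<in> closure (egg m)"
  shows "norm (fst p) \<le> 1" "cmod (snd p) \<le> 1"
proof -
  have e: "(norm (fst p))\<^sup>2 + cmod (snd p) ^ (2 * m) \<le> 1" using p unfolding closure_egg[OF m] by simp
  then have "(norm (fst p))\<^sup>2 \<le> 1" "cmod (snd p) ^ (2 * m) \<le> 1"
    using zero_le_power[OF norm_ge_zero, of "snd p" "2 * m"] zero_le_power2[of "norm (fst p)"] by linarith+
  then show "norm (fst p) \<le> 1" "cmod (snd p) \<le> 1"
    using m by (auto simp: abs_square_le_1 power_le_one_iff)
qed

lemma herm_closure_egg:
  assumes m: "m \<ge> 1" and p: "p \<in> closure (egg m)" and q: "q \<in> egg m"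
  shows "norm (fst q) < 1" "cmod (herm (fst p) (fst q)) \<le> norm (fst p) * norm (fst q)"
    "cmod (herm (fst p) (fst q)) \<le> norm (fst q)"
    "1 - norm (fst q) \<le> cmod (1 - herm (fst p) (fst q))" "Re (1 - herm (fst p) (fst q)) > 0"
proof -
  show n: "norm (fst q) < 1" using q egg_fiber(1)[OF m, of "fst q" "snd q"] by simp
  show 1: "cmod (herm (fst p) (fst q)) \<le> norm (fst p) * norm (fst q)" by (rule cmod_herm_le)
  also have "\<dots> \<le> 1 * norm (fst q)" using closure_egg_norm_le(1)[OF m p] by (intro mult_right_mono) auto
  finally show 2: "cmod (herm (fst p) (fst q)) \<le> norm (fst q)" by simp
  have "Re (herm (fst p) (fst q)) \<le> norm (fst q)" using complex_Re_le_cmod 2 by (rule order_trans)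
  then show "Re (1 - herm (fst p) (fst q)) > 0" using n by simp
  have "1 - cmod (herm (fst p) (fst q)) \<le> cmod (1 - herm (fst p) (fst q))"
    using norm_triangle_ineq2[of 1 "herm (fst p) (fst q)"] by simp
  then show "1 - norm (fst q) \<le> cmod (1 - herm (fst p) (fst q))" using 2 by linarith
qed

text \<open>A bound for \<open>|X(p, q)|\<close> that holds for all \<open>p\<close> in the closed domain; see \<open>cmod_X_egg_le\<close>.\<close>

definition egg_ratio :: "nat \<Rightarrow> ('k::finite) cpoint \<Rightarrow> real" where
  "egg_ratio m q = cmod (snd q) / polar_radius m (fst q)"

lemma egg_ratio:
  assumes m: "m \<ge> 1" and q: "q \<in> egg m"
  shows "0 \<le> egg_ratio m q" "egg_ratio m q < 1"
proof -
  have "norm (fst q) < 1 \<and> cmod (snd q) < polar_radius m (fst q)"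
    using q egg_fiber(1)[OF m, of "fst q" "snd q"] by simp
  then show "0 \<le> egg_ratio m q" "egg_ratio m q < 1"
    using polar_radius_pos[of "fst q" m] by (auto simp: egg_ratio_def)
qed

text \<open>For \<open>p = (z, w)\<close> and \<open>q = (\<zeta>, \<eta>)\<close> the Cauchy-Schwarz inequality gives
  \<open>|1 - \<langle>z, \<zeta>\<rangle>|\<^sup>2 \<ge> (1 - |z|\<^sup>2) (1 - |\<zeta>|\<^sup>2)\<close>, that is \<open>|1 - \<langle>z, \<zeta>\<rangle>|\<^bsup>1/m\<^esup> \<ge> R(z) R(\<zeta>)\<close>, while \<open>|w| \<le> R(z)\<close>.\<close>

lemma cmod_X_egg_le:
  assumes m: "m \<ge> 1" and p: "p \<in> closure (egg m)" and q: "q \<in> egg m"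
  shows "cmod (X_egg m p q) \<le> egg_ratio m q"
proof -
  let ?a = "norm (fst p)" and ?b = "norm (fst q)" and ?h = "herm (fst p) (fst q)"
  note H = herm_closure_egg[OF m p q]
  have u: "1 - ?h \<noteq> 0" using H(5) by auto
  have R: "polar_radius m (fst q) > 0" by (rule polar_radius_pos[OF H(1)])
  have X: "cmod (X_egg m p q) = cmod (snd p) * cmod (snd q) / cmod (1 - ?h) powr (1 / real m)"
    unfolding X_egg_eq norm_divide norm_mult cmod_powr_of_real[OF u] by simp
  show ?thesis
  proof (cases "snd p = 0")
    case True
    then show ?thesis using X egg_ratio(1)[OF m q] by simp
  next
    case False
    have e: "?a\<^sup>2 + cmod (snd p) ^ (2 * m) \<le> 1" using p unfolding closure_egg[OF m] by simp
    moreover have "cmod (snd p) ^ (2 * m) > 0" using False by simp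
    ultimately have "?a\<^sup>2 < 1" by linarith
    then have a: "?a < 1" by (simp add: abs_square_less_1)
    have "cmod (snd p) ^ (2 * m) \<le> polar_radius m (fst p) ^ (2 * m)"
      using e polar_radius_power[OF a m] by simp
    then have w: "cmod (snd p) \<le> polar_radius m (fst p)"
      using polar_radius_pos[OF a, of m] m by (subst (asm) power_mono_iff) auto
    have ab: "?a * ?b < 1" using mult_strict_mono'[OF a H(1)] by simp
    define d where "d = 1 - ?a * ?b"
    have d: "d > 0" using ab by (simp add: d_def)
    have dle: "d \<le> cmod (1 - ?h)"
      using norm_triangle_ineq2[of 1 ?h] H(2) by (simp add: d_def)
    have "polar_radius m (fst p) * polar_radius m (fst q) = ((1 - ?a\<^sup>2) * (1 - ?b\<^sup>2)) powr (1 / (2 * real m))"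
      using one_minus_norm_pos[OF a] one_minus_norm_pos[OF H(1)] by (simp add: polar_radius_def powr_mult)
    also have "\<dots> \<le> (d\<^sup>2) powr (1 / (2 * real m))"
    proof (rule powr_mono2)
      have "d\<^sup>2 - (1 - ?a\<^sup>2) * (1 - ?b\<^sup>2) = (?a - ?b)\<^sup>2" by (simp add: d_def power2_eq_square algebra_simps)
      then show "(1 - ?a\<^sup>2) * (1 - ?b\<^sup>2) \<le> d\<^sup>2" using zero_le_power2[of "?a - ?b"] by linarith
    qed (use one_minus_norm_pos[OF a] one_minus_norm_pos[OF H(1)] in auto)
    also have "\<dots> = d powr (1 / real m)"
    proof -
      have "d\<^sup>2 = d powr 2" using d by simp
      then show ?thesis by (simp only: powr_powr) simp
    qed
    also have "\<dots> \<le> cmod (1 - ?h) powr (1 / real m)" using d dle by (intro powr_mono2) auto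
    finally have RR: "polar_radius m (fst p) * polar_radius m (fst q) \<le> cmod (1 - ?h) powr (1 / real m)" .
    have up: "cmod (1 - ?h) powr (1 / real m) > 0" using u by simp
    have "cmod (snd p) * polar_radius m (fst q) \<le> cmod (1 - ?h) powr (1 / real m)"
      using mult_right_mono[OF w, of "polar_radius m (fst q)"] R RR by linarith
    then have "cmod (snd p) / cmod (1 - ?h) powr (1 / real m) \<le> 1 / polar_radius m (fst q)"
      using R up by (simp add: divide_simps)
    from mult_left_mono[OF this, of "cmod (snd q)"] show ?thesis
      unfolding X egg_ratio_def by (simp add: mult_ac)
  qed
qed

text \<open>The term with \<open>X^g\<close> in the expansion of the conjugated kernel; conjugation exchanges the roles of \<open>p\<close>
  and \<open>q\<close> in the hermitian product.\<close>

definition kernel_term :: "nat \<Rightarrow> ('k::finite) cpoint \<Rightarrow> nat \<Rightarrow> 'k cpoint \<Rightarrow> complex" where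
  "kernel_term m q g p = of_real (C_egg (CARD('k) + 1) m * pochhammer (mu_egg (CARD('k) + 1) m + real g / real m) CARD('k))
     * ((cnj (snd p) * snd q) ^ g
     * (1 - herm (fst q) (fst p)) powr of_real (- (mu_egg (CARD('k) + 1) m + real g / real m + real CARD('k))))"

lemma kernel_term_eq:
  fixes p q :: "('k::finite) cpoint"
  assumes m: "m \<ge> 1" and p: "p \<in> closure (egg m)" and q: "q \<in> egg m"
  shows "cnj (kernel_term m q g p) = of_real (C_egg (CARD('k) + 1) m * pochhammer (mu_egg (CARD('k) + 1) m + real g / real m) CARD('k))
    * ((1 - herm (fst p) (fst q)) powr of_real (- real CARD('k) - mu_egg (CARD('k) + 1) m) * X_egg m p q ^ g)"
proof -
  let ?u = "1 - herm (fst p) (fst q)"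
  have u: "?u \<noteq> 0" "?u \<notin> \<real>\<^sub>\<le>\<^sub>0" using herm_closure_egg(5)[OF m p q] by (auto simp: complex_nonpos_Reals_iff)
  have c: "cnj (1 - herm (fst q) (fst p)) = ?u" by (simp add: cnj_herm)
  have u': "Im (1 - herm (fst q) (fst p)) = 0 \<Longrightarrow> 0 \<le> Re (1 - herm (fst q) (fst p))"
    using herm_closure_egg(5)[OF m p q] arg_cong[OF c, of Re] by simp
  have "cnj ((1 - herm (fst q) (fst p)) powr of_real (- (mu_egg (CARD('k) + 1) m + real g / real m + real CARD('k))))
     = ?u powr of_real (- (mu_egg (CARD('k) + 1) m + real g / real m + real CARD('k)))"
  proof -
    have E: "cnj ((1 - herm (fst q) (fst p)) powr b) = cnj (1 - herm (fst q) (fst p)) powr cnj b" for b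
      by (rule cnj_powr) (rule u')
    show ?thesis by (simp only: E c complex_cnj_complex_of_real)
  qed
  then have "cnj (kernel_term m q g p) = of_real (C_egg (CARD('k) + 1) m * pochhammer (mu_egg (CARD('k) + 1) m + real g / real m) CARD('k))
    * ((snd p * cnj (snd q)) ^ g * ?u powr of_real (- (mu_egg (CARD('k) + 1) m + real g / real m + real CARD('k))))"
    unfolding kernel_term_def by simp
  also have "(snd p * cnj (snd q)) ^ g * ?u powr of_real (- (mu_egg (CARD('k) + 1) m + real g / real m + real CARD('k))) =
      ?u powr of_real (- real CARD('k) - mu_egg (CARD('k) + 1) m) * X_egg m p q ^ g"
    unfolding X_egg_eq powr_times_quotient_power[OF u(1)] by (simp add: algebra_simps)
  finally show ?thesis .
qed

lemma kernel_term_sums: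
  fixes p q :: "('k::finite) cpoint"
  assumes m: "m \<ge> 1" and p: "p \<in> closure (egg m)" and q: "q \<in> egg m"
  shows "(\<lambda>g. kernel_term m q g p) sums cnj (egg_kernel m p q)"
proof -
  let ?mu = "mu_egg (CARD('k) + 1) m" and ?X = "X_egg m p q"
  have X: "cmod ?X < 1" using cmod_X_egg_le[OF m p q] egg_ratio(2)[OF m q] by simp
  have "(\<lambda>g. (of_real (C_egg (CARD('k) + 1) m) * (1 - herm (fst p) (fst q)) powr of_real (- real CARD('k) - ?mu)) *
      (complex_of_real (pochhammer (?mu + real g / real m) CARD('k)) * ?X ^ g)) sums egg_kernel m p q"
    unfolding egg_kernel_def by (rule sums_mult[OF P_poly_sums[OF X]])
  then have "(\<lambda>g. cnj (kernel_term m q g p)) sums egg_kernel m p q"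
    unfolding kernel_term_eq[OF m p q] by (simp add: mult_ac)
  then have "(\<lambda>g. cnj (cnj (kernel_term m q g p))) sums cnj (egg_kernel m p q)"
    by (subst sums_cnj)
  then show ?thesis by simp
qed

lemma C_egg_pos: "m \<ge> 1 \<Longrightarrow> C_egg n m > 0"
  by (simp add: C_egg_def)

lemma mu_egg_shift_pos: "m \<ge> 1 \<Longrightarrow> mu_egg n m + real g / real m > 0"
  using mu_egg_pos[of m n] by (simp add: add_pos_nonneg)

lemma kernel_term_bound:
  fixes q :: "('k::finite) cpoint"
  assumes m: "m \<ge> 1" and q: "q \<in> egg m"
  shows "\<exists>t. summable t \<and> (\<forall>g. \<forall>p\<in>closure (egg m). cmod (kernel_term m q g p) \<le> t g)"
proof -
  let ?mu = "mu_egg (CARD('k) + 1) m" and ?C = "C_egg (CARD('k) + 1) m"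
  define P where "P g = pochhammer (?mu + real g / real m) CARD('k)" for g
  define t where "t g = ?C * P g * ((1 - norm (fst q)) powr (- real CARD('k) - ?mu) * egg_ratio m q ^ g)" for g
  have Pp: "P g > 0" for g unfolding P_def by (rule pochhammer_pos[OF mu_egg_shift_pos[OF m]])
  note r = egg_ratio[OF m q]
  have "summable (\<lambda>g. complex_of_real (P g) * of_real (egg_ratio m q) ^ g)"
    unfolding P_def by (rule sums_summable[OF P_poly_sums]) (use r in simp)
  then have "summable (\<lambda>g. complex_of_real (P g * egg_ratio m q ^ g))" by simp
  then have "summable (\<lambda>g. P g * egg_ratio m q ^ g)" by (simp only: summable_of_real_iff)
  then have "summable (\<lambda>g. (?C * (1 - norm (fst q)) powr (- real CARD('k) - ?mu)) * (P g * egg_ratio m q ^ g))"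
    by (rule summable_mult)
  then have "summable t" by (simp add: t_def[abs_def] mult_ac)
  moreover have "cmod (kernel_term m q g p) \<le> t g" if p: "p \<in> closure (egg m)" for g p
  proof -
    note H = herm_closure_egg[OF m p q]
    let ?u = "1 - herm (fst p) (fst q)"
    have u: "?u \<noteq> 0" using H(5) by auto
    have PC: "cmod (of_real (?C * P g)) = ?C * P g"
      using mult_pos_pos[OF C_egg_pos[OF m, of "CARD('k) + 1"] Pp[of g]] by (simp only: norm_of_real abs_of_pos)
    have "cmod (kernel_term m q g p) = cmod (cnj (kernel_term m q g p))" by simp
    also have "\<dots> = ?C * P g * (cmod ?u powr (- real CARD('k) - ?mu) * cmod (X_egg m p q) ^ g)"
      unfolding kernel_term_eq[OF m p q] norm_mult norm_power cmod_powr_of_real[OF u] P_def[symmetric] PC by simp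
    also have "\<dots> \<le> t g"
      unfolding t_def
    proof (intro mult_left_mono mult_mono power_mono)
      show "cmod ?u powr (- real CARD('k) - ?mu) \<le> (1 - norm (fst q)) powr (- real CARD('k) - ?mu)"
        using H(1,4) mu_egg_pos[OF m, of "CARD('k) + 1"] by (intro powr_mono2') auto
      show "cmod (X_egg m p q) \<le> egg_ratio m q" by (rule cmod_X_egg_le[OF m p q])
    qed (use C_egg_pos[OF m, of "CARD('k) + 1"] Pp[of g] in auto)
    finally show ?thesis .
  qed
  ultimately show ?thesis by blast
qed

text \<open>The term with \<open>\<langle>\<zeta>, z\<rangle>^M\<close> in the binomial expansion of \<open>kernel_term m q g\<close>. The two rising factorials combine
  to a single one of length \<open>k + M\<close>.\<close>

definition kernel_monomial :: "nat \<Rightarrow> ('k::finite) cpoint \<Rightarrow> nat \<Rightarrow> nat \<Rightarrow> 'k cpoint \<Rightarrow> complex" where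
  "kernel_monomial m q g M p = of_real (C_egg (CARD('k) + 1) m * pochhammer (mu_egg (CARD('k) + 1) m + real g / real m) (CARD('k) + M) / fact M)
     * snd q ^ g * (cnj (snd p) ^ g * herm (fst q) (fst p) ^ M)"

lemma kernel_monomial_sums:
  fixes p q :: "('k::finite) cpoint"
  assumes m: "m \<ge> 1" and p: "p \<in> closure (egg m)" and q: "q \<in> egg m"
  shows "(\<lambda>M. kernel_monomial m q g M p) sums kernel_term m q g p"
proof -
  let ?c = "mu_egg (CARD('k) + 1) m + real g / real m"
  have "cmod (herm (fst q) (fst p)) = cmod (herm (fst p) (fst q))"
    by (metis cnj_herm complex_mod_cnj)
  then have h: "cmod (herm (fst q) (fst p)) < 1" using herm_closure_egg(1,3)[OF m p q] by simp
  have poch: "pochhammer ?c (CARD('k) + M) = pochhammer ?c CARD('k) * pochhammer (?c + real CARD('k)) M" for M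
    by (rule pochhammer_product')
  have "(\<lambda>M. (of_real (C_egg (CARD('k) + 1) m * pochhammer ?c CARD('k)) * (cnj (snd p) * snd q) ^ g) *
     (of_real (pochhammer (?c + real CARD('k)) M / fact M) * herm (fst q) (fst p) ^ M)) sums
     ((of_real (C_egg (CARD('k) + 1) m * pochhammer ?c CARD('k)) * (cnj (snd p) * snd q) ^ g) * (1 - herm (fst q) (fst p)) powr of_real (- (?c + real CARD('k))))"
    by (rule sums_mult[OF binomial_series_pochhammer[OF h]])
  moreover have "(of_real (C_egg (CARD('k) + 1) m * pochhammer ?c CARD('k)) * (cnj (snd p) * snd q) ^ g) *
     (of_real (pochhammer (?c + real CARD('k)) M / fact M) * herm (fst q) (fst p) ^ M) = kernel_monomial m q g M p" for M
    unfolding kernel_monomial_def poch by (simp add: power_mult_distrib mult_ac)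
  ultimately show ?thesis unfolding kernel_term_def by (simp only: mult.assoc)
qed

lemma kernel_monomial_bound:
  fixes q :: "('k::finite) cpoint"
  assumes m: "m \<ge> 1" and q: "q \<in> egg m"
  shows "\<exists>t. summable t \<and> (\<forall>M. \<forall>p\<in>closure (egg m). cmod (kernel_monomial m q g M p) \<le> t M)"
proof -
  let ?c = "mu_egg (CARD('k) + 1) m + real g / real m" and ?C = "C_egg (CARD('k) + 1) m"
  define P where "P M = pochhammer ?c (CARD('k) + M) / fact M" for M
  define t where "t M = ?C * P M * norm (fst q) ^ M" for M
  have q1: "norm (fst q) < 1" using q egg_fiber(1)[OF m, of "fst q" "snd q"] by simp
  have qc: "q \<in> closure (egg m)" using q closure_subset by blast
  have Pp: "P M > 0" for M unfolding P_def using pochhammer_pos[OF mu_egg_shift_pos[OF m]] by simp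
  have poch: "P M = pochhammer ?c CARD('k) * (pochhammer (?c + real CARD('k)) M / fact M)" for M
    by (simp add: P_def pochhammer_product')
  have "summable (\<lambda>M. of_real (pochhammer (?c + real CARD('k)) M / fact M) * complex_of_real (norm (fst q)) ^ M)"
    by (rule sums_summable[OF binomial_series_pochhammer]) (use q1 in simp)
  then have "summable (\<lambda>M. complex_of_real (pochhammer (?c + real CARD('k)) M / fact M * norm (fst q) ^ M))" by simp
  then have "summable (\<lambda>M. pochhammer (?c + real CARD('k)) M / fact M * norm (fst q) ^ M)" by (simp only: summable_of_real_iff)
  then have "summable (\<lambda>M. (?C * pochhammer ?c CARD('k)) * (pochhammer (?c + real CARD('k)) M / fact M * norm (fst q) ^ M))"
    by (rule summable_mult)
  then have "summable t" unfolding t_def[abs_def] poch by (simp add: mult_ac)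
  moreover have "cmod (kernel_monomial m q g M p) \<le> t M" if p: "p \<in> closure (egg m)" for M p
  proof -
    have h: "cmod (herm (fst q) (fst p)) \<le> norm (fst q)"
      using herm_closure_egg(3)[OF m p q] by (metis cnj_herm complex_mod_cnj)
    have PC: "cmod (of_real (?C * P M)) = ?C * P M"
      using mult_pos_pos[OF C_egg_pos[OF m, of "CARD('k) + 1"] Pp[of M]] by (simp only: norm_of_real abs_of_pos)
    have "cmod (kernel_monomial m q g M p) = ?C * P M * (cmod (snd q) ^ g * cmod (snd p) ^ g * cmod (herm (fst q) (fst p)) ^ M)"
      using PC unfolding kernel_monomial_def P_def norm_mult norm_power complex_mod_cnj times_divide_eq_right by (simp only: mult.assoc)
    also have "\<dots> \<le> ?C * P M * (1 * 1 * norm (fst q) ^ M)"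
      using C_egg_pos[OF m, of "CARD('k) + 1"] Pp[of M] h closure_egg_norm_le(2)[OF m p] closure_egg_norm_le(2)[OF m qc]
      by (intro mult_left_mono mult_mono power_mono power_le_one) auto
    finally show ?thesis by (simp add: t_def)
  qed
  ultimately show ?thesis by blast
qed

section \<open>The reproducing property\<close>

lemma fefferman_sums_integral:
  fixes F :: "nat \<Rightarrow> ('k::finite) cpoint \<Rightarrow> complex"
  assumes m: "m \<ge> 1" and c: "\<And>i. continuous_on (frontier (egg m)) (F i)"
    and b: "\<And>i p. p \<in> frontier (egg m) \<Longrightarrow> cmod (F i p) \<le> t i" and t: "summable t"
    and s: "\<And>p. p \<in> frontier (egg m) \<Longrightarrow> (\<lambda>i. F i p) sums G p"
  shows "(\<lambda>i. \<integral>p. F i p \<partial>fefferman_measure m) sums (\<integral>p. G p \<partial>fefferman_measure m)"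
proof -
  let ?M = "fefferman_measure m :: 'k cpoint measure"
  interpret finite_measure ?M by (rule finite_measure_fefferman_measure[OF m])
  note sp = space_fefferman_measure[OF m]
  have i: "integrable ?M (F i)" for i by (rule integrable_continuous_fefferman[OF m c])
  have "(\<lambda>i. \<integral>p. F i p \<partial>?M) sums (\<integral>p. (\<Sum>i. F i p) \<partial>?M)"
  proof (rule sums_integral[OF i])
    show "AE p in ?M. summable (\<lambda>i. norm (F i p))"
      by (rule AE_I2) (use b t in \<open>auto simp: sp intro: summable_comparison_test'\<close>)
    show "summable (\<lambda>i. \<integral>p. norm (F i p) \<partial>?M)"
    proof (rule summable_comparison_test')
      show "summable (\<lambda>i. t i * measure ?M (space ?M))" by (rule summable_mult2[OF t])
      fix i
      have "(\<integral>p. norm (F i p) \<partial>?M) \<le> (\<integral>p. t i \<partial>?M)"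
        by (rule integral_mono) (use i b in \<open>auto simp: sp\<close>)
      then show "norm (\<integral>p. norm (F i p) \<partial>?M) \<le> t i * measure ?M (space ?M)" by (simp add: mult.commute)
    qed
  qed
  also have "(\<integral>p. (\<Sum>i. F i p) \<partial>?M) = (\<integral>p. G p \<partial>?M)"
    by (rule Bochner_Integration.integral_cong) (use s in \<open>auto simp: sp sums_iff\<close>)
  finally show ?thesis .
qed

text \<open>The rising factorial is a quotient of Gamma functions that cancels the ratio in \<open>monomial_integral\<close>, and
  \<open>C_egg\<close> normalizes the constant of the measure. This identity fixes the constants of the kernel.\<close>

lemma kernel_constant:
  fixes k :: nat
  assumes m: "m \<ge> 1"
  shows "C_egg (k + 1) m * pochhammer (mu_egg (k + 1) m + real g / real m) (k + M) / fact M *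
    (polar_const k m * (pi ^ k * Gamma (mu_egg (k + 1) m + real g / real m) * fact M
       / Gamma (mu_egg (k + 1) m + real g / real m + real (k + M)))) = 1"
proof -
  define c where "c = mu_egg (k + 1) m + real g / real m"
  have c: "c > 0" unfolding c_def by (rule mu_egg_shift_pos[OF m])
  have poch: "pochhammer c (k + M) = Gamma (c + real (k + M)) / Gamma c"
    using pochhammer_Gamma[of c "k + M"] c by (auto dest: nonpos_Ints_nonpos simp: not_le[symmetric])
  have g: "Gamma c > 0" "Gamma (c + real (k + M)) > 0" using c by (auto intro!: Gamma_real_pos add_pos_nonneg)
  have m0: "real m > 0" using m by simp
  have "real m powr (1 - 2 / (real k + 2)) * real m powr (2 / (real k + 2)) = real m"
    using m0 by (simp flip: powr_add)
  then have K: "C_egg (k + 1) m * polar_const k m * pi ^ k = 1"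
    using m0 by (simp add: C_egg_def polar_const_def field_simps)
  have "C_egg (k + 1) m * pochhammer c (k + M) / fact M *
    (polar_const k m * (pi ^ k * Gamma c * fact M / Gamma (c + real (k + M))))
    = (C_egg (k + 1) m * polar_const k m * pi ^ k) * (pochhammer c (k + M) * Gamma c / Gamma (c + real (k + M)))"
    by (simp add: field_simps)
  also have "\<dots> = 1" unfolding K poch using g by simp
  finally show ?thesis unfolding c_def .
qed

text \<open>Integrating the double expansion of the conjugated kernel term by term, each monomial reproduces one
  homogeneous part of one Taylor coefficient of \<open>f\<close>. The bounds \<open>kernel_monomial_bound\<close> and
  \<open>kernel_term_bound\<close>, uniform on the boundary, justify the exchange of sum and integral.\<close>

theorem kernel_reproduces:
  fixes f :: "('k::finite) cpoint \<Rightarrow> complex"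
  assumes m: "m \<ge> 1" and f: "f \<in> holomorphic_near_closure m" and q: "q \<in> egg m"
  shows "(\<integral>p. f p * cnj (egg_kernel m p q) \<partial>fefferman_measure m) = f q"
proof -
  obtain U where U: "open U" "closure (egg m) \<subseteq> U" "holomorphic_several f U"
    using f by (auto simp: holomorphic_near_closure_def)
  interpret E: egg_holomorphic m f U by unfold_locales (use m U in auto)
  have fr: "frontier (egg m) \<subseteq> closure (egg m :: 'k cpoint set)" by (auto simp: frontier_def)
  have cf: "continuous_on (frontier (egg m)) f"
    by (rule continuous_on_subset[OF holomorphic_several_continuous_on[OF U(3)]]) (use U(2) fr in auto)
  obtain B where B: "B \<ge> 0" "\<And>p. p \<in> frontier (egg m) \<Longrightarrow> cmod (f p) \<le> B"
    using bounded_continuous_frontier_egg[OF m cf] by blast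
  have mono: "(\<integral>p. f p * kernel_monomial m q g M p \<partial>fefferman_measure m) = snd q ^ g * line_holomorphic.homog (E.w_coeff g) M (fst q)" for g M
  proof -
    let ?K = "C_egg (CARD('k) + 1) m * pochhammer (mu_egg (CARD('k) + 1) m + real g / real m) (CARD('k) + M) / fact M"
    have "(\<integral>p. f p * kernel_monomial m q g M p \<partial>fefferman_measure m) =
       (\<integral>p. (of_real ?K * snd q ^ g) * (f p * (cnj (snd p) ^ g * herm (fst q) (fst p) ^ M)) \<partial>fefferman_measure m)"
      by (intro Bochner_Integration.integral_cong refl) (simp add: kernel_monomial_def mult_ac)
    also have "\<dots> = (of_real ?K * snd q ^ g) * (\<integral>p. f p * (cnj (snd p) ^ g * herm (fst q) (fst p) ^ M) \<partial>fefferman_measure m)"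
      by (rule integral_mult_right_zero)
    also have "\<dots> = of_real (?K * (polar_const CARD('k) m * (pi ^ CARD('k) * Gamma (mu_egg (CARD('k) + 1) m + real g / real m) * fact M
       / Gamma (mu_egg (CARD('k) + 1) m + real g / real m + real (CARD('k) + M))))) * (snd q ^ g * line_holomorphic.homog (E.w_coeff g) M (fst q))"
      unfolding E.monomial_integral by (simp only: of_real_mult mult_ac)
    also have "\<dots> = snd q ^ g * line_holomorphic.homog (E.w_coeff g) M (fst q)"
      unfolding kernel_constant[OF m] by simp
    finally show ?thesis .
  qed
  have ckm: "continuous_on S (kernel_monomial m q g M)" for S g M
    unfolding kernel_monomial_def[abs_def] by (intro continuous_intros)
  have tm: "(\<integral>p. f p * kernel_term m q g p \<partial>fefferman_measure m) = E.w_coeff g (fst q) * snd q ^ g" for g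
  proof -
    from kernel_monomial_bound[OF m q, of g]
    obtain t where T: "summable t \<and> (\<forall>M. \<forall>p\<in>closure (egg m). cmod (kernel_monomial m q g M p) \<le> t M)" by (rule exE)
    have t: "summable t" "\<And>M p. p \<in> closure (egg m) \<Longrightarrow> cmod (kernel_monomial m q g M p) \<le> t M"
      using T by simp_all
    have "(\<lambda>M. \<integral>p. f p * kernel_monomial m q g M p \<partial>fefferman_measure m) sums (\<integral>p. f p * kernel_term m q g p \<partial>fefferman_measure m)"
    proof (rule fefferman_sums_integral[OF m])
      show "continuous_on (frontier (egg m)) (\<lambda>p. f p * kernel_monomial m q g M p)" for M
        by (intro continuous_on_mult cf ckm)
      show "summable (\<lambda>M. B * t M)" by (rule summable_mult[OF t(1)])
      fix p assume p: "p \<in> frontier (egg m :: 'k cpoint set)"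
      then have pc: "p \<in> closure (egg m)" using fr by auto
      show "cmod (f p * kernel_monomial m q g M p) \<le> B * t M" for M
        unfolding norm_mult using B(1) B(2)[OF p] t(2)[OF pc] by (intro mult_mono) auto
      show "(\<lambda>M. f p * kernel_monomial m q g M p) sums (f p * kernel_term m q g p)"
        by (rule sums_mult[OF kernel_monomial_sums[OF m pc q]])
    qed
    moreover have "(\<lambda>M. snd q ^ g * line_holomorphic.homog (E.w_coeff g) M (fst q)) sums (snd q ^ g * E.w_coeff g (fst q))"
      using q egg_fiber(1)[OF m, of "fst q" "snd q"] by (intro sums_mult E.homog_sums) simp
    ultimately show ?thesis unfolding mono by (simp add: sums_unique2 mult.commute)
  qed
  have ckt: "continuous_on (frontier (egg m)) (kernel_term m q g)" for g
  proof -
    have re: "Re (1 - herm (fst q) (fst p)) > 0" if "p \<in> frontier (egg m)" for p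
    proof -
      have "Re (1 - herm (fst p) (fst q)) > 0" using herm_closure_egg(5)[OF m _ q, of p] that fr by auto
      then show ?thesis using arg_cong[OF cnj_herm[of "fst p" "fst q"], of Re] by simp
    qed
    show ?thesis
      unfolding kernel_term_def[abs_def]
      by (intro continuous_on_mult continuous_on_const continuous_on_power continuous_on_cnj continuous_on_snd continuous_on_id
          continuous_on_powr_complex continuous_on_diff continuous_on_herm continuous_on_fst) (auto dest!: re)
  qed
  from kernel_term_bound[OF m q]
  obtain t where T: "summable t \<and> (\<forall>g. \<forall>p\<in>closure (egg m). cmod (kernel_term m q g p) \<le> t g)" by (rule exE)
  have t: "summable t" "\<And>g p. p \<in> closure (egg m) \<Longrightarrow> cmod (kernel_term m q g p) \<le> t g"
    using T by simp_all
  have "(\<lambda>g. \<integral>p. f p * kernel_term m q g p \<partial>fefferman_measure m) sums (\<integral>p. f p * cnj (egg_kernel m p q) \<partial>fefferman_measure m)"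
  proof (rule fefferman_sums_integral[OF m])
    show "continuous_on (frontier (egg m)) (\<lambda>p. f p * kernel_term m q g p)" for g
      by (intro continuous_on_mult cf ckt)
    show "summable (\<lambda>g. B * t g)" by (rule summable_mult[OF t(1)])
    fix p assume p: "p \<in> frontier (egg m :: 'k cpoint set)"
    then have pc: "p \<in> closure (egg m)" using fr by auto
    show "cmod (f p * kernel_term m q g p) \<le> B * t g" for g
      unfolding norm_mult using B(1) B(2)[OF p] t(2)[OF pc] by (intro mult_mono) auto
    show "(\<lambda>g. f p * kernel_term m q g p) sums (f p * cnj (egg_kernel m p q))"
      by (rule sums_mult[OF kernel_term_sums[OF m pc q]])
  qed
  moreover have "(\<lambda>g. E.w_coeff g (fst q) * snd q ^ g) sums f q"
    using E.w_coeff_sums[of "fst q" "snd q"] q by simp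
  ultimately show ?thesis unfolding tm by (rule sums_unique2)
qed

section \<open>The Hardy space and uniqueness of the kernel\<close>

lemma open_Re_herm: "open {p :: ('k::finite) cpoint. Re (1 - herm (fst p) \<zeta>) > 0}"
  by (intro open_Collect_less continuous_intros continuous_on_herm)

lemma complex_differentiable_one_minus_herm_powr:
  assumes "Re (1 - herm (fst p) \<zeta>) > 0"
  shows "complex_differentiable_at (\<lambda>p. (1 - herm (fst p) \<zeta>) powr of_real a) p"
proof -
  have "1 - herm (fst p) \<zeta> \<notin> \<real>\<^sub>\<le>\<^sub>0" using assms by (auto simp: complex_nonpos_Reals_iff)
  then have "((\<lambda>h. (1 - h) powr of_real a) has_field_derivative
      of_real a * (1 - herm (fst p) \<zeta>) powr (of_real a - 1) * (0 - 1)) (at (herm (fst p) \<zeta>))"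
    by (intro DERIV_chain2[OF has_field_derivative_powr] DERIV_diff DERIV_const DERIV_ident)
  then show ?thesis by (rule complex_differentiable_compose[OF complex_differentiable_herm])
qed

lemma complex_differentiable_const: "complex_differentiable_at (\<lambda>_. c) p"
proof -
  have "((\<lambda>_. c) has_field_derivative 0) (at (snd p))" by (rule DERIV_const)
  from complex_differentiable_compose[OF complex_differentiable_snd this] show ?thesis .
qed

lemma complex_differentiable_X_egg:
  assumes u: "Re (1 - herm (fst p) (fst q)) > 0"
  shows "complex_differentiable_at (\<lambda>p. X_egg m p q) p"
proof -
  have "(1 - herm (fst p) (fst q)) powr of_real (1 / real m) \<noteq> 0" using u by auto
  then have "(inverse has_field_derivative - (inverse ((1 - herm (fst p) (fst q)) powr of_real (1 / real m)) ^ Suc (Suc 0)))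
      (at ((1 - herm (fst p) (fst q)) powr of_real (1 / real m)))"
    by (rule DERIV_inverse)
  from complex_differentiable_compose[OF complex_differentiable_one_minus_herm_powr[OF u] this]
  have "complex_differentiable_at (\<lambda>p. inverse ((1 - herm (fst p) (fst q)) powr of_real (1 / real m))) p" .
  then have "complex_differentiable_at (\<lambda>p. snd p * cnj (snd q) * inverse ((1 - herm (fst p) (fst q)) powr of_real (1 / real m))) p"
    by (intro complex_differentiable_mult complex_differentiable_snd complex_differentiable_const)
  then show ?thesis unfolding X_egg_eq divide_inverse .
qed

text \<open>The formula is holomorphic where \<open>1 - \<langle>z, \<zeta>\<rangle>\<close> has positive real part and \<open>|X| < 1\<close>. This open set
  contains the closed domain when \<open>q\<close> is in the open domain.\<close>

lemma egg_kernel_holomorphic: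
  fixes q :: "('k::finite) cpoint"
  assumes m: "m \<ge> 1" and q: "q \<in> egg m"
  shows "(\<lambda>p. egg_kernel m p q) \<in> holomorphic_near_closure m"
proof -
  let ?U = "{p. Re (1 - herm (fst p) (fst q)) > 0}"
  let ?P = "P_poly m CARD('k) (mu_egg (CARD('k) + 1) m)"
  let ?V = "?U \<inter> (\<lambda>p. X_egg m p q) -` ball 0 1"
  have "holomorphic_several (\<lambda>p. X_egg m p q) ?U"
    unfolding holomorphic_several_iff by (auto intro: complex_differentiable_X_egg)
  then have "continuous_on ?U (\<lambda>p. X_egg m p q)" by (rule holomorphic_several_continuous_on)
  then have V: "open ?V" by (intro continuous_open_preimage open_Re_herm open_ball)
  have "closure (egg m) \<subseteq> ?V"
  proof
    fix p :: "'k cpoint" assume p: "p \<in> closure (egg m)"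
    have "cmod (X_egg m p q) < 1" using cmod_X_egg_le[OF m p q] egg_ratio(2)[OF m q] by linarith
    then show "p \<in> ?V" using herm_closure_egg(5)[OF m p q] by simp
  qed
  moreover have "complex_differentiable_at (\<lambda>p. egg_kernel m p q) p" if p: "p \<in> ?V" for p
  proof -
    have u: "Re (1 - herm (fst p) (fst q)) > 0" and X: "cmod (X_egg m p q) < 1" using p by auto
    have "(\<lambda>X. poly ?P X / (1 - X) ^ (CARD('k) + 1)) field_differentiable (at (X_egg m p q))"
    proof (rule field_differentiable_divide)
      show "poly ?P field_differentiable at (X_egg m p q)"
        using poly_DERIV field_differentiable_def by blast
      show "(\<lambda>X. (1 - X) ^ (CARD('k) + 1)) field_differentiable at (X_egg m p q)"
        by (intro field_differentiable_power field_differentiable_diff field_differentiable_const field_differentiable_ident)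
      show "(1 - X_egg m p q) ^ (CARD('k) + 1) \<noteq> 0" using X by auto
    qed
    then obtain D where "((\<lambda>X. poly ?P X / (1 - X) ^ (CARD('k) + 1)) has_field_derivative D) (at (X_egg m p q))"
      unfolding field_differentiable_def by (rule exE)
    from complex_differentiable_compose[OF complex_differentiable_X_egg[OF u] this]
    show ?thesis unfolding egg_kernel_def
      by (intro complex_differentiable_mult complex_differentiable_const complex_differentiable_one_minus_herm_powr u)
  qed
  ultimately show ?thesis
    unfolding holomorphic_near_closure_def holomorphic_several_iff mem_Collect_eq
    by (intro exI[of _ ?V] conjI ballI V)
qed

lemma square_integrable_holomorphic:
  fixes f :: "('k::finite) cpoint \<Rightarrow> complex"
  assumes m: "m \<ge> 1" and f: "f \<in> holomorphic_near_closure m"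
  shows "continuous_on (frontier (egg m)) f" "square_integrable (fefferman_measure m) f"
proof -
  obtain U where U: "closure (egg m) \<subseteq> U" "holomorphic_several f U"
    using f by (auto simp: holomorphic_near_closure_def)
  show c: "continuous_on (frontier (egg m)) f"
    by (rule continuous_on_subset[OF holomorphic_several_continuous_on[OF U(2)]]) (use U(1) in \<open>auto simp: frontier_def\<close>)
  have "continuous_on (frontier (egg m)) (\<lambda>p. complex_of_real ((cmod (f p))\<^sup>2))"
    by (intro continuous_on_of_real continuous_on_power continuous_on_norm c)
  then have "integrable (fefferman_measure m) (\<lambda>p. complex_of_real ((cmod (f p))\<^sup>2))"
    by (rule integrable_continuous_fefferman[OF m])
  from integrable_Re[OF this] have "integrable (fefferman_measure m) (\<lambda>p. (cmod (f p))\<^sup>2)" by (simp only: Re_complex_of_real)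
  then show "square_integrable (fefferman_measure m) f"
    unfolding square_integrable_def using borel_measurable_fefferman_measure[OF m c] by simp
qed

lemma hardy_pair_holomorphic:
  fixes f :: "('k::finite) cpoint \<Rightarrow> complex"
  assumes m: "m \<ge> 1" and f: "f \<in> holomorphic_near_closure m"
  shows "hardy_pair m f f"
  unfolding hardy_pair_def
proof (intro conjI exI[of _ "\<lambda>_. f"])
  show "square_integrable (fefferman_measure m) f" by (rule square_integrable_holomorphic[OF m f])
qed (use f in \<open>auto simp: L2_converges_def\<close>)

text \<open>On a finite measure space \<open>L\<^sup>2\<close> convergence implies convergence of integrals against bounded functions. In
  place of the Cauchy-Schwarz inequality, the proof uses \<open>|d| \<le> e + |d|\<^sup>2 / e\<close> with a small \<open>e\<close>.\<close>

lemma integral_mult_tendsto_L2: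
  fixes f :: "nat \<Rightarrow> 'a \<Rightarrow> complex"
  assumes "finite_measure M" and f: "\<And>j. square_integrable M (f j)" and g: "square_integrable M g"
    and lim: "L2_converges M f g" and h: "h \<in> borel_measurable M" and B: "\<And>x. x \<in> space M \<Longrightarrow> cmod (h x) \<le> B"
  shows "(\<lambda>j. \<integral>x. f j x * h x \<partial>M) \<longlonglongrightarrow> (\<integral>x. g x * h x \<partial>M)"
proof -
  interpret finite_measure M by fact
  have fm: "f j \<in> borel_measurable M" and gm: "g \<in> borel_measurable M" for j
    using f g by (auto simp: square_integrable_def)
  have i2: "integrable M (\<lambda>x. (cmod (f j x))\<^sup>2)" "integrable M (\<lambda>x. (cmod (g x))\<^sup>2)" for j
    using f g by (auto simp: square_integrable_def)
  have int1: "integrable M u" if um: "u \<in> borel_measurable M" and u2: "integrable M (\<lambda>x. (cmod (u x))\<^sup>2)" for u :: "'a \<Rightarrow> complex"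
  proof (rule Bochner_Integration.integrable_bound[OF Bochner_Integration.integrable_add[OF integrable_const[of "1::real"] u2] um])
    show "AE x in M. norm (u x) \<le> norm (1 + (cmod (u x))\<^sup>2)"
    proof (rule AE_I2)
      fix x
      have "0 \<le> (cmod (u x))\<^sup>2 - 2 * cmod (u x) + 1" "0 \<le> cmod (u x)"
        using zero_le_power2[of "cmod (u x) - 1"] by (simp_all add: power2_diff)
      then have "cmod (u x) \<le> 1 + (cmod (u x))\<^sup>2" by linarith
      then show "norm (u x) \<le> norm (1 + (cmod (u x))\<^sup>2)" by simp
    qed
  qed
  define d where "d j x = f j x - g x" for j x
  have dm: "d j \<in> borel_measurable M" for j unfolding d_def[abs_def] using fm gm by simp
  have d2: "integrable M (\<lambda>x. (cmod (d j x))\<^sup>2)" for j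
  proof (rule Bochner_Integration.integrable_bound[OF Bochner_Integration.integrable_add[OF integrable_mult_right[OF i2(1), of 2] integrable_mult_right[OF i2(2), of 2]]])
    show "(\<lambda>x. (cmod (d j x))\<^sup>2) \<in> borel_measurable M" using dm by simp
    show "AE x in M. norm ((cmod (d j x))\<^sup>2) \<le> norm (2 * (cmod (f j x))\<^sup>2 + 2 * (cmod (g x))\<^sup>2)"
    proof (rule AE_I2)
      fix x
      have "cmod (d j x) \<le> cmod (f j x) + cmod (g x)" unfolding d_def by (rule norm_triangle_ineq4)
      then have "(cmod (d j x))\<^sup>2 \<le> (cmod (f j x) + cmod (g x))\<^sup>2" by (intro power_mono) auto
      also have "\<dots> \<le> 2 * (cmod (f j x))\<^sup>2 + 2 * (cmod (g x))\<^sup>2"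
        using zero_le_power2[of "cmod (f j x) - cmod (g x)"] by (simp add: power2_diff power2_sum)
      finally show "norm ((cmod (d j x))\<^sup>2) \<le> norm (2 * (cmod (f j x))\<^sup>2 + 2 * (cmod (g x))\<^sup>2)" by simp
    qed
  qed
  have B0: "\<bar>B\<bar> \<ge> cmod (h x)" if "x \<in> space M" for x using B[OF that] by linarith
  have ih: "integrable M (\<lambda>x. u x * h x)" if "integrable M u" for u
  proof (rule Bochner_Integration.integrable_bound[OF integrable_mult_right[OF integrable_norm[OF that], of "\<bar>B\<bar>"]])
    show "(\<lambda>x. u x * h x) \<in> borel_measurable M" using that h by simp
    show "AE x in M. norm (u x * h x) \<le> norm (\<bar>B\<bar> * norm (u x))"
    proof (rule AE_I2)
      fix x assume "x \<in> space M"
      from mult_left_mono[OF B0[OF this] norm_ge_zero[of "u x"]]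
      show "norm (u x * h x) \<le> norm (\<bar>B\<bar> * norm (u x))" by (simp add: norm_mult mult.commute)
    qed
  qed
  define I where "I j = (\<integral>x. (cmod (d j x))\<^sup>2 \<partial>M)" for j
  have "(\<integral>\<^sup>+x. ennreal ((cmod (f j x - g x))\<^sup>2) \<partial>M) = ennreal (I j)" for j
    unfolding I_def d_def[symmetric] by (rule nn_integral_eq_integral[OF d2]) simp
  then have "(\<lambda>j. ennreal (I j)) \<longlonglongrightarrow> ennreal 0" using lim unfolding L2_converges_def by simp
  moreover have I0: "I j \<ge> 0" for j unfolding I_def by (rule integral_nonneg_AE) simp
  ultimately have I: "I \<longlonglongrightarrow> 0" by (subst (asm) tendsto_ennreal_iff) auto
  let ?W = "measure M (space M)"
  have est: "cmod ((\<integral>x. f j x * h x \<partial>M) - (\<integral>x. g x * h x \<partial>M)) \<le> \<bar>B\<bar> * (e * ?W + I j / e)" if e: "e > 0" for e j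
  proof -
    have "(\<integral>x. f j x * h x \<partial>M) - (\<integral>x. g x * h x \<partial>M) = (\<integral>x. d j x * h x \<partial>M)"
      unfolding d_def left_diff_distrib
      by (rule Bochner_Integration.integral_diff[symmetric]; rule ih; rule int1; fact fm gm i2)
    also have "cmod \<dots> \<le> (\<integral>x. norm (d j x * h x) \<partial>M)" by (rule integral_norm_bound)
    also have "\<dots> \<le> (\<integral>x. \<bar>B\<bar> * (e + (cmod (d j x))\<^sup>2 / e) \<partial>M)"
    proof (rule integral_mono)
      show "integrable M (\<lambda>x. norm (d j x * h x))" by (rule integrable_norm[OF ih[OF int1[OF dm d2]]])
      show "integrable M (\<lambda>x. \<bar>B\<bar> * (e + (cmod (d j x))\<^sup>2 / e))" using d2[of j] by simp
      fix x assume x: "x \<in> space M"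
      have "0 \<le> (cmod (d j x) - e)\<^sup>2" by simp
      moreover have "0 \<le> e * cmod (d j x)" using e by simp
      ultimately have "e * cmod (d j x) \<le> e * e + (cmod (d j x))\<^sup>2"
        unfolding power2_eq_square left_diff_distrib right_diff_distrib by (simp add: mult.commute)
      also have "\<dots> = e * (e + (cmod (d j x))\<^sup>2 / e)" using e by (simp add: distrib_left)
      finally have "cmod (d j x) \<le> e + (cmod (d j x))\<^sup>2 / e" using e by simp
      then have "cmod (h x) * cmod (d j x) \<le> \<bar>B\<bar> * (e + (cmod (d j x))\<^sup>2 / e)"
        by (intro mult_mono B0[OF x]) auto
      then show "norm (d j x * h x) \<le> \<bar>B\<bar> * (e + (cmod (d j x))\<^sup>2 / e)" by (simp add: norm_mult mult.commute)
    qed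
    also have "\<dots> = \<bar>B\<bar> * (e * ?W + I j / e)" using d2[of j] by (simp add: I_def mult.commute)
    finally show ?thesis .
  qed
  show ?thesis
  proof (rule LIMSEQ_I)
    fix r :: real assume r: "r > 0"
    define D where "D = \<bar>B\<bar> * ?W"
    have D: "D \<ge> 0" unfolding D_def by simp
    define e where "e = r / (2 * (D + 1))"
    have e: "e > 0" unfolding e_def using r D by simp
    have "e * D < e * (D + 1)" using e by simp
    also have "\<dots> = r / 2" unfolding e_def using D by (simp add: field_simps)
    finally have e1: "\<bar>B\<bar> * (e * ?W) < r / 2" unfolding D_def by (simp only: mult_ac)
    have lim0: "(\<lambda>j. \<bar>B\<bar> * (I j / e)) \<longlonglongrightarrow> \<bar>B\<bar> * (0 / e)" by (intro tendsto_mult tendsto_const tendsto_divide I) (use e in simp)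
    obtain N where N: "\<And>j. j \<ge> N \<Longrightarrow> \<bar>B\<bar> * (I j / e) < r / 2"
    proof -
      assume A: "\<And>N. (\<And>j. j \<ge> N \<Longrightarrow> \<bar>B\<bar> * (I j / e) < r / 2) \<Longrightarrow> thesis"
      obtain N where "\<forall>j\<ge>N. norm (\<bar>B\<bar> * (I j / e) - \<bar>B\<bar> * (0 / e)) < r / 2"
        using LIMSEQ_D[OF lim0 half_gt_zero[OF r]] by (rule exE)
      then have N: "norm (\<bar>B\<bar> * (I j / e) - \<bar>B\<bar> * (0 / e)) < r / 2" if "j \<ge> N" for j using that by simp
      show thesis
      proof (rule A)
        fix j assume "j \<ge> N"
        from N[OF this] show "\<bar>B\<bar> * (I j / e) < r / 2" by (simp only: real_norm_def div_0 mult_zero_right)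
      qed
    qed
    have "norm ((\<integral>x. f j x * h x \<partial>M) - (\<integral>x. g x * h x \<partial>M)) < r" if "j \<ge> N" for j
    proof -
      have "norm ((\<integral>x. f j x * h x \<partial>M) - (\<integral>x. g x * h x \<partial>M)) \<le> \<bar>B\<bar> * (e * ?W) + \<bar>B\<bar> * (I j / e)"
        using est[OF e, of j] unfolding distrib_left .
      also have "\<dots> < r / 2 + r / 2" by (rule add_strict_mono[OF e1 N[OF that]])
      finally show ?thesis by simp
    qed
    then show "\<exists>N. \<forall>j\<ge>N. norm ((\<integral>x. f j x * h x \<partial>M) - (\<integral>x. g x * h x \<partial>M)) < r" by blast
  qed
qed

theorem egg_kernel_is_fefferman_szego_kernel:
  assumes m: "m \<ge> 1"
  shows "is_fefferman_szego_kernel m (egg_kernel m :: ('k::finite) cpoint \<Rightarrow> 'k cpoint \<Rightarrow> complex)"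
  unfolding is_fefferman_szego_kernel_def
proof (intro ballI exI conjI allI impI)
  fix q :: "'k cpoint" assume q: "q \<in> egg m"
  note K = egg_kernel_holomorphic[OF m q]
  show "hardy_pair m (\<lambda>p. egg_kernel m p q) (\<lambda>p. egg_kernel m p q)"
    by (rule hardy_pair_holomorphic[OF m K])
  fix F g :: "'k cpoint \<Rightarrow> complex" assume H: "hardy_pair m F g"
  then obtain f where f: "\<And>j. f j \<in> holomorphic_near_closure m" "L2_converges (fefferman_measure m) f g"
    "(\<lambda>j. f j q) \<longlonglongrightarrow> F q" and g: "square_integrable (fefferman_measure m) g"
    unfolding hardy_pair_def using q by blast
  have c: "continuous_on (frontier (egg m)) (\<lambda>p. cnj (egg_kernel m p q))"
    by (intro continuous_on_cnj square_integrable_holomorphic(1)[OF m K])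
  obtain B where B: "\<And>p. p \<in> frontier (egg m) \<Longrightarrow> cmod (cnj (egg_kernel m p q)) \<le> B"
    using bounded_continuous_frontier_egg[OF m c] by blast
  have "(\<lambda>j. \<integral>p. f j p * cnj (egg_kernel m p q) \<partial>fefferman_measure m) \<longlonglongrightarrow>
      (\<integral>p. g p * cnj (egg_kernel m p q) \<partial>fefferman_measure m)"
    by (rule integral_mult_tendsto_L2[OF finite_measure_fefferman_measure[OF m] square_integrable_holomorphic(2)[OF m f(1)] g f(2)
          borel_measurable_fefferman_measure[OF m c]]) (use B space_fefferman_measure[OF m] in auto)
  then have "(\<lambda>j. f j q) \<longlonglongrightarrow> (\<integral>p. g p * cnj (egg_kernel m p q) \<partial>fefferman_measure m)"
    unfolding kernel_reproduces[OF m f(1) q] .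
  then show "F q = L2_inner (fefferman_measure m) g (\<lambda>p. egg_kernel m p q)"
    unfolding L2_inner_def by (rule LIMSEQ_unique[OF f(3)])
qed

lemma L2_inner_commute: "L2_inner M f g = cnj (L2_inner M g f)"
proof -
  have "L2_inner M f g = (LINT x|M. cnj (g x * cnj (f x)))" unfolding L2_inner_def by (simp add: mult.commute)
  also have "\<dots> = cnj (L2_inner M g f)" unfolding L2_inner_def by (rule Bochner_Integration.integral_cnj)
  finally show ?thesis .
qed

text \<open>Apply the reproducing property of \<open>T\<close> to \<open>S(\<cdot>, q)\<close> and that of \<open>S\<close> to \<open>T(\<cdot>, p)\<close>; both give the same
  inner product up to conjugation, so \<open>S p q = cnj (T q p)\<close>. The case \<open>S = T\<close> turns the right-hand side
  into \<open>T p q\<close>.\<close>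

lemma fefferman_szego_kernel_unique:
  assumes S: "is_fefferman_szego_kernel m S" and T: "is_fefferman_szego_kernel m T"
    and p: "p \<in> egg m" and q: "q \<in> egg m"
  shows "S p q = T p q"
proof -
  have cross: "S p q = cnj (T q p)" if S: "is_fefferman_szego_kernel m S" and T: "is_fefferman_szego_kernel m T"
    and p: "p \<in> egg m" and q: "q \<in> egg m" for S T p q
  proof -
    obtain s where s: "hardy_pair m (\<lambda>p. S p q) s" "\<And>F g. hardy_pair m F g \<Longrightarrow> F q = L2_inner (fefferman_measure m) g s"
      using S q unfolding is_fefferman_szego_kernel_def by blast
    obtain t where t: "hardy_pair m (\<lambda>q. T q p) t" "\<And>F g. hardy_pair m F g \<Longrightarrow> F p = L2_inner (fefferman_measure m) g t"
      using T p unfolding is_fefferman_szego_kernel_def by blast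
    have "S p q = L2_inner (fefferman_measure m) s t" by (rule t(2)[OF s(1)])
    also have "\<dots> = cnj (L2_inner (fefferman_measure m) t s)" by (rule L2_inner_commute)
    also have "L2_inner (fefferman_measure m) t s = T q p" by (rule s(2)[OF t(1), symmetric])
    finally show ?thesis .
  qed
  show ?thesis using cross[OF S T p q] cross[OF T T p q] by simp
qed

theorem theorem4p2:
  fixes n m k :: nat
  assumes "n \<ge> 2" and "m \<ge> 1" and "k = n - 1" and "CARD('k::finite) = k"
  shows "is_fefferman_szego_kernel m (fefferman_szego_kernel m :: 'k cpoint \<Rightarrow> 'k cpoint \<Rightarrow> complex) \<and>
    (\<forall>(z :: complex ^ 'k) w \<zeta> \<eta>. (z, w) \<in> egg m \<longrightarrow> (\<zeta>, \<eta>) \<in> egg m \<longrightarrow>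
      (let X = X_egg m (z, w) (\<zeta>, \<eta>) in
       fefferman_szego_kernel m (z, w) (\<zeta>, \<eta>) =
         complex_of_real (C_egg n m)
         * (1 - herm z \<zeta>) powr complex_of_real (- real k - mu_egg n m)
         * (poly (P_poly m k (mu_egg n m)) X / (1 - X) ^ n)))"
proof -
  have n: "CARD('k) = k" "n = CARD('k) + 1" using assms by auto
  note E = egg_kernel_is_fefferman_szego_kernel[OF assms(2), where 'k = 'k]
  have K: "is_fefferman_szego_kernel m (fefferman_szego_kernel m :: 'k cpoint \<Rightarrow> 'k cpoint \<Rightarrow> complex)"
    unfolding fefferman_szego_kernel_def by (rule someI[of "is_fefferman_szego_kernel m", OF E])
  have "fefferman_szego_kernel m p q = egg_kernel m p q" if "p \<in> egg m" "q \<in> egg m" for p q :: "'k cpoint"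
    by (rule fefferman_szego_kernel_unique[OF K E that])
  then show ?thesis using K unfolding Let_def egg_kernel_def n(1)[symmetric] n(2) by simp
qed

end
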